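(* Let $1/2<H<1$, $T>0$, $x\in\mathbb R^d$, and let $b=(b^1,\dots,b^d):\mathbb R^d\to\mathbb R^d$ and $\sigma=(\sigma^{i,j}):[0,T]\to\mathbb R^{d\times m}$ satisfy: (i) there exists $L_b$ such that $|b(z)-b(z')|\le L_b|z-z'|$ for all $z,z'\in\mathbb R^d$; (ii) there exists $\beta>1-H$ such that $\sigma\in C^\beta(0,T;\mathbb R^{d\times m})$; (iii) there exists $B<0$ such that $\langle z-y,\,b(z)-b(y)\rangle_{\mathbb R^d}\le B|z-y|^2$ for all $z,y\in\mathbb R^d$. Let $(X_t)_{t\in[0,T]}$ be the solution of $$X^i_t=x^i+\int_0^t b^i(X_s)\,\mathrm ds+\sum_{j=1}^m\int_0^t\sigma^{i,j}(s)\,\mathrm dB^{H,j}_s,\qquad t\in[0,T],\ i=1,\dots,d,$$ and let $V:\mathbb R^d\to\mathbb R$ be a function with $\|V\|_{\mathrm{Lip}}\le\alpha$, $\alpha>0$. Then for any $r>0$, $$\mathbb P_x\Big(\frac1T\int_0^T\big[V(X_t)-\mathbb E V(X_t)\big]\,\mathrm dt>r\Big)\le\exp\Big(-\frac{r^2B^2T^{2-2H}}{4\alpha^2H\,\|\sigma\|_{0,T,\infty}^2\,(1-e^{BT})}\Big).$$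
   Context: $B^H=(B^{H,1},\dots,B^{H,m})$ (not to be confused with the constant $B$) is an $m$-dimensional fractional Brownian motion with Hurst parameter $H$: its components are independent centered Gaussian processes with covariance $R_H(s,t)=\frac12(t^{2H}+s^{2H}-|t-s|^{2H})$. Stochastic integrals are pathwise Riemann--Stieltjes (Young) integrals. Under (i) and (ii) the equation has a unique adapted solution whose trajectories are Hölder continuous of order $H-\epsilon$ for every $\epsilon>0$. $\mathbb P_x$ denotes the law of the solution started from $x$. $C^\beta(0,T;E)$ is the space of $\beta$-Hölder continuous functions $[0,T]\to E$ ($E$ a Euclidean space with norm $|\cdot|$), $\|f\|_{0,T,\infty}=\sup_{0\le r\le T}|f(r)|$, and $\|V\|_{\mathrm{Lip}}=\sup_{y\ne z}\frac{|V(y)-V(z)|}{|y-z|}$. *)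

theory Defs
  imports "HOL-Probability.Probability"
begin

definition holder_on :: "real \<Rightarrow> real set \<Rightarrow> (real \<Rightarrow> 'e::real_normed_vector) \<Rightarrow> bool" where
  "holder_on \<beta> S f \<longleftrightarrow> (\<exists>C. \<forall>s\<in>S. \<forall>t\<in>S. norm (f s - f t) \<le> C * \<bar>s - t\<bar> powr \<beta>)"

text \<open>The supremum is taken in the extended reals, so that it is infinite for functions
  that are not Lipschitz.\<close>

definition lip_norm :: "('e::real_normed_vector \<Rightarrow> real) \<Rightarrow> ereal" where
  "lip_norm V = (SUP (y, z)\<in>{(y, z). y \<noteq> z}. ereal (\<bar>V y - V z\<bar> / norm (y - z)))"

text \<open>Riemann--Stieltjes integral of \<open>f\<close> against \<open>g\<close> over \<open>[a, b]\<close>: the limit of tagged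
  Riemann--Stieltjes sums as the mesh tends to zero. For Hoelder functions whose exponents sum to more
  than one this limit exists and is the Young integral. Degenerate intervals, which
  \<open>tagged_division_of\<close> admits, contribute nothing to the sums.\<close>

definition has_rs_integral ::
    "(real \<Rightarrow> real) \<Rightarrow> (real \<Rightarrow> real) \<Rightarrow> real \<Rightarrow> real \<Rightarrow> real \<Rightarrow> bool" where
  "has_rs_integral f g a b I \<longleftrightarrow>
    (\<forall>e>0. \<exists>\<delta>>0. \<forall>D. D tagged_division_of {a..b} \<and> (\<forall>(u, K)\<in>D. Sup K - Inf K < \<delta>) \<longrightarrow>
      \<bar>(\<Sum>(u, K)\<in>D. f u * (g (Sup K) - g (Inf K))) - I\<bar> < e)"

text \<open>Constants count as (degenerate) Gaussian random variables.\<close>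

definition gaussian_rv :: "'a measure \<Rightarrow> ('a \<Rightarrow> real) \<Rightarrow> bool" where
  "gaussian_rv M Z \<longleftrightarrow> Z \<in> borel_measurable M \<and>
    ((\<exists>\<mu>. AE \<omega> in M. Z \<omega> = \<mu>) \<or>
     (\<exists>\<mu> s. 0 < s \<and> distributed M lborel Z (normal_density \<mu> s)))"

definition gaussian_process :: "'a measure \<Rightarrow> real set \<Rightarrow> (real \<Rightarrow> 'a \<Rightarrow> real) \<Rightarrow> bool" where
  "gaussian_process M I Z \<longleftrightarrow>
    (\<forall>S c. finite S \<and> S \<subseteq> I \<longrightarrow> gaussian_rv M (\<lambda>\<omega>. \<Sum>t\<in>S. c t * Z t \<omega>))"

definition fbm_cov :: "real \<Rightarrow> real \<Rightarrow> real \<Rightarrow> real" where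
  "fbm_cov H s t = (s powr (2 * H) + t powr (2 * H) - \<bar>t - s\<bar> powr (2 * H)) / 2"

text \<open>Independence of the components is independence of the processes, i.e. of the random
  functions they define on the time set \<open>I\<close>.\<close>

definition fractional_brownian_motion ::
    "'a measure \<Rightarrow> real \<Rightarrow> real set \<Rightarrow> (real \<Rightarrow> 'a \<Rightarrow> real ^ 'm) \<Rightarrow> bool" where
  "fractional_brownian_motion M H I W \<longleftrightarrow>
    (\<forall>j. gaussian_process M I (\<lambda>t \<omega>. W t \<omega> $ j) \<and>
         (\<forall>t\<in>I. (\<integral>\<omega>. W t \<omega> $ j \<partial>M) = 0) \<and>
         (\<forall>s\<in>I. \<forall>t\<in>I. (\<integral>\<omega>. W s \<omega> $ j * W t \<omega> $ j \<partial>M) = fbm_cov H s t)) \<and>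
    prob_space.indep_vars M (\<lambda>j. PiM I (\<lambda>_. borel)) (\<lambda>j \<omega>. \<lambda>t\<in>I. W t \<omega> $ j) UNIV"

definition augmented_filtration :: "'a measure \<Rightarrow> (real \<Rightarrow> 'a \<Rightarrow> real ^ 'm) \<Rightarrow> real \<Rightarrow> 'a measure" where
  "augmented_filtration M W t = sigma (space M)
    ({W s -` A \<inter> space M | s A. s \<in> {0..t} \<and> A \<in> sets borel} \<union> null_sets M)"

text \<open>Adapted solutions on \<open>[0, T]\<close>, with Hoelder trajectories, of
  \<open>dX = b(X) dt + \<sigma> dW\<close>, \<open>X_0 = x\<close>. The existence of the pathwise Stieltjes integrals is
  part of the equation.\<close>

definition fbm_sde_solution ::
    "'a measure \<Rightarrow> real \<Rightarrow> real \<Rightarrow> (real \<Rightarrow> 'a \<Rightarrow> real ^ 'm) \<Rightarrow> (real ^ 'd \<Rightarrow> real ^ 'd) \<Rightarrow>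
     (real \<Rightarrow> real ^ 'm ^ 'd) \<Rightarrow> real ^ 'd \<Rightarrow> (real \<Rightarrow> 'a \<Rightarrow> real ^ 'd) \<Rightarrow> bool" where
  "fbm_sde_solution M H T W b \<sigma> x X \<longleftrightarrow>
    (\<forall>t\<in>{0..T}. X t \<in> borel_measurable (augmented_filtration M W t)) \<and>
    (\<forall>\<omega>\<in>space M. \<forall>\<epsilon>. 0 < \<epsilon> \<and> \<epsilon> < H \<longrightarrow> holder_on (H - \<epsilon>) {0..T} (\<lambda>t. X t \<omega>)) \<and>
    (AE \<omega> in M. \<forall>t\<in>{0..T}. \<forall>i. \<exists>J.
       (\<forall>j. has_rs_integral (\<lambda>s. \<sigma> s $ i $ j) (\<lambda>s. W s \<omega> $ j) 0 t (J j)) \<and>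
       X t \<omega> $ i = x $ i + integral {0..t} (\<lambda>s. b (X s \<omega>) $ i) + (\<Sum>j\<in>UNIV. J j))"

end

theory Submission
  imports Defs
begin

text \<open>The time average of \<open>V (X t)\<close> is a functional of the Gaussian noise, and such a functional
  fluctuates no more than its Lipschitz constant allows. If \<open>\<xi>\<close> is a standard Gaussian vector and
  \<open>f\<close> is \<open>c\<close>-Lipschitz for the Euclidean norm, then
  \<open>E exp (\<theta> (f \<xi> - E f \<xi>)) \<le> exp (\<theta>\<^sup>2 c\<^sup>2 / 2)\<close> for every \<open>\<theta>\<close>
  (\<open>std_gauss_concentration\<close>), and Markov's inequality turns this into the tail bound
  \<open>exp (- r\<^sup>2 / (2 c\<^sup>2))\<close>. What has to be found is a Lipschitz constant of the time average, in the
  coordinates in which the noise is standard.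

  The equation is discretised by the Euler scheme with step \<open>h = T / n\<close>, whose noise in each block is
  a finely subdivided Riemann--Stieltjes sum of \<open>\<sigma>\<close> against the fractional Brownian motion. The scheme
  reads only finitely many values of the motion, and these are the image \<open>A \<xi>\<close> of a standard
  vector, where \<open>A\<close> is a Gram factor of the covariance matrix (\<open>fbm_law\<close>). Two facts bound the effect of
  a shift \<open>\<delta>\<close> of \<open>\<xi>\<close>. First, dissipativity makes one Euler step contract by about \<open>1 + B h\<close>, so a change
  of the noise by \<open>d 0, d 1, \<dots>\<close> changes the averaged scheme by at most
  \<open>(1 - exp (B T)) / (- B T)\<close> times \<open>\<alpha> (\<Sum>l. norm (d l))\<close>, asymptotically in \<open>n\<close>
  (\<open>euler_sum_stability\<close>, \<open>average_gain_eventually\<close>). Second, because \<open>H > 1 / 2\<close>, the increments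
  of the motion are nonnegatively correlated, and their covariances add up to the variance
  \<open>T powr (2 * H)\<close> of the motion at time \<open>T\<close>; by duality and the Cauchy--Schwarz inequality the increments
  of \<open>A \<delta>\<close> have total variation at most \<open>T powr H * norm \<delta>\<close> (\<open>gram_total_variation\<close>). This
  bound is the discrete form of the comparison with the Cameron--Martin norm of the process.

  Altogether the Lipschitz constant tends to
  \<open>\<alpha> (SUP s. norm (\<sigma> s)) T powr H (1 - exp (B T)) / (- B T)\<close>. The bound of the theorem corresponds to the
  larger constant in which \<open>q = 1 - exp (B T)\<close> is replaced by \<open>sqrt (2 H q)\<close>. Since
  \<open>q\<^sup>2 < q < 2 H q\<close>, the gap is strict and absorbs the discretisation error.

  The exponential bound survives almost sure limits, and the centre of the limit is then automatically
  its expectation (\<open>subgaussian_limit\<close>). This is used to refine the Riemann--Stieltjes sums, to let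
  the Euler step tend to zero, and, applied to \<open>V (X t)\<close> at a single time, to see that these variables
  are integrable with an expectation continuous in \<open>t\<close>, so that the expectation of the time
  average is the time average of the expectations.

  The concentration inequality itself is obtained, with its sharp constant and without any
  smoothness of \<open>f\<close>, from the Prekopa--Leindler inequality on the line: it gives a
  one-dimensional transport inequality for pairs \<open>u x \<le> f y + a (x - y)\<^sup>2 / 2\<close>, which tensorises.\<close>

section \<open>The Prekopa--Leindler inequality on the line\<close>

lemma positive_density_cdf:
  fixes f :: "real \<Rightarrow> real"
  assumes cont: "continuous_on UNIV f" and pos: "\<And>x. f x > 0"
    and int: "integrable lborel f" and one: "(\<integral>x. f x \<partial>lborel) = 1"
  obtains F where "\<And>x. (F has_real_derivative f x) (at x)" "\<And>x. 0 < F x" "\<And>x. F x < 1"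
    "\<And>y. 0 < y \<Longrightarrow> y < 1 \<Longrightarrow> \<exists>x. F x = y"
proof -
  have f_meas[measurable]: "f \<in> borel_measurable borel"
    using cont by (rule borel_measurable_continuous_onI)
  define N where "N = density lborel f"
  interpret N: prob_space N
  proof
    have "emeasure N (space N) = (\<integral>\<^sup>+x. ennreal (f x) \<partial>lborel)"
      unfolding N_def by (subst emeasure_density) auto
    also have "\<dots> = 1"
      using int one pos by (subst nn_integral_eq_integral) (auto intro: less_imp_le)
    finally show "emeasure N (space N) = 1" .
  qed
  interpret N: real_distribution N
    by standard (simp add: N_def)
  have diff: "cdf N b - cdf N a = integral {a..b} f" if "a \<le> b" for a b
  proof -
    have fin: "f integrable_on {a..b}"
      using cont by (intro integrable_continuous_interval) (auto intro: continuous_on_subset)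
    have "cdf N b - cdf N a = measure N {a<..b}"
    proof (cases "a = b")
      case False
      then show ?thesis using that N.cdf_diff_eq[of a b] by simp
    qed simp
    also have "\<dots> = enn2real (\<integral>\<^sup>+x\<in>{a<..b}. ennreal (f x) \<partial>lborel)"
      unfolding measure_def N_def by (subst emeasure_density) (auto simp: mult.commute)
    also have "(\<integral>\<^sup>+x\<in>{a<..b}. ennreal (f x) \<partial>lborel) = (\<integral>\<^sup>+x\<in>{a..b}. ennreal (f x) \<partial>lborel)"
      by (intro nn_integral_cong_AE, use AE_lborel_singleton[of a] in eventually_elim)
        (auto simp: indicator_def)
    also have "\<dots> = ennreal (integral {a..b} f)"
      using fin pos
      by (intro nn_integral_has_integral_lebesgue') (auto intro: less_imp_le)
    also have "enn2real \<dots> = integral {a..b} f"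
      using pos by (intro enn2real_ennreal integral_nonneg fin) (auto intro: less_imp_le)
    finally show ?thesis .
  qed
  have der: "(cdf N has_real_derivative f x) (at x)" for x
  proof -
    have "((\<lambda>y. integral {x-1..y} f) has_real_derivative f x) (at x within {x-1..x+1})"
      using cont by (intro integral_has_real_derivative) (auto intro: continuous_on_subset)
    then have "((\<lambda>y. integral {x-1..y} f) has_real_derivative f x) (at x)"
      by (simp add: at_within_Icc_at)
    then have "((\<lambda>y. cdf N (x-1) + integral {x-1..y} f) has_real_derivative f x) (at x)"
      by (auto intro!: derivative_eq_intros)
    then show ?thesis
    proof (rule has_field_derivative_transform_within[where d=1])
      fix y assume "dist y x < 1"
      then have "x - 1 \<le> y" by (auto simp: dist_real_def)
      from diff[OF this] show "cdf N (x-1) + integral {x-1..y} f = cdf N y" by simp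
    qed simp_all
  qed
  have smono: "cdf N a < cdf N b" if "a < b" for a b
    using der pos by (intro DERIV_pos_imp_increasing[OF that]) blast
  have pos': "0 < cdf N x" for x
    using smono[of "x-1" x] N.cdf_nonneg[of "x-1"] by simp
  have lt1: "cdf N x < 1" for x
    using smono[of x "x+1"] N.cdf_bounded_prob[of "x+1"] by simp
  have surj: "\<exists>x. cdf N x = y" if y: "0 < y" "y < 1" for y
  proof -
    have "\<forall>\<^sub>F x in at_bot. cdf N x < y"
      using y by (intro order_tendstoD(2)[OF N.cdf_lim_at_bot])
    then obtain a where a: "cdf N a < y" by (auto simp: eventually_at_bot_linorder)
    have "\<forall>\<^sub>F x in at_top. cdf N x > y"
      using y by (intro order_tendstoD(1)[OF N.cdf_lim_at_top_prob])
    then obtain b where b: "cdf N b > y" by (auto simp: eventually_at_top_linorder)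
    have "a \<le> b" using a b smono[of b a] by (cases "a \<le> b") auto
    have "\<exists>x. a \<le> x \<and> x \<le> b \<and> cdf N x = y"
      using a b \<open>a \<le> b\<close> by (intro IVT) (auto intro: DERIV_isCont[OF der])
    then show ?thesis by auto
  qed
  show ?thesis using that[OF der pos' lt1 surj] .
qed

text \<open>Monotone transport: \<open>S\<close> carries the density \<open>g\<close> to the density \<open>f\<close>, that is
  \<open>g y = f (S y) * S' y\<close>. Substituting \<open>z = t * S y + (1 - t) * y\<close> in the integral of \<open>h\<close> and using
  \<open>S' powr t \<le> t * S' + (1 - t)\<close> leaves the integral of \<open>g\<close>.\<close>

lemma prekopa_leindler_normalised:
  fixes f g h :: "real \<Rightarrow> real"
  assumes f: "continuous_on UNIV f" "\<And>x. f x > 0" "integrable lborel f" "(\<integral>x. f x \<partial>lborel) = 1"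
    and g: "continuous_on UNIV g" "\<And>x. g x > 0" "integrable lborel g" "(\<integral>x. g x \<partial>lborel) = 1"
    and h[measurable]: "h \<in> borel_measurable borel"
    and t: "0 < t" "t < 1"
    and ineq: "\<And>x y. f x powr t * g y powr (1 - t) \<le> h (t * x + (1 - t) * y)"
  shows "1 \<le> (\<integral>\<^sup>+x. ennreal (h x) \<partial>lborel)"
proof -
  have gm[measurable]: "g \<in> borel_measurable borel"
    using g(1) by (rule borel_measurable_continuous_onI)
  obtain F where F: "\<And>x. (F has_real_derivative f x) (at x)" "\<And>x. 0 < F x" "\<And>x. F x < 1"
    "\<And>y. 0 < y \<Longrightarrow> y < 1 \<Longrightarrow> \<exists>x. F x = y"
    using positive_density_cdf[OF f] by blast
  obtain G where G: "\<And>x. (G has_real_derivative g x) (at x)" "\<And>x. 0 < G x" "\<And>x. G x < 1"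
    "\<And>y. 0 < y \<Longrightarrow> y < 1 \<Longrightarrow> \<exists>x. G x = y"
    using positive_density_cdf[OF g] by blast
  have Fmono: "F a < F b" if "a < b" for a b
    using F(1) f(2) by (intro DERIV_pos_imp_increasing[OF that]) blast
  have Finj: "inj F"
    using Fmono by (intro linorder_injI) (simp add: less_imp_neq)
  define R where "R = inv F"
  have FR: "F (R y) = y" if "0 < y" "y < 1" for y
    using F(4)[OF that] unfolding R_def by (metis f_inv_into_f rangeI)
  have RF: "R (F x) = x" for x
    unfolding R_def using Finj by simp
  have Fcont: "isCont F x" for x by (rule DERIV_isCont[OF F(1)])
  have Rder: "(R has_real_derivative inverse (f (R y))) (at y)" if y: "0 < y" "y < 1" for y
  proof (rule DERIV_inverse_function)
    show "(F has_real_derivative f (R y)) (at (R y))" by (rule F)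
    show "f (R y) \<noteq> 0" using f(2)[of "R y"] by simp
    show "0 < y" "y < 1" by fact+
    show "\<And>y. 0 < y \<Longrightarrow> y < 1 \<Longrightarrow> F (R y) = y" by (rule FR)
    have "isCont R (F (R y))"
      by (rule isCont_inverse_function[where d=1]) (use RF Fcont in auto)
    then show "isCont R y" using FR[OF y] by simp
  qed
  define S where "S = (\<lambda>y. R (G y))"
  have Sder: "(S has_real_derivative g y / f (S y)) (at y)" for y
    using DERIV_chain2[OF Rder[OF G(2,3)] G(1), of y]
    by (simp add: S_def divide_inverse mult.commute)
  have Scont: "continuous_on UNIV S"
    by (intro continuous_at_imp_continuous_on ballI DERIV_isCont[OF Sder])
  define z where "z = (\<lambda>y. t * S y + (1 - t) * y)"
  define z' where "z' = (\<lambda>y. t * (g y / f (S y)) + (1 - t))"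
  have zder: "(z has_real_derivative z' y) (at y)" for y
    unfolding z_def z'_def by (auto intro!: derivative_eq_intros Sder)
  have fS: "continuous_on UNIV (\<lambda>y. f (S y))"
    using continuous_on_compose2[OF f(1) Scont] by simp
  have z'cont: "continuous_on UNIV z'"
    unfolding z'_def using f(2) by (intro continuous_intros g(1) fS) (metis less_irrefl)
  have ratio: "0 < g y / f (S y)" for y using f(2) g(2) by simp
  have z'pos: "0 \<le> z' y" for y
    unfolding z'_def using ratio[of y] t by (intro add_nonneg_nonneg mult_nonneg_nonneg) auto
  have key: "g y \<le> h (z y) * z' y" for y
  proof -
    have "(g y / f (S y)) powr t \<le> z' y"
    proof -
      have "exp ((1 - t) *\<^sub>R 0 + t *\<^sub>R ln (g y / f (S y)))
          \<le> (1 - t) * exp 0 + t * exp (ln (g y / f (S y)))"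
        using t by (intro convex_onD[OF exp_convex]) auto
      moreover have "(g y / f (S y)) powr t = exp ((1 - t) *\<^sub>R 0 + t *\<^sub>R ln (g y / f (S y)))"
        using ratio[of y] unfolding powr_def by (auto simp: less_imp_neq)
      moreover have "exp (ln (g y / f (S y))) = g y / f (S y)"
        using ratio[of y] by (rule exp_ln)
      ultimately show ?thesis unfolding z'_def by simp
    qed
    moreover have "f (S y) powr t * g y powr (1 - t) \<le> h (z y)"
      unfolding z_def by (rule ineq)
    moreover from this have "0 \<le> h (z y)"
      by (rule order_trans[rotated]) simp
    ultimately have "(f (S y) powr t * g y powr (1 - t)) * (g y / f (S y)) powr t \<le> h (z y) * z' y"
      by (intro mult_mono) simp_all
    moreover have "(f (S y) powr t * g y powr (1 - t)) * (g y / f (S y)) powr t = g y"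
    proof -
      have "(f (S y) powr t * g y powr (1 - t)) * (g y / f (S y)) powr t
          = (f (S y) * (g y / f (S y))) powr t * g y powr (1 - t)"
        using ratio[of y] f(2)[of "S y"] by (subst powr_mult) (auto simp: less_imp_le)
      also have "\<dots> = g y powr t * g y powr (1 - t)" using f(2)[of "S y"] by simp
      also have "\<dots> = g y" using g(2)[of y] by (simp flip: powr_add)
      finally show ?thesis .
    qed
    ultimately show ?thesis by simp
  qed
  \<comment> \<open>the substitution is made on bounded intervals, which then exhaust the line\<close>
  have part: "(\<integral>\<^sup>+y. ennreal (g y) * indicator {-real n..real n} y \<partial>lborel) \<le> (\<integral>\<^sup>+x. ennreal (h x) \<partial>lborel)" for n
  proof -
    have "(\<integral>\<^sup>+y. ennreal (g y) * indicator {-real n..real n} y \<partial>lborel)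
       \<le> (\<integral>\<^sup>+y. ennreal (h (z y) * z' y * indicator {-real n..real n} y) \<partial>lborel)"
      using key by (intro nn_integral_mono) (auto simp: indicator_def intro: ennreal_leI)
    also have "\<dots> = (\<integral>\<^sup>+x. ennreal (h x * indicator {z (-real n)..z (real n)} x) \<partial>lborel)"
    proof (rule nn_integral_substitution[symmetric])
      show "set_borel_measurable borel {z (-real n)..z (real n)} h"
        unfolding set_borel_measurable_def by measurable
      show "(z has_real_derivative z' y) (at y)" for y by (rule zder)
      show "continuous_on {-real n..real n} z'" using z'cont by (rule continuous_on_subset) simp
    qed (use z'pos in auto)
    also have "\<dots> \<le> (\<integral>\<^sup>+x. ennreal (h x) \<partial>lborel)"
      by (intro nn_integral_mono) (auto simp: indicator_def)
    finally show ?thesis .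
  qed
  have "1 = (\<integral>\<^sup>+y. ennreal (g y) \<partial>lborel)"
    using g by (subst nn_integral_eq_integral) (auto intro: less_imp_le)
  also have "\<dots> = (\<integral>\<^sup>+y. (SUP n. ennreal (g y) * indicator {-real n..real n} y) \<partial>lborel)"
  proof (rule nn_integral_cong)
    fix y :: real
    obtain n :: nat where n: "\<bar>y\<bar> \<le> real n" using real_arch_simple by blast
    show "ennreal (g y) = (SUP n. ennreal (g y) * indicator {-real n..real n} y)"
    proof (rule antisym)
      show "ennreal (g y) \<le> (SUP n. ennreal (g y) * indicator {-real n..real n} y)"
        using n by (intro SUP_upper2[of n]) (auto simp: indicator_def)
    qed (auto intro!: SUP_least simp: indicator_def)
  qed
  also have "\<dots> = (SUP n. (\<integral>\<^sup>+y. ennreal (g y) * indicator {-real n..real n} y \<partial>lborel))"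
    by (intro nn_integral_monotone_convergence_SUP)
       (auto simp: incseq_def le_fun_def indicator_def)
  also have "\<dots> \<le> (\<integral>\<^sup>+x. ennreal (h x) \<partial>lborel)"
    by (intro SUP_least part)
  finally show ?thesis .
qed

lemma prekopa_leindler_real:
  fixes f g h :: "real \<Rightarrow> real"
  assumes f: "continuous_on UNIV f" "\<And>x. f x > 0" "integrable lborel f"
    and g: "continuous_on UNIV g" "\<And>x. g x > 0" "integrable lborel g"
    and h[measurable]: "h \<in> borel_measurable borel"
    and t: "0 < t" "t < 1"
    and ineq: "\<And>x y. f x powr t * g y powr (1 - t) \<le> h (t * x + (1 - t) * y)"
  shows "ennreal ((\<integral>x. f x \<partial>lborel) powr t * (\<integral>x. g x \<partial>lborel) powr (1 - t))
    \<le> (\<integral>\<^sup>+x. ennreal (h x) \<partial>lborel)"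
proof -
  have pos: "0 < (\<integral>x. u x \<partial>lborel)" if u: "\<And>x. u x > 0" "integrable lborel u" for u :: "real \<Rightarrow> real"
  proof -
    have "(\<integral>x. u x \<partial>lborel) \<noteq> 0"
    proof
      assume "(\<integral>x. u x \<partial>lborel) = 0"
      then have "AE x in lborel. u x = 0"
        using u by (subst (asm) integral_nonneg_eq_0_iff_AE) (auto intro: less_imp_le)
      then have "AE x in (lborel::real measure). False"
        by eventually_elim (use u(1) in \<open>metis less_irrefl\<close>)
      then have "(UNIV::real set) \<in> null_sets lborel"
        by (simp add: AE_iff_null)
      then show False by (simp add: null_sets_def)
    qed
    moreover have "0 \<le> (\<integral>x. u x \<partial>lborel)"
      using u by (intro integral_nonneg_AE) (auto intro: less_imp_le)
    ultimately show ?thesis by simp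
  qed
  define a where "a = (\<integral>x. f x \<partial>lborel)"
  define b where "b = (\<integral>x. g x \<partial>lborel)"
  have ab: "0 < a" "0 < b" unfolding a_def b_def using pos f g by auto
  define c where "c = a powr t * b powr (1 - t)"
  have c: "0 < c" unfolding c_def using ab by simp
  have "1 \<le> (\<integral>\<^sup>+x. ennreal (h x / c) \<partial>lborel)"
  proof (rule prekopa_leindler_normalised[of "\<lambda>x. f x / a" "\<lambda>x. g x / b" _ t])
    show "(f x / a) powr t * (g y / b) powr (1 - t) \<le> h (t * x + (1 - t) * y) / c" for x y
    proof -
      have "(f x / a) powr t * (g y / b) powr (1 - t) = (f x powr t * g y powr (1 - t)) / c"
        using f(2)[of x] g(2)[of y] ab by (simp add: powr_divide less_imp_le c_def)
      also have "\<dots> \<le> h (t * x + (1 - t) * y) / c"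
        using ineq[of x y] c by (simp add: divide_right_mono)
      finally show ?thesis .
    qed
  qed (use f g ab t in \<open>auto intro!: continuous_intros simp: a_def[symmetric] b_def[symmetric]\<close>)
  also have "\<dots> = (\<integral>\<^sup>+x. ennreal (h x) * ennreal (1 / c) \<partial>lborel)"
    using c by (intro nn_integral_cong) (simp add: ennreal_mult''[symmetric])
  also have "\<dots> = (\<integral>\<^sup>+x. ennreal (h x) \<partial>lborel) * ennreal (1 / c)"
    by (rule nn_integral_multc) simp
  finally have "ennreal c * 1 \<le> ennreal c * ((\<integral>\<^sup>+x. ennreal (h x) \<partial>lborel) * ennreal (1 / c))"
    by (intro mult_left_mono) auto
  also have "\<dots> = (\<integral>\<^sup>+x. ennreal (h x) \<partial>lborel) * (ennreal c * ennreal (1 / c))"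
    by (simp add: ac_simps)
  also have "ennreal c * ennreal (1 / c) = 1"
    using c by (simp flip: ennreal_mult)
  finally show ?thesis by (simp add: c_def a_def b_def)
qed

section \<open>Transport and concentration for standard Gaussian vectors\<close>

text \<open>Completing the square bounds the integrand by a multiple of the normal density of variance
  \<open>2\<close>.\<close>

lemma std_normal_exp_abs_integrable:
  "integrable lborel (\<lambda>x. std_normal_density x * exp (K * \<bar>x\<bar>))"
proof (rule Bochner_Integration.integrable_bound)
  show "integrable lborel (\<lambda>x. sqrt 2 * exp (K\<^sup>2) * normal_density 0 (sqrt 2) x)"
    by simp
  show "AE x in lborel. norm (std_normal_density x * exp (K * \<bar>x\<bar>))
      \<le> norm (sqrt 2 * exp (K\<^sup>2) * normal_density 0 (sqrt 2) x)"
  proof (rule AE_I2)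
    fix x :: real
    have "0 \<le> (\<bar>x\<bar> / 2 - K)\<^sup>2" by simp
    then have "- (x\<^sup>2 / 2) + K * \<bar>x\<bar> \<le> K\<^sup>2 + - (x\<^sup>2 / 4)"
      by (simp add: power2_eq_square algebra_simps)
    then have "exp (- (x\<^sup>2 / 2)) * exp (K * \<bar>x\<bar>) \<le> exp (K\<^sup>2) * exp (- (x\<^sup>2 / 4))"
      by (simp flip: exp_add)
    then have "exp (- (x\<^sup>2 / 2)) * exp (K * \<bar>x\<bar>) / sqrt (2 * pi)
        \<le> exp (K\<^sup>2) * exp (- (x\<^sup>2 / 4)) / sqrt (2 * pi)"
      by (intro divide_right_mono) auto
    moreover have "sqrt 2 * exp (K\<^sup>2) * normal_density 0 (sqrt 2) x
        = exp (K\<^sup>2) * exp (- (x\<^sup>2 / 4)) / sqrt (2 * pi)"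
    proof -
      have "sqrt (2 * pi * (sqrt 2)\<^sup>2) = sqrt 2 * sqrt (2 * pi)"
        by (simp flip: real_sqrt_mult)
      then show ?thesis unfolding normal_density_def by simp
    qed
    moreover have "norm (std_normal_density x * exp (K * \<bar>x\<bar>))
        = exp (- (x\<^sup>2 / 2)) * exp (K * \<bar>x\<bar>) / sqrt (2 * pi)"
      by (simp add: std_normal_density_def)
    ultimately show "norm (std_normal_density x * exp (K * \<bar>x\<bar>))
      \<le> norm (sqrt 2 * exp (K\<^sup>2) * normal_density 0 (sqrt 2) x)"
      by simp
  qed
qed simp

lemma lipschitz_continuous_on:
  fixes u :: "'e::real_normed_vector \<Rightarrow> 'f::real_normed_vector"
  assumes "\<And>x y. norm (u x - u y) \<le> K * norm (x - y)"
  shows "continuous_on UNIV u"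
proof -
  have "\<bar>K\<bar>-lipschitz_on UNIV u"
  proof (rule lipschitz_onI)
    fix x y :: 'e
    have "K * norm (x - y) \<le> \<bar>K\<bar> * norm (x - y)" by (intro mult_right_mono) auto
    with assms[of x y] show "dist (u x) (u y) \<le> \<bar>K\<bar> * dist x y" by (simp add: dist_norm)
  qed simp
  then show ?thesis by (rule lipschitz_on_continuous_on)
qed

lemma std_normal_exp_lipschitz_integrable:
  fixes u :: "real \<Rightarrow> real"
  assumes "\<And>x y. \<bar>u x - u y\<bar> \<le> K * \<bar>x - y\<bar>"
  shows "integrable lborel (\<lambda>x. std_normal_density x * exp (u x))"
proof (rule Bochner_Integration.integrable_bound)
  have [measurable]: "u \<in> borel_measurable borel"
    using lipschitz_continuous_on[OF assms[folded real_norm_def]] by (rule borel_measurable_continuous_onI)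
  show "(\<lambda>x. std_normal_density x * exp (u x)) \<in> borel_measurable lborel" by simp
  show "integrable lborel (\<lambda>x. exp \<bar>u 0\<bar> * (std_normal_density x * exp (K * \<bar>x\<bar>)))"
    by (intro integrable_mult_right std_normal_exp_abs_integrable)
  show "AE x in lborel. norm (std_normal_density x * exp (u x))
      \<le> norm (exp \<bar>u 0\<bar> * (std_normal_density x * exp (K * \<bar>x\<bar>)))"
  proof (rule AE_I2)
    fix x :: real
    have "u x \<le> \<bar>u 0\<bar> + K * \<bar>x\<bar>" using assms[of x 0] by simp
    then have "exp (u x) \<le> exp \<bar>u 0\<bar> * exp (K * \<bar>x\<bar>)" by (simp flip: exp_add)
    then have "std_normal_density x * exp (u x) \<le> std_normal_density x * (exp \<bar>u 0\<bar> * exp (K * \<bar>x\<bar>))"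
      by (intro mult_left_mono) auto
    then show "norm (std_normal_density x * exp (u x))
      \<le> norm (exp \<bar>u 0\<bar> * (std_normal_density x * exp (K * \<bar>x\<bar>)))"
      by (simp add: abs_mult ac_simps)
  qed
qed

lemma std_normal_lipschitz_integrable:
  fixes u :: "real \<Rightarrow> real"
  assumes "\<And>x y. \<bar>u x - u y\<bar> \<le> K * \<bar>x - y\<bar>"
  shows "integrable std_normal_distribution u"
proof (rule Bochner_Integration.integrable_bound)
  interpret real_distribution std_normal_distribution by (rule real_dist_normal_dist)
  have "integrable std_normal_distribution (\<lambda>x. \<bar>x\<bar>)"
    using integrable_std_normal_distribution_moment[of 1] by (intro integrable_abs) simp
  then show "integrable std_normal_distribution (\<lambda>x. \<bar>u 0\<bar> + K * \<bar>x\<bar>)" by simp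
  show "u \<in> borel_measurable std_normal_distribution"
    using lipschitz_continuous_on[OF assms[folded real_norm_def]] borel_measurable_continuous_onI by simp
  show "AE x in std_normal_distribution. norm (u x) \<le> norm (\<bar>u 0\<bar> + K * \<bar>x\<bar>)"
  proof (rule AE_I2)
    fix x :: real
    show "norm (u x) \<le> norm (\<bar>u 0\<bar> + K * \<bar>x\<bar>)" using assms[of x 0] by simp
  qed
qed

text \<open>The dual form of Talagrand's transport inequality; the sharp cost is the limit \<open>a = 1\<close>. The
  Prekopa--Leindler inequality is applied to \<open>\<phi> * exp u\<close> and \<open>\<phi> * exp (- \<kappa> * f)\<close>, where \<open>\<phi>\<close> is the
  normal density, with the weight \<open>t = 1 - a\<close>. Since
  \<open>t x\<^sup>2 + (1 - t) y\<^sup>2 - (t x + (1 - t) y)\<^sup>2 = t (1 - t) (x - y)\<^sup>2\<close>, the hypothesis relating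
  \<open>u\<close> and \<open>f\<close> says exactly that \<open>\<phi>\<close> may serve as the upper function. Jensen's inequality then
  replaces the integral of \<open>exp (- \<kappa> * f)\<close> by the expectation of \<open>f\<close>.\<close>

lemma normal_transport_real:
  fixes u f :: "real \<Rightarrow> real"
  assumes a: "0 < a" "a < 1"
    and u: "\<And>x y. \<bar>u x - u y\<bar> \<le> K * \<bar>x - y\<bar>"
    and f: "\<And>x y. \<bar>f x - f y\<bar> \<le> K * \<bar>x - y\<bar>"
    and uf: "\<And>x y. u x \<le> f y + a / 2 * (x - y)\<^sup>2"
  shows "(\<integral>\<^sup>+x. ennreal (exp (u x)) \<partial>std_normal_distribution)
     \<le> ennreal (exp (\<integral>x. f x \<partial>std_normal_distribution))"
proof -
  interpret real_distribution std_normal_distribution by (rule real_dist_normal_dist)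
  define t where "t = 1 - a"
  have t: "0 < t" "t < 1" using a by (auto simp: t_def)
  define \<kappa> where "\<kappa> = t / (1 - t)"
  have \<kappa>: "0 < \<kappa>" "(1 - t) * \<kappa> = t" using t by (auto simp: \<kappa>_def)
  let ?\<phi> = std_normal_density
  have \<phi>c: "continuous_on UNIV ?\<phi>"
    unfolding std_normal_density_def by (intro continuous_intros) auto
  have \<kappa>f: "\<bar>- \<kappa> * f x - - \<kappa> * f y\<bar> \<le> (\<kappa> * K) * \<bar>x - y\<bar>" for x y
  proof -
    have "- \<kappa> * f x - - \<kappa> * f y = - \<kappa> * (f x - f y)" by (simp add: algebra_simps)
    then have "\<bar>- \<kappa> * f x - - \<kappa> * f y\<bar> = \<kappa> * \<bar>f x - f y\<bar>" using \<kappa> by (simp add: abs_mult)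
    then show ?thesis using f[of x y] \<kappa> by simp
  qed
  note uc = lipschitz_continuous_on[OF u[folded real_norm_def]] and fc = lipschitz_continuous_on[OF f[folded real_norm_def]]
  have um[measurable]: "u \<in> borel_measurable borel" "f \<in> borel_measurable borel"
    using uc fc by (auto intro: borel_measurable_continuous_onI)
  define A where "A = (\<integral>x. ?\<phi> x * exp (u x) \<partial>lborel)"
  define B where "B = (\<integral>x. ?\<phi> x * exp (- \<kappa> * f x) \<partial>lborel)"
  define E where "E = (\<integral>x. f x \<partial>std_normal_distribution)"
  have "ennreal (A powr t * B powr (1 - t)) \<le> (\<integral>\<^sup>+x. ennreal (?\<phi> x) \<partial>lborel)"
    unfolding A_def B_def
  proof (rule prekopa_leindler_real)
    show "continuous_on UNIV (\<lambda>x. ?\<phi> x * exp (u x))"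
      "continuous_on UNIV (\<lambda>x. ?\<phi> x * exp (- \<kappa> * f x))"
      by (intro continuous_intros \<phi>c uc fc)+
    show "integrable lborel (\<lambda>x. ?\<phi> x * exp (u x))"
      using u by (rule std_normal_exp_lipschitz_integrable)
    show "integrable lborel (\<lambda>x. ?\<phi> x * exp (- \<kappa> * f x))"
      using \<kappa>f by (rule std_normal_exp_lipschitz_integrable)
    fix x y
    define c where "c = 1 / sqrt (2 * pi)"
    have c: "0 < c" by (simp add: c_def)
    have \<phi>: "?\<phi> z = exp (ln c + - z\<^sup>2 / 2)" for z
      unfolding exp_add exp_ln[OF c] by (simp add: std_normal_density_def c_def)
    have "(?\<phi> x * exp (u x)) powr t * (?\<phi> y * exp (- \<kappa> * f y)) powr (1 - t)
      = exp (t * (ln c + - x\<^sup>2 / 2 + u x) + (1 - t) * (ln c + - y\<^sup>2 / 2 - \<kappa> * f y))"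
      unfolding \<phi> exp_add[symmetric] powr_def by (simp add: exp_add[symmetric])
    also have "\<dots> \<le> ?\<phi> (t * x + (1 - t) * y)"
    proof -
      have "t * u x \<le> t * (f y + (1 - t) / 2 * (x - y)\<^sup>2)"
        using uf[of x y] t by (intro mult_left_mono) (auto simp: t_def)
      moreover have "(1 - t) * (ln c + - y\<^sup>2 / 2 - \<kappa> * f y) = (1 - t) * (ln c + - y\<^sup>2 / 2) - t * f y"
        using \<kappa>(2) by (metis mult.assoc right_diff_distrib)
      moreover have "t * ((1 - t) / 2 * (x - y)\<^sup>2) + t * (ln c + - x\<^sup>2 / 2) + (1 - t) * (ln c + - y\<^sup>2 / 2)
        = ln c + - (t * x + (1 - t) * y)\<^sup>2 / 2"
        by (simp add: power2_eq_square field_simps)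
      ultimately have "t * (ln c + - x\<^sup>2 / 2 + u x) + (1 - t) * (ln c + - y\<^sup>2 / 2 - \<kappa> * f y)
        \<le> ln c + - (t * x + (1 - t) * y)\<^sup>2 / 2"
        unfolding distrib_left by linarith
      then show ?thesis unfolding \<phi> by simp
    qed
    finally show "(?\<phi> x * exp (u x)) powr t * (?\<phi> y * exp (- \<kappa> * f y)) powr (1 - t)
      \<le> ?\<phi> (t * x + (1 - t) * y)" .
  qed (use t in \<open>auto simp: normal_density_pos\<close>)
  also have "(\<integral>\<^sup>+x. ennreal (?\<phi> x) \<partial>lborel) = 1"
    by (subst nn_integral_eq_integral) auto
  finally have AB: "A powr t * B powr (1 - t) \<le> 1" by simp
  have fint: "integrable std_normal_distribution f"
    using f by (rule std_normal_lipschitz_integrable)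
  have eint: "integrable std_normal_distribution (\<lambda>x. exp (- \<kappa> * f x))"
    using std_normal_exp_lipschitz_integrable[OF \<kappa>f] by (subst integrable_density) auto
  have B: "exp (- \<kappa> * E) \<le> B"
  proof -
    have "exp (- \<kappa> * E) * (1 + - \<kappa> * (f x - E)) \<le> exp (- \<kappa> * f x)" for x
    proof -
      have "exp (- \<kappa> * E) * (1 + - \<kappa> * (f x - E)) \<le> exp (- \<kappa> * E) * exp (- \<kappa> * (f x - E))"
        by (intro mult_left_mono exp_ge_add_one_self) auto
      also have "\<dots> = exp (- \<kappa> * f x)" by (simp add: exp_add[symmetric] algebra_simps)
      finally show ?thesis .
    qed
    then have "(\<integral>x. exp (- \<kappa> * E) * (1 + - \<kappa> * (f x - E)) \<partial>std_normal_distribution)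
      \<le> (\<integral>x. exp (- \<kappa> * f x) \<partial>std_normal_distribution)"
      using fint eint by (intro integral_mono) auto
    also have "(\<integral>x. exp (- \<kappa> * E) * (1 + - \<kappa> * (f x - E)) \<partial>std_normal_distribution) = exp (- \<kappa> * E)"
      using fint by (simp add: E_def prob_space[simplified])
    also have "(\<integral>x. exp (- \<kappa> * f x) \<partial>std_normal_distribution) = B"
      unfolding B_def by (subst integral_density) auto
    finally show ?thesis .
  qed
  have A0: "0 \<le> A" unfolding A_def by (intro integral_nonneg_AE) auto
  have "A powr t * exp (- t * E) \<le> 1"
  proof -
    have "exp (- t * E) = exp (- \<kappa> * E) powr (1 - t)"
      using \<kappa>(2) by (simp add: powr_def)
    also have "\<dots> \<le> B powr (1 - t)"
      using B t by (intro powr_mono2) auto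
    finally have "A powr t * exp (- t * E) \<le> A powr t * B powr (1 - t)"
      by (intro mult_left_mono) auto
    with AB show ?thesis by simp
  qed
  then have "A powr t \<le> exp E powr t"
    by (simp add: powr_def exp_minus field_simps)
  then have AE: "A \<le> exp E"
    using t A0 by (metis exp_ge_zero not_le powr_less_mono2)
  have "(\<integral>\<^sup>+x. ennreal (exp (u x)) \<partial>std_normal_distribution)
      = (\<integral>\<^sup>+x. ennreal (?\<phi> x * exp (u x)) \<partial>lborel)"
    by (subst nn_integral_density) (auto simp: ennreal_mult)
  also have "\<dots> = ennreal A"
    unfolding A_def using std_normal_exp_lipschitz_integrable[OF u]
    by (intro nn_integral_eq_integral) auto
  finally show ?thesis using AE by (simp add: E_def)
qed

abbreviation std_gauss :: "'i set \<Rightarrow> ('i \<Rightarrow> real) measure" where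
  "std_gauss I \<equiv> PiM I (\<lambda>_. std_normal_distribution)"

lemma prob_space_std_gauss: "prob_space (std_gauss I)"
  using real_dist_normal_dist by (intro prob_space_PiM) (auto simp: real_distribution_def)

lemma product_sigma_finite_std_normal: "product_sigma_finite (\<lambda>_. std_normal_distribution)"
proof -
  interpret real_distribution std_normal_distribution by (rule real_dist_normal_dist)
  show ?thesis by standard
qed

lemma std_gauss_lipschitz_integrable:
  fixes f :: "('i \<Rightarrow> real) \<Rightarrow> real"
  assumes fin: "finite I" and f[measurable]: "f \<in> borel_measurable (std_gauss I)"
    and lip: "\<And>x y. x \<in> space (std_gauss I) \<Longrightarrow> y \<in> space (std_gauss I) \<Longrightarrow>
      \<bar>f x - f y\<bar> \<le> K * (\<Sum>i\<in>I. \<bar>x i - y i\<bar>)"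
  shows "integrable (std_gauss I) f"
proof (rule Bochner_Integration.integrable_bound)
  interpret prob_space "std_gauss I" by (rule prob_space_std_gauss)
  have comp: "integrable (std_gauss I) (\<lambda>x. \<bar>x i\<bar>)" if "i \<in> I" for i
  proof -
    have "distr (std_gauss I) std_normal_distribution (\<lambda>x. x i) = std_normal_distribution"
      using that real_dist_normal_dist by (intro distr_PiM_component) (auto simp: real_distribution_def)
    moreover have "integrable std_normal_distribution (\<lambda>x. \<bar>x\<bar>)"
      by (rule std_normal_lipschitz_integrable[where K=1]) simp
    ultimately have "integrable (distr (std_gauss I) std_normal_distribution (\<lambda>x. x i)) (\<lambda>x. \<bar>x\<bar>)"
      by simp
    then show ?thesis
      using that by (subst (asm) integrable_distr_eq) auto
  qed
  let ?o = "\<lambda>i\<in>I. 0::real"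
  show "integrable (std_gauss I) (\<lambda>x. \<bar>f ?o\<bar> + K * (\<Sum>i\<in>I. \<bar>x i\<bar>))"
    using comp by simp
  show "AE x in std_gauss I. norm (f x) \<le> norm (\<bar>f ?o\<bar> + K * (\<Sum>i\<in>I. \<bar>x i\<bar>))"
  proof (rule AE_I2)
    fix x assume x: "x \<in> space (std_gauss I)"
    have "?o \<in> space (std_gauss I)" by (auto simp: space_PiM)
    from lip[OF x this] show "norm (f x) \<le> norm (\<bar>f ?o\<bar> + K * (\<Sum>i\<in>I. \<bar>x i\<bar>))"
      by (auto cong: sum.cong)
  qed
qed simp

text \<open>Tensorisation. Integrating over one coordinate with the one-dimensional inequality shows that
  \<open>G = ln (\<integral>exp u)\<close> and \<open>g = \<integral>f\<close>, functions of the other coordinates, satisfy the same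
  hypotheses. The Lipschitz bounds are carried along because the one-dimensional inequality needs
  continuous integrable densities.\<close>

lemma std_gauss_transport:
  fixes u f :: "('i \<Rightarrow> real) \<Rightarrow> real"
  assumes fin: "finite I" and a: "0 < a" "a < 1"
    and "u \<in> borel_measurable (std_gauss I)" "f \<in> borel_measurable (std_gauss I)"
    and "\<And>x y. x \<in> space (std_gauss I) \<Longrightarrow> y \<in> space (std_gauss I) \<Longrightarrow>
      \<bar>u x - u y\<bar> \<le> K * (\<Sum>i\<in>I. \<bar>x i - y i\<bar>)"
    and "\<And>x y. x \<in> space (std_gauss I) \<Longrightarrow> y \<in> space (std_gauss I) \<Longrightarrow>
      \<bar>f x - f y\<bar> \<le> K * (\<Sum>i\<in>I. \<bar>x i - y i\<bar>)"
    and "\<And>x y. x \<in> space (std_gauss I) \<Longrightarrow> y \<in> space (std_gauss I) \<Longrightarrow>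
      u x \<le> f y + a / 2 * (\<Sum>i\<in>I. (x i - y i)\<^sup>2)"
  shows "(\<integral>\<^sup>+x. ennreal (exp (u x)) \<partial>std_gauss I) \<le> ennreal (exp (\<integral>x. f x \<partial>std_gauss I))"
  using fin assms(4-)
proof (induction I arbitrary: u f rule: finite_induct)
  case empty
  interpret prob_space "std_gauss {} :: ('i \<Rightarrow> real) measure" by (rule prob_space_std_gauss)
  let ?o = "\<lambda>_::'i. undefined :: real"
  have o: "x \<in> space (std_gauss {}) \<longleftrightarrow> x = ?o" for x
    by (auto simp: space_PiM)
  have "(\<integral>\<^sup>+x. ennreal (exp (u x)) \<partial>std_gauss {}) = (\<integral>\<^sup>+x. ennreal (exp (u ?o)) \<partial>(std_gauss {} :: ('i \<Rightarrow> real) measure))"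
    by (intro nn_integral_cong) (simp only: o)
  also have "\<dots> = ennreal (exp (u ?o))"
    using emeasure_space_1 by simp
  also have "\<dots> \<le> ennreal (exp (f ?o))"
    using empty.prems(5)[of ?o ?o] o by simp
  also have "f ?o = (\<integral>x. f ?o \<partial>(std_gauss {} :: ('i \<Rightarrow> real) measure))" using prob_space by simp
  also have "\<dots> = (\<integral>x. f x \<partial>std_gauss {})"
    by (intro Bochner_Integration.integral_cong refl) (simp only: o)
  finally show ?case .
next
  case (insert i I)
  note [measurable] = insert.prems(1,2)
  note lip_u = insert.prems(3) and lip_f = insert.prems(4) and uf = insert.prems(5)
  interpret N: product_sigma_finite "\<lambda>_::'i. std_normal_distribution"
    by (rule product_sigma_finite_std_normal)
  interpret S: real_distribution std_normal_distribution by (rule real_dist_normal_dist)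
  have upd: "x(i := s) \<in> space (std_gauss (insert i I))" if "x \<in> space (std_gauss I)" for x s
    using that insert.hyps by (auto simp: space_PiM PiE_def extensional_def)
  \<comment> \<open>used for \<open>abs\<close> in the Lipschitz bounds and for the square in the cost\<close>
  have dist1: "(\<Sum>j\<in>insert i I. \<phi> ((x(i := s)) j - (y(i := r)) j))
      = \<phi> (s - r) + (\<Sum>j\<in>I. \<phi> (x j - y j))" for x y :: "'i \<Rightarrow> real" and s r and \<phi> :: "real \<Rightarrow> real"
  proof -
    have "(\<Sum>j\<in>I. \<phi> ((x(i := s)) j - (y(i := r)) j)) = (\<Sum>j\<in>I. \<phi> (x j - y j))"
      using insert.hyps by (intro sum.cong) auto
    then show ?thesis using insert.hyps by simp
  qed
  define J where "J x = (\<integral>\<^sup>+s. ennreal (exp (u (x(i := s)))) \<partial>std_normal_distribution)" for x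
  define G where "G x = ln (enn2real (J x))" for x
  define g where "g x = (\<integral>s. f (x(i := s)) \<partial>std_normal_distribution)" for x
  have Jm[measurable]: "J \<in> borel_measurable (std_gauss I)"
    unfolding J_def by measurable
  have Gm[measurable]: "G \<in> borel_measurable (std_gauss I)"
    unfolding G_def by measurable
  have gm[measurable]: "g \<in> borel_measurable (std_gauss I)"
    unfolding g_def by measurable
  have slice_lip: "\<bar>h (x(i := s)) - h (x(i := r))\<bar> \<le> K * \<bar>s - r\<bar>"
    if "\<And>x y. x \<in> space (std_gauss (insert i I)) \<Longrightarrow> y \<in> space (std_gauss (insert i I)) \<Longrightarrow>
      \<bar>h x - h y\<bar> \<le> K * (\<Sum>i\<in>insert i I. \<bar>x i - y i\<bar>)" "x \<in> space (std_gauss I)" for h x s r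
    using that(1)[OF upd[OF that(2)] upd[OF that(2)], of s r] unfolding dist1[of abs] by simp
  have f_slice: "integrable std_normal_distribution (\<lambda>s. f (x(i := s)))" if "x \<in> space (std_gauss I)" for x
    using slice_lip[OF lip_f that] by (rule std_normal_lipschitz_integrable)
  have Jg: "J x \<le> ennreal (exp (g y + a / 2 * (\<Sum>i\<in>I. (x i - y i)\<^sup>2)))"
    if x: "x \<in> space (std_gauss I)" and y: "y \<in> space (std_gauss I)" for x y
  proof -
    define c where "c = a / 2 * (\<Sum>i\<in>I. (x i - y i)\<^sup>2)"
    have "(\<integral>\<^sup>+s. ennreal (exp (u (x(i := s)))) \<partial>std_normal_distribution)
        \<le> ennreal (exp (\<integral>s. f (y(i := s)) + c \<partial>std_normal_distribution))"
    proof (rule normal_transport_real[OF a])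
      show "\<bar>u (x(i := s)) - u (x(i := r))\<bar> \<le> K * \<bar>s - r\<bar>" for s r
        by (rule slice_lip[OF lip_u x])
      show "\<bar>(f (y(i := s)) + c) - (f (y(i := r)) + c)\<bar> \<le> K * \<bar>s - r\<bar>" for s r
        using slice_lip[OF lip_f y, of s r] unfolding add_diff_cancel_right .
      show "u (x(i := s)) \<le> f (y(i := r)) + c + a / 2 * (s - r)\<^sup>2" for s r
      proof -
        have "u (x(i := s)) \<le> f (y(i := r)) + a / 2 * ((s - r)\<^sup>2 + (\<Sum>i\<in>I. (x i - y i)\<^sup>2))"
          using uf[OF upd[OF x] upd[OF y]] unfolding dist1[of "\<lambda>z. z\<^sup>2"] .
        then show ?thesis unfolding c_def distrib_left by linarith
      qed
    qed
    also have "(\<integral>s. f (y(i := s)) + c \<partial>std_normal_distribution) = g y + c"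
      unfolding g_def using f_slice[OF y] by (simp add: S.prob_space[simplified])
    finally show ?thesis unfolding J_def c_def .
  qed
  have Jfin: "J x < top" if "x \<in> space (std_gauss I)" for x
    using Jg[OF that that] by (rule le_less_trans) simp
  have um: "(\<lambda>s. u (x(i := s))) \<in> borel_measurable std_normal_distribution"
    if "x \<in> space (std_gauss I)" for x
  proof -
    have "\<bar>u (x(i := s)) - u (x(i := r))\<bar> \<le> K * \<bar>s - r\<bar>" for s r
      by (rule slice_lip[OF lip_u that])
    from borel_measurable_continuous_onI[OF lipschitz_continuous_on[OF this[folded real_norm_def]]]
    show ?thesis by simp
  qed
  have Jpos: "0 < J x" if x: "x \<in> space (std_gauss I)" for x
  proof -
    note um[OF x, measurable]
    have "J x \<noteq> 0"
    proof
      assume "J x = 0"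
      then have "AE s in std_normal_distribution. ennreal (exp (u (x(i := s)))) = 0"
        unfolding J_def by (subst (asm) nn_integral_0_iff_AE) auto
      then have "AE s in std_normal_distribution. False" by eventually_elim simp
      then show False using S.AE_False by simp
    qed
    then show ?thesis by (simp add: zero_less_iff_neq_zero)
  qed
  have expG: "ennreal (exp (G x)) = J x" if "x \<in> space (std_gauss I)" for x
    using Jpos[OF that] Jfin[OF that] unfolding G_def
    by (simp add: enn2real_positive_iff)
  have G_lip: "G x \<le> G y + K * (\<Sum>i\<in>I. \<bar>x i - y i\<bar>)"
    if x: "x \<in> space (std_gauss I)" and y: "y \<in> space (std_gauss I)" for x y
  proof -
    define c where "c = K * (\<Sum>i\<in>I. \<bar>x i - y i\<bar>)"
    note um[OF y, measurable]
    have "J x \<le> (\<integral>\<^sup>+s. ennreal (exp c) * ennreal (exp (u (y(i := s)))) \<partial>std_normal_distribution)"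
      unfolding J_def
    proof (intro nn_integral_mono)
      fix s
      have "\<bar>u (x(i := s)) - u (y(i := s))\<bar> \<le> c"
        using lip_u[OF upd[OF x, of s] upd[OF y, of s]] 
        unfolding dist1[of abs] c_def diff_self abs_zero add_0 by linarith
      then have "exp (u (x(i := s))) \<le> exp c * exp (u (y(i := s)))" by (simp flip: exp_add)
      then show "ennreal (exp (u (x(i := s)))) \<le> ennreal (exp c) * ennreal (exp (u (y(i := s))))"
        by (simp flip: ennreal_mult)
    qed
    also have "\<dots> = ennreal (exp c) * J y"
      unfolding J_def by (rule nn_integral_cmult) simp
    finally have "ennreal (exp (G x)) \<le> ennreal (exp (c + G y))"
      unfolding expG[OF x, symmetric] expG[OF y, symmetric] by (simp add: exp_add ennreal_mult)
    then show ?thesis by (simp add: c_def)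
  qed
  have g_lip: "g x \<le> g y + K * (\<Sum>i\<in>I. \<bar>x i - y i\<bar>)"
    if x: "x \<in> space (std_gauss I)" and y: "y \<in> space (std_gauss I)" for x y
  proof -
    define c where "c = K * (\<Sum>i\<in>I. \<bar>x i - y i\<bar>)"
    have "g x \<le> (\<integral>s. f (y(i := s)) + c \<partial>std_normal_distribution)"
      unfolding g_def
    proof (rule integral_mono)
      fix s
      show "f (x(i := s)) \<le> f (y(i := s)) + c"
        using lip_f[OF upd[OF x, of s] upd[OF y, of s]] 
        unfolding dist1[of abs] c_def diff_self abs_zero add_0 by linarith
    qed (use f_slice[OF x] f_slice[OF y] in auto)
    also have "\<dots> = g y + c"
      unfolding g_def using f_slice[OF y] by (simp add: S.prob_space[simplified])
    finally show ?thesis by (simp add: c_def)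
  qed
  have sym: "(\<Sum>i\<in>I. \<bar>x i - y i\<bar>) = (\<Sum>i\<in>I. \<bar>y i - x i\<bar>)" for x y :: "'i \<Rightarrow> real"
    by (simp add: abs_minus_commute)
  have "(\<integral>\<^sup>+x. ennreal (exp (u x)) \<partial>std_gauss (insert i I)) = (\<integral>\<^sup>+x. J x \<partial>std_gauss I)"
    unfolding J_def using insert.hyps by (intro N.product_nn_integral_insert) auto
  also have "\<dots> = (\<integral>\<^sup>+x. ennreal (exp (G x)) \<partial>std_gauss I)"
    by (intro nn_integral_cong) (simp add: expG)
  also have "\<dots> \<le> ennreal (exp (\<integral>x. g x \<partial>std_gauss I))"
  proof (rule insert.IH[OF Gm gm])
    fix x y assume xy: "x \<in> space (std_gauss I)" "y \<in> space (std_gauss I)"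
    show "\<bar>G x - G y\<bar> \<le> K * (\<Sum>i\<in>I. \<bar>x i - y i\<bar>)"
      using G_lip[OF xy] G_lip[OF xy(2,1)] sym[of x y] by simp
    show "\<bar>g x - g y\<bar> \<le> K * (\<Sum>i\<in>I. \<bar>x i - y i\<bar>)"
      using g_lip[OF xy] g_lip[OF xy(2,1)] sym[of x y] by simp
    have "ennreal (exp (G x)) \<le> ennreal (exp (g y + a / 2 * (\<Sum>i\<in>I. (x i - y i)\<^sup>2)))"
      using Jg[OF xy] expG[OF xy(1)] by simp
    then show "G x \<le> g y + a / 2 * (\<Sum>i\<in>I. (x i - y i)\<^sup>2)" by simp
  qed
  also have "(\<integral>x. g x \<partial>std_gauss I) = (\<integral>x. f x \<partial>std_gauss (insert i I))"
    unfolding g_def using insert.hyps lip_f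
    by (intro N.product_integral_insert[symmetric] std_gauss_lipschitz_integrable) auto
  finally show ?case .
qed

text \<open>By Young's inequality \<open>u = \<theta> * f - \<theta>\<^sup>2 * L\<^sup>2 / (2 * a)\<close> and \<open>\<theta> * f\<close> form an
  admissible pair for the transport inequality; then \<open>a\<close> tends to \<open>1\<close>.\<close>

lemma std_gauss_concentration:
  fixes f :: "('i \<Rightarrow> real) \<Rightarrow> real"
  assumes fin: "finite I" and f[measurable]: "f \<in> borel_measurable (std_gauss I)"
    and L: "0 \<le> L"
    and lip: "\<And>x y. x \<in> space (std_gauss I) \<Longrightarrow> y \<in> space (std_gauss I) \<Longrightarrow>
      \<bar>f x - f y\<bar> \<le> L * sqrt (\<Sum>i\<in>I. (x i - y i)\<^sup>2)"
  shows "(\<integral>\<^sup>+x. ennreal (exp (\<theta> * (f x - (\<integral>y. f y \<partial>std_gauss I)))) \<partial>std_gauss I)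
    \<le> ennreal (exp (\<theta>\<^sup>2 * L\<^sup>2 / 2))"
proof -
  interpret prob_space "std_gauss I" by (rule prob_space_std_gauss)
  define E where "E = (\<integral>y. f y \<partial>std_gauss I)"
  have l1: "\<bar>f x - f y\<bar> \<le> L * (\<Sum>i\<in>I. \<bar>x i - y i\<bar>)"
    if "x \<in> space (std_gauss I)" "y \<in> space (std_gauss I)" for x y
  proof -
    have "sqrt (\<Sum>i\<in>I. (x i - y i)\<^sup>2) \<le> (\<Sum>i\<in>I. \<bar>x i - y i\<bar>)"
      using L2_set_le_sum_abs[of "\<lambda>i. x i - y i" I] by (simp add: L2_set_def)
    then have "L * sqrt (\<Sum>i\<in>I. (x i - y i)\<^sup>2) \<le> L * (\<Sum>i\<in>I. \<bar>x i - y i\<bar>)"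
      using L by (intro mult_left_mono)
    with lip[OF that] show ?thesis by simp
  qed
  have fint: "integrable (std_gauss I) f"
    using fin f l1 by (rule std_gauss_lipschitz_integrable)
  let ?X = "\<integral>\<^sup>+x. ennreal (exp (\<theta> * (f x - E))) \<partial>std_gauss I"
  have le: "?X \<le> ennreal (exp (\<theta>\<^sup>2 * L\<^sup>2 / (2 * a)))" if a: "0 < a" "a < 1" for a
  proof -
    define c where "c = \<theta>\<^sup>2 * L\<^sup>2 / (2 * a)"
    have lipl: "\<bar>\<theta> * f x - \<theta> * f y\<bar> \<le> (\<bar>\<theta>\<bar> * L) * (\<Sum>i\<in>I. \<bar>x i - y i\<bar>)"
      if "x \<in> space (std_gauss I)" "y \<in> space (std_gauss I)" for x y
    proof -
      have "\<bar>\<theta> * f x - \<theta> * f y\<bar> = \<bar>\<theta>\<bar> * \<bar>f x - f y\<bar>"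
        by (simp add: abs_mult flip: right_diff_distrib)
      also have "\<dots> \<le> \<bar>\<theta>\<bar> * (L * (\<Sum>i\<in>I. \<bar>x i - y i\<bar>))"
        by (intro mult_left_mono l1 that) auto
      finally show ?thesis by simp
    qed
    have "(\<integral>\<^sup>+x. ennreal (exp (\<theta> * f x - c)) \<partial>std_gauss I)
      \<le> ennreal (exp (\<integral>x. \<theta> * f x \<partial>std_gauss I))"
    proof (rule std_gauss_transport[OF fin a])
      show "\<bar>(\<theta> * f x - c) - (\<theta> * f y - c)\<bar> \<le> (\<bar>\<theta>\<bar> * L) * (\<Sum>i\<in>I. \<bar>x i - y i\<bar>)"
        if "x \<in> space (std_gauss I)" "y \<in> space (std_gauss I)" for x y
        using lipl[OF that] by simp
      show "\<theta> * f x - c \<le> \<theta> * f y + a / 2 * (\<Sum>i\<in>I. (x i - y i)\<^sup>2)"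
        if xy: "x \<in> space (std_gauss I)" "y \<in> space (std_gauss I)" for x y
      proof -
        define d where "d = sqrt (\<Sum>i\<in>I. (x i - y i)\<^sup>2)"
        have d2: "d\<^sup>2 = (\<Sum>i\<in>I. (x i - y i)\<^sup>2)"
          unfolding d_def by (simp add: sum_nonneg)
        have "\<theta> * f x - \<theta> * f y \<le> \<bar>\<theta>\<bar> * \<bar>f x - f y\<bar>"
          by (metis abs_ge_self abs_mult right_diff_distrib)
        also have "\<dots> \<le> \<bar>\<theta>\<bar> * (L * d)"
          unfolding d_def by (intro mult_left_mono lip xy) auto
        also have "\<dots> \<le> c + a / 2 * d\<^sup>2"
        proof -
          have "0 \<le> (\<bar>\<theta>\<bar> * L - a * d)\<^sup>2 / (2 * a)" using a by simp
          also have "\<dots> = c + a / 2 * d\<^sup>2 - \<bar>\<theta>\<bar> * (L * d)"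
            unfolding c_def power2_diff using a
            by (simp add: power_mult_distrib field_simps power2_eq_square)
          finally show ?thesis by simp
        qed
        finally show ?thesis using d2 by simp
      qed
    qed (use lipl in auto)
    then have "ennreal (exp (c - \<theta> * E)) * (\<integral>\<^sup>+x. ennreal (exp (\<theta> * f x - c)) \<partial>std_gauss I)
      \<le> ennreal (exp (c - \<theta> * E)) * ennreal (exp (\<theta> * E))"
      unfolding E_def by (intro mult_left_mono) simp_all
    also have "ennreal (exp (c - \<theta> * E)) * (\<integral>\<^sup>+x. ennreal (exp (\<theta> * f x - c)) \<partial>std_gauss I) = ?X"
      by (subst nn_integral_cmult[symmetric])
        (auto intro!: nn_integral_cong simp: ennreal_mult[symmetric] exp_add[symmetric] algebra_simps)
    also have "ennreal (exp (c - \<theta> * E)) * ennreal (exp (\<theta> * E)) = ennreal (exp c)"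
      by (simp add: ennreal_mult[symmetric] exp_add[symmetric])
    finally show ?thesis by (simp add: c_def)
  qed
  obtain X where X: "?X = ennreal X" "0 \<le> X"
    using le[of "1/2"] by (cases ?X) (auto simp: top_unique)
  have "X \<le> exp (\<theta>\<^sup>2 * L\<^sup>2 / (2 * 1))"
  proof (rule tendsto_lowerbound)
    show "((\<lambda>a::real. exp (\<theta>\<^sup>2 * L\<^sup>2 / (2 * a))) \<longlongrightarrow> exp (\<theta>\<^sup>2 * L\<^sup>2 / (2 * 1))) (at_left 1)"
      by (intro tendsto_intros) auto
    have "\<forall>\<^sub>F a::real in at_left 1. 0 < a \<and> a < 1"
      using eventually_at_left_real[OF zero_less_one] by eventually_elim auto
    then show "\<forall>\<^sub>F a in at_left 1. X \<le> exp (\<theta>\<^sup>2 * L\<^sup>2 / (2 * a))"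
      by eventually_elim (use le X in simp)
  qed simp
  then show ?thesis using X by (simp add: E_def[symmetric])
qed

section \<open>Characteristic functions of random vectors\<close>

text \<open>Levy's uniqueness theorem is about probability measures on the line. This is how a nonnegative
  weight \<open>g\<close> is brought into that form.\<close>

lemma weighted_distribution:
  fixes g X :: "'a \<Rightarrow> real"
  assumes [measurable]: "g \<in> borel_measurable M" "X \<in> borel_measurable M" "B \<in> sets borel"
    and g: "\<And>x. 0 \<le> g x" "integrable M g" "(\<integral>x. g x \<partial>M) = c" "0 < c"
  defines "D \<equiv> distr (density M (\<lambda>x. g x / c)) borel X"
  shows "real_distribution D"
    and "char D s = (\<integral>x. of_real (g x) * iexp (s * X x) \<partial>M) / c"
    and "measure D B = (\<integral>x. g x * indicator B (X x) \<partial>M) / c"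
proof -
  let ?M = "density M (\<lambda>x. g x / c)"
  have "emeasure ?M (space ?M) = (\<integral>\<^sup>+x. ennreal (g x / c) \<partial>M)"
    by (subst emeasure_density) (auto intro!: nn_integral_cong)
  also have "\<dots> = ennreal (\<integral>x. g x / c \<partial>M)"
    using g by (intro nn_integral_eq_integral) auto
  finally interpret prob_space ?M
    using g(3,4) by (intro prob_spaceI) simp
  show "real_distribution D" unfolding D_def by (rule real_distribution_distr) simp
  have "char D s = (\<integral>x. iexp (s * X x) \<partial>?M)"
    unfolding char_def D_def by (subst integral_distr) auto
  also have "\<dots> = (\<integral>x. (g x / c) *\<^sub>R iexp (s * X x) \<partial>M)"
    using g by (subst integral_density) auto
  also have "\<dots> = (\<integral>x. (of_real (g x) * iexp (s * X x)) / c \<partial>M)"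
    by (intro Bochner_Integration.integral_cong refl) (simp add: scaleR_conv_of_real)
  finally show "char D s = (\<integral>x. of_real (g x) * iexp (s * X x) \<partial>M) / c" by simp
  have gB: "integrable M (\<lambda>x. g x * indicator B (X x))"
    by (rule Bochner_Integration.integrable_bound[OF g(2)]) (auto simp: indicator_def)
  have "emeasure D B = (\<integral>\<^sup>+x. ennreal (g x / c) * indicator (X -` B \<inter> space M) x \<partial>M)"
    unfolding D_def by (subst emeasure_distr) (auto intro!: emeasure_density)
  also have "\<dots> = (\<integral>\<^sup>+x. ennreal (g x * indicator B (X x) / c) \<partial>M)"
    by (intro nn_integral_cong) (auto simp: indicator_def)
  also have "\<dots> = ennreal (\<integral>x. g x * indicator B (X x) / c \<partial>M)"
    using g gB by (intro nn_integral_eq_integral) auto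
  finally show "measure D B = (\<integral>x. g x * indicator B (X x) \<partial>M) / c"
    using g by (simp add: measure_def integral_nonneg_AE)
qed

lemma weighted_char_unique:
  fixes X :: "'a \<Rightarrow> real" and X' :: "'b \<Rightarrow> real"
  assumes M: "finite_measure M" and N: "finite_measure N"
    and m[measurable]: "g \<in> borel_measurable M" "X \<in> borel_measurable M"
      "g' \<in> borel_measurable N" "X' \<in> borel_measurable N" and B[measurable]: "B \<in> sets borel"
    and g: "\<And>x. 0 \<le> g x" "\<And>x. g x \<le> K" and g': "\<And>x. 0 \<le> g' x" "\<And>x. g' x \<le> K"
    and char: "\<And>s. (\<integral>x. of_real (g x) * iexp (s * X x) \<partial>M) = (\<integral>x. of_real (g' x) * iexp (s * X' x) \<partial>N)"
  shows "(\<integral>x. g x * indicator B (X x) \<partial>M) = (\<integral>x. g' x * indicator B (X' x) \<partial>N)"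
proof -
  interpret M: finite_measure M by fact
  interpret N: finite_measure N by fact
  have gi: "integrable M g" "integrable N g'"
    using g g' by (auto intro!: M.integrable_const_bound[where B=K] N.integrable_const_bound[where B=K])
  define c where "c = (\<integral>x. g x \<partial>M)"
  have c: "c = (\<integral>x. g' x \<partial>N)"
    using char[of 0] by (simp add: c_def)
  have c0: "0 \<le> c" unfolding c_def using g by (intro integral_nonneg_AE) auto
  show ?thesis
  proof (cases "c = 0")
    case True
    \<comment> \<open>a weight of total mass zero cannot be normalised\<close>
    have zero: "(\<integral>x. h x * indicator B (Y x) \<partial>L) = 0"
      if h: "integrable L h" "\<And>x. 0 \<le> h x" "(\<integral>x. h x \<partial>L) = 0" for L :: "'c measure" and h Y :: "'c \<Rightarrow> real"
    proof (rule integral_eq_zero_AE)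
      have "AE x in L. h x = 0"
        using integral_nonneg_eq_0_iff_AE[OF h(1)] h(2,3) by simp
      then show "AE x in L. h x * indicator B (Y x) = 0" by eventually_elim simp
    qed
    show ?thesis
      using zero[OF gi(1) g(1), of X] zero[OF gi(2) g'(1), of X'] True c c_def by simp
  next
    case False
    then have c0: "0 < c" using c0 by simp
    note lawM = weighted_distribution[OF m(1,2) B g(1) gi(1) c_def[symmetric] c0]
    note lawN = weighted_distribution[OF m(3,4) B g'(1) gi(2) c[symmetric] c0]
    have "distr (density M (\<lambda>x. g x / c)) borel X = distr (density N (\<lambda>x. g' x / c)) borel X'"
      by (rule Levy_uniqueness[OF lawM(1) lawN(1)]) (simp only: fun_eq_iff lawM(2) lawN(2) char simp_thms)
    from arg_cong[OF this, of "\<lambda>D. measure D B"] show ?thesis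
      unfolding lawM(3) lawN(3) using c0 by simp
  qed
qed

text \<open>A complex exponential of \<open>z\<close> is not a density, but \<open>1 + cos z\<close> and \<open>1 + sin z\<close> are nonnegative and
  are combinations of \<open>1\<close>, \<open>iexp z\<close> and \<open>iexp (- z)\<close>. So the integrals with these two weights are
  determined by \<open>F\<close>, and they in turn determine the integral with \<open>iexp z\<close>.\<close>

lemma trigonometric_weights:
  fixes p y z :: "'a \<Rightarrow> real"
  assumes L: "finite_measure L"
    and [measurable]: "y \<in> borel_measurable L" "z \<in> borel_measurable L" "p \<in> borel_measurable L" "B \<in> sets borel"
    and p: "\<And>x. 0 \<le> p x" "\<And>x. p x \<le> 1"
  defines "F \<equiv> \<lambda>s e. \<integral>x. of_real (p x) * iexp (s * y x + e * z x) \<partial>L"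
    and "J \<equiv> \<lambda>w. \<integral>x. p x * w x * indicator B (y x) \<partial>L"
  shows "(\<integral>x. of_real (p x * (1 + cos (z x))) * iexp (s * y x) \<partial>L) = F s 0 + (F s 1 + F s (-1)) / 2" (is ?cos)
    and "(\<integral>x. of_real (p x * (1 + sin (z x))) * iexp (s * y x) \<partial>L) = F s 0 + (F s 1 - F s (-1)) / (2 * \<i>)" (is ?sin)
    and "(\<integral>x. of_real (p x * indicator B (y x)) * iexp (z x) \<partial>L)
      = of_real (J (\<lambda>x. 1 + cos (z x)) - J (\<lambda>_. 1)) + \<i> * of_real (J (\<lambda>x. 1 + sin (z x)) - J (\<lambda>_. 1))" (is ?ind)
proof -
  interpret L: finite_measure L by fact
  have i: "integrable L (\<lambda>x. of_real (p x) * iexp (s * y x + e * z x))" for e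
    using p by (intro L.integrable_const_bound[where B=1]) (auto simp: norm_mult)
  have e: "iexp (s * y x + e * z x) = iexp (s * y x) * iexp (e * z x)" for e x
    by (simp add: exp_add distrib_left)
  have cosE: "of_real (cos w) = (iexp w + iexp (- w)) / 2"
    and sinE: "of_real (sin w) = (iexp w - iexp (- w)) / (2 * \<i>)" for w
    by (simp_all add: cos_exp_eq sin_exp_eq flip: cos_of_real sin_of_real)
  have c: "of_real (p x * (1 + cos (z x))) * iexp (s * y x) = of_real (p x) * iexp (s * y x + 0 * z x)
      + (of_real (p x) * iexp (s * y x + 1 * z x) + of_real (p x) * iexp (s * y x + - 1 * z x)) / 2" for x
    unfolding e by (simp add: cosE sinE field_simps)
  have s: "of_real (p x * (1 + sin (z x))) * iexp (s * y x) = of_real (p x) * iexp (s * y x + 0 * z x)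
      + (of_real (p x) * iexp (s * y x + 1 * z x) - of_real (p x) * iexp (s * y x + - 1 * z x)) / (2 * \<i>)" for x
    unfolding e by (simp add: cosE sinE field_simps)
  show ?cos unfolding c F_def using i[of 0] i[of 1] i[of "-1"] by (simp del: mult_minus1 mult_1 mult_zero_left)
  show ?sin unfolding s F_def using i[of 0] i[of 1] i[of "-1"] by (simp del: mult_minus1 mult_1 mult_zero_left)
  let ?I = "\<lambda>x. p x * indicator B (y x)"
  have bd: "norm (?I x * w) \<le> 1" if "\<bar>w\<bar> \<le> 1" for x w
  proof -
    have "\<bar>?I x\<bar> \<le> 1" using p by (auto simp: indicator_def)
    then show ?thesis using that mult_le_one[of "\<bar>?I x\<bar>" "\<bar>w\<bar>"]
      unfolding real_norm_def abs_mult[of "?I x"] by simp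
  qed
  have I: "integrable L ?I"
    using bd[of 1] by (intro L.integrable_const_bound[where B=1] AE_I2) simp_all
  have Ic: "integrable L (\<lambda>x. ?I x * cos (z x))" "integrable L (\<lambda>x. ?I x * sin (z x))"
    by (intro L.integrable_const_bound[where B=1] AE_I2 bd abs_cos_le_one abs_sin_le_one; measurable)+
  have J: "J (\<lambda>x. 1 + cos (z x)) - J (\<lambda>_. 1) = (\<integral>x. ?I x * cos (z x) \<partial>L)"
    "J (\<lambda>x. 1 + sin (z x)) - J (\<lambda>_. 1) = (\<integral>x. ?I x * sin (z x) \<partial>L)"
    using Bochner_Integration.integral_add[OF I Ic(1)] Bochner_Integration.integral_add[OF I Ic(2)]
    by (simp_all add: J_def algebra_simps)
  have "(\<integral>x. of_real (?I x) * iexp (z x) \<partial>L)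
     = (\<integral>x. of_real (?I x * cos (z x)) + \<i> * of_real (?I x * sin (z x)) \<partial>L)"
    by (intro Bochner_Integration.integral_cong refl)
      (simp add: exp_Euler cos_of_real sin_of_real algebra_simps)
  also have "\<dots> = of_real (\<integral>x. ?I x * cos (z x) \<partial>L) + \<i> * of_real (\<integral>x. ?I x * sin (z x) \<partial>L)"
    using Ic by (subst Bochner_Integration.integral_add)
      (auto simp del: of_real_mult intro!: integrable_mult_right integrable_of_real)
  finally show ?ind unfolding J .
qed

text \<open>The induction step of the uniqueness theorem: moves one variable out of the exponential and into an indicator.\<close>

lemma char_indicator_step:
  fixes X Z P :: "'a \<Rightarrow> real" and X' Z' P' :: "'b \<Rightarrow> real"
  assumes M: "finite_measure M" and N: "finite_measure N"
    and m[measurable]: "X \<in> borel_measurable M" "Z \<in> borel_measurable M" "P \<in> borel_measurable M"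
      "X' \<in> borel_measurable N" "Z' \<in> borel_measurable N" "P' \<in> borel_measurable N" and B: "B \<in> sets borel"
    and P: "\<And>x. 0 \<le> P x" "\<And>x. P x \<le> 1" and P': "\<And>x. 0 \<le> P' x" "\<And>x. P' x \<le> 1"
    and char: "\<And>s e. (\<integral>x. of_real (P x) * iexp (s * X x + e * Z x) \<partial>M)
       = (\<integral>x. of_real (P' x) * iexp (s * X' x + e * Z' x) \<partial>N)"
  shows "(\<integral>x. of_real (P x * indicator B (X x)) * iexp (Z x) \<partial>M)
       = (\<integral>x. of_real (P' x * indicator B (X' x)) * iexp (Z' x) \<partial>N)"
proof -
  note dM = trigonometric_weights[OF M m(1-3) B P]
  note dN = trigonometric_weights[OF N m(4-6) B P']
  have bnd: "p * (1 + w) \<le> 2" "0 \<le> p * (1 + w)" if "0 \<le> p" "p \<le> 1" "-1 \<le> w" "w \<le> 1" for p w :: real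
    using mult_mono[of p 1 "1 + w" 2] that by simp_all
  have "(\<integral>x. P x * (1 + cos (Z x)) * indicator B (X x) \<partial>M) = (\<integral>x. P' x * (1 + cos (Z' x)) * indicator B (X' x) \<partial>N)"
    by (rule weighted_char_unique[OF M N _ _ _ _ B _ _ _ _ dM(1)[unfolded char, folded dN(1)], where K=2])
      (auto intro!: bnd P P')
  moreover have "(\<integral>x. P x * (1 + sin (Z x)) * indicator B (X x) \<partial>M) = (\<integral>x. P' x * (1 + sin (Z' x)) * indicator B (X' x) \<partial>N)"
    by (rule weighted_char_unique[OF M N _ _ _ _ B _ _ _ _ dM(2)[unfolded char, folded dN(2)], where K=2])
      (auto intro!: bnd P P')
  moreover have "(\<integral>x. P x * 1 * indicator B (X x) \<partial>M) = (\<integral>x. P' x * 1 * indicator B (X' x) \<partial>N)"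
    by (rule weighted_char_unique[OF M N _ _ _ _ B, where K=1]) (use char[of _ 0] P P' in auto)
  ultimately show ?thesis unfolding dM(3) dN(3) by simp
qed

text \<open>Reduction of the uniqueness theorem for random vectors to Levy's theorem on the line: the
  coordinates leave the exponential one at a time, each leaving behind the indicator of a Borel set,
  until the probability of a box remains.\<close>

lemma char_determines_law:
  fixes X :: "'i \<Rightarrow> 'a \<Rightarrow> real" and Y :: "'i \<Rightarrow> 'b \<Rightarrow> real"
  assumes M: "prob_space M" and N: "prob_space N" and fin: "finite I"
    and X[measurable]: "\<And>i. i \<in> I \<Longrightarrow> X i \<in> borel_measurable M"
    and Y[measurable]: "\<And>i. i \<in> I \<Longrightarrow> Y i \<in> borel_measurable N"
    and char: "\<And>v. (\<integral>\<omega>. iexp (\<Sum>i\<in>I. v i * X i \<omega>) \<partial>M) = (\<integral>\<omega>. iexp (\<Sum>i\<in>I. v i * Y i \<omega>) \<partial>N)"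
  shows "distr M (PiM I (\<lambda>_. borel)) (\<lambda>\<omega>. \<lambda>i\<in>I. X i \<omega>) = distr N (PiM I (\<lambda>_. borel)) (\<lambda>\<omega>. \<lambda>i\<in>I. Y i \<omega>)"
proof -
  interpret M: prob_space M by fact
  interpret N: prob_space N by fact
  have main: "(\<integral>\<omega>. of_real (\<Prod>i\<in>J. indicator (B i) (X i \<omega>)) * iexp (\<Sum>i\<in>I-J. v i * X i \<omega>) \<partial>M)
      = (\<integral>\<omega>. of_real (\<Prod>i\<in>J. indicator (B i) (Y i \<omega>)) * iexp (\<Sum>i\<in>I-J. v i * Y i \<omega>) \<partial>N)"
    if J: "J \<subseteq> I" and B: "\<And>i. i \<in> I \<Longrightarrow> B i \<in> sets borel" for J B v
    using finite_subset[OF J fin] J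
  proof (induction J arbitrary: v rule: finite_induct)
    case empty
    show ?case using char by simp
  next
    case (insert a J)
    then have a: "a \<in> I" "a \<notin> J" "finite J" "J \<subseteq> I" by auto
    note [measurable] = B[OF a(1)] X[OF a(1)] Y[OF a(1)]
    have Bm: "B i \<in> sets borel" if "i \<in> J" for i using B that a by auto
    have Xm: "X i \<in> borel_measurable M" "Y i \<in> borel_measurable N" if "i \<in> J" for i
      using X Y that a by auto
    let ?R = "I - insert a J"
    have split: "(\<Sum>i\<in>I-J. (if i = a then s else e * v i) * z i) = s * z a + e * (\<Sum>i\<in>?R. v i * z i)" for s e and z :: "'i \<Rightarrow> real"
    proof -
      have eq: "I - J = insert a ?R" using a by auto
      have "(\<Sum>i\<in>I-J. (if i = a then s else e * v i) * z i) = s * z a + (\<Sum>i\<in>?R. (if i = a then s else e * v i) * z i)"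
        unfolding eq using fin by (subst sum.insert) auto
      also have "(\<Sum>i\<in>?R. (if i = a then s else e * v i) * z i) = e * (\<Sum>i\<in>?R. v i * z i)"
        unfolding sum_distrib_left by (intro sum.cong) auto
      finally show ?thesis .
    qed
    have ind: "(\<Prod>i\<in>insert a J. indicator (B i) (z i)) = (\<Prod>i\<in>J. indicator (B i) (z i)) * indicator (B a) (z a)" for z :: "'i \<Rightarrow> real"
      using a by (simp add: mult.commute)
    have bnd: "0 \<le> (\<Prod>i\<in>J. indicator (B i) (z i) :: real)" "(\<Prod>i\<in>J. indicator (B i) (z i) :: real) \<le> 1" for z :: "'i \<Rightarrow> real"
      by (auto intro!: prod_nonneg prod_le_1)
    show ?case
      unfolding ind
    proof (rule char_indicator_step)
      show "finite_measure M" "finite_measure N" by unfold_locales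
      show "(\<lambda>\<omega>. \<Prod>i\<in>J. indicator (B i) (X i \<omega>) :: real) \<in> borel_measurable M"
        "(\<lambda>\<omega>. \<Prod>i\<in>J. indicator (B i) (Y i \<omega>) :: real) \<in> borel_measurable N"
        using Bm Xm by measurable
      show "(\<integral>\<omega>. of_real (\<Prod>i\<in>J. indicator (B i) (X i \<omega>)) * iexp (s * X a \<omega> + e * (\<Sum>i\<in>?R. v i * X i \<omega>)) \<partial>M)
        = (\<integral>\<omega>. of_real (\<Prod>i\<in>J. indicator (B i) (Y i \<omega>)) * iexp (s * Y a \<omega> + e * (\<Sum>i\<in>?R. v i * Y i \<omega>)) \<partial>N)" for s e
        using insert.IH[of "\<lambda>i. if i = a then s else e * v i"] a(4) unfolding split by simp
    qed (use bnd X Y in auto)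
  qed
  have Xr[measurable]: "(\<lambda>\<omega>. \<lambda>i\<in>I. X i \<omega>) \<in> measurable M (PiM I (\<lambda>_. borel))"
    and Yr[measurable]: "(\<lambda>\<omega>. \<lambda>i\<in>I. Y i \<omega>) \<in> measurable N (PiM I (\<lambda>_. borel))"
    by (auto intro!: measurable_restrict)
  have meas: "measure (distr L (PiM I (\<lambda>_. borel)) (\<lambda>\<omega>. \<lambda>i\<in>I. Z i \<omega>)) (PiE I B) = (\<integral>\<omega>. (\<Prod>i\<in>I. indicator (B i) (Z i \<omega>)) \<partial>L)"
    if "prob_space L" and Z: "\<And>i. i \<in> I \<Longrightarrow> Z i \<in> borel_measurable L" and B: "\<And>i. i \<in> I \<Longrightarrow> B i \<in> sets borel"
    for L :: "'c measure" and Z :: "'i \<Rightarrow> 'c \<Rightarrow> real" and B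
  proof -
    have "(\<lambda>\<omega>. \<lambda>i\<in>I. Z i \<omega>) \<in> measurable L (PiM I (\<lambda>_. borel))"
      using Z by (auto intro!: measurable_restrict)
    moreover have "PiE I B \<in> sets (PiM I (\<lambda>_. borel))"
      using fin B by (intro sets_PiM_I_finite) auto
    ultimately have "measure (distr L (PiM I (\<lambda>_. borel)) (\<lambda>\<omega>. \<lambda>i\<in>I. Z i \<omega>)) (PiE I B)
        = measure L ((\<lambda>\<omega>. \<lambda>i\<in>I. Z i \<omega>) -` PiE I B \<inter> space L)"
      by (rule measure_distr)
    also have "\<dots> = (\<integral>\<omega>. indicator ((\<lambda>\<omega>. \<lambda>i\<in>I. Z i \<omega>) -` PiE I B) \<omega> \<partial>L)"
      by simp
    also have "\<dots> = (\<integral>\<omega>. (\<Prod>i\<in>I. indicator (B i) (Z i \<omega>)) \<partial>L)"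
    proof (intro Bochner_Integration.integral_cong refl)
      fix \<omega>
      have "(\<lambda>i\<in>I. Z i \<omega>) \<in> PiE I B \<longleftrightarrow> (\<forall>i\<in>I. Z i \<omega> \<in> B i)" by (auto simp: PiE_iff)
      then show "indicator ((\<lambda>\<omega>. \<lambda>i\<in>I. Z i \<omega>) -` PiE I B) \<omega> = (\<Prod>i\<in>I. indicator (B i) (Z i \<omega>) :: real)"
        using fin by (cases "\<forall>i\<in>I. Z i \<omega> \<in> B i") (auto simp: indicator_def prod_zero_iff)
    qed
    finally show ?thesis .
  qed
  interpret DM: prob_space "distr M (PiM I (\<lambda>_. borel)) (\<lambda>\<omega>. \<lambda>i\<in>I. X i \<omega>)"
    by (rule M.prob_space_distr) simp
  interpret DN: prob_space "distr N (PiM I (\<lambda>_. borel)) (\<lambda>\<omega>. \<lambda>i\<in>I. Y i \<omega>)"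
    by (rule N.prob_space_distr) simp
  show ?thesis
  proof (rule measure_eqI_PiM_finite[OF fin, where A="\<lambda>_::nat. PiE I (\<lambda>_. UNIV)"])
    fix B :: "'i \<Rightarrow> real set" assume B: "\<And>i. i \<in> I \<Longrightarrow> B i \<in> sets borel"
    have "of_real (\<integral>\<omega>. (\<Prod>i\<in>I. indicator (B i) (X i \<omega>)) \<partial>M) = (of_real (\<integral>\<omega>. (\<Prod>i\<in>I. indicator (B i) (Y i \<omega>)) \<partial>N) :: complex)"
      using main[of I B] B by (simp del: of_real_prod flip: integral_of_real)
    then have "(\<integral>\<omega>. (\<Prod>i\<in>I. indicator (B i) (X i \<omega>)) \<partial>M) = (\<integral>\<omega>. (\<Prod>i\<in>I. indicator (B i) (Y i \<omega>)) \<partial>N :: real)"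
      using of_real_eq_iff by blast
    then show "emeasure (distr M (PiM I (\<lambda>_. borel)) (\<lambda>\<omega>. \<lambda>i\<in>I. X i \<omega>)) (PiE I B)
      = emeasure (distr N (PiM I (\<lambda>_. borel)) (\<lambda>\<omega>. \<lambda>i\<in>I. Y i \<omega>)) (PiE I B)"
      using meas[OF M X B] meas[OF N Y B] unfolding DM.emeasure_eq_measure DN.emeasure_eq_measure by simp
  next
    show "range (\<lambda>_::nat. PiE I (\<lambda>_. UNIV)) \<subseteq> prod_algebra I (\<lambda>_. borel :: real measure)"
      using fin by (auto intro!: prod_algebraI_finite)
  qed (auto simp: space_PiM)
qed

section \<open>Finite-dimensional laws of fractional Brownian motion\<close>

text \<open>Cholesky factorisation by Schur complements. A vanishing diagonal entry forces its whole row to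
  vanish, and since division by zero yields zero the same formulas cover this case.\<close>

lemma psd_gram:
  fixes C :: "'i \<Rightarrow> 'i \<Rightarrow> real"
  assumes "finite I" and "\<And>k l. k \<in> I \<Longrightarrow> l \<in> I \<Longrightarrow> C k l = C l k"
    and "\<And>v. 0 \<le> (\<Sum>k\<in>I. \<Sum>l\<in>I. v k * v l * C k l)"
  shows "\<exists>A. \<forall>k\<in>I. \<forall>l\<in>I. C k l = (\<Sum>u\<in>I. A k u * A l u)"
  using assms
proof (induction I arbitrary: C rule: finite_induct)
  case empty
  show ?case by simp
next
  case (insert i I)
  note fin = insert.hyps(1) and iI = insert.hyps(2)
  have symi: "C k i = C i k" if "k \<in> I" for k using insert.prems(1) that by simp
  have expand: "(\<Sum>k\<in>insert i I. \<Sum>l\<in>insert i I. v k * v l * C k l)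
     = v i * v i * C i i + 2 * v i * (\<Sum>l\<in>I. v l * C i l) + (\<Sum>k\<in>I. \<Sum>l\<in>I. v k * v l * C k l)" for v
  proof -
    have "(\<Sum>k\<in>I. v k * v i * C k i) = v i * (\<Sum>l\<in>I. v l * C i l)"
      unfolding sum_distrib_left by (intro sum.cong refl) (simp add: symi)
    moreover have "(\<Sum>l\<in>I. v i * v l * C i l) = v i * (\<Sum>l\<in>I. v l * C i l)"
      unfolding sum_distrib_left by (intro sum.cong refl) simp
    ultimately show ?thesis
      using fin iI by (simp add: sum.distrib)
  qed
  have psd: "0 \<le> x * x * C i i + 2 * x * (\<Sum>l\<in>I. v l * C i l) + (\<Sum>k\<in>I. \<Sum>l\<in>I. v k * v l * C k l)" for x v
  proof -
    have "(\<Sum>l\<in>I. (v(i := x)) l * C i l) = (\<Sum>l\<in>I. v l * C i l)"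
      using iI by (intro sum.cong) auto
    moreover have "(\<Sum>k\<in>I. \<Sum>l\<in>I. (v(i := x)) k * (v(i := x)) l * C k l) = (\<Sum>k\<in>I. \<Sum>l\<in>I. v k * v l * C k l)"
      using iI by (intro sum.cong) auto
    ultimately show ?thesis
      using insert.prems(2)[of "v(i := x)"] unfolding expand by simp
  qed
  define d where "d = C i i"
  have d: "0 \<le> d" using psd[of 1 "\<lambda>_. 0"] by (simp add: d_def)
  have zero: "C i l = 0" if l: "l \<in> I" and d: "d = 0" for l
  proof (rule ccontr)
    assume nz: "C i l \<noteq> 0"
    define v where "v = (\<lambda>k. if k = l then 1 else 0 :: real)"
    have v: "(\<Sum>k\<in>I. v k * g k) = g l" for g :: "'i \<Rightarrow> real"
    proof -
      have "(\<Sum>k\<in>I. v k * g k) = (\<Sum>k\<in>I. if k = l then g k else 0)"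
        unfolding v_def by (intro sum.cong) auto
      then show ?thesis using fin l by simp
    qed
    have "(\<Sum>k\<in>I. \<Sum>m\<in>I. v k * v m * C k m) = C l l"
      unfolding mult.assoc v sum_distrib_left[symmetric] ..
    then have "0 \<le> 2 * x * C i l + C l l" for x
      using psd[of x v] d unfolding v d_def by simp
    from this[of "- (C l l + 1) / (2 * C i l)"] nz show False by (simp add: field_simps)
  qed
  define C' where "C' k l = C k l - C i k * C i l / d" for k l
  have "0 \<le> (\<Sum>k\<in>I. \<Sum>l\<in>I. v k * v l * C' k l)" for v
  proof -
    define s where "s = (\<Sum>l\<in>I. v l * C i l)"
    have "(\<Sum>k\<in>I. \<Sum>l\<in>I. v k * v l * (C i k * C i l / d)) = s * s / d"
      unfolding s_def sum_product sum_divide_distrib by (intro sum.cong refl) simp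
    then have "(\<Sum>k\<in>I. \<Sum>l\<in>I. v k * v l * C' k l) = (\<Sum>k\<in>I. \<Sum>l\<in>I. v k * v l * C k l) - s * s / d"
      unfolding C'_def right_diff_distrib sum_subtractf by simp
    moreover have "0 \<le> (- s / d) * (- s / d) * d + 2 * (- s / d) * s + (\<Sum>k\<in>I. \<Sum>l\<in>I. v k * v l * C k l)"
      using psd[of "- s / d" v] unfolding s_def d_def .
    moreover have "(- s / d) * (- s / d) * d + 2 * (- s / d) * s = - (s * s / d)"
      by (cases "d = 0") (simp_all add: field_simps)
    ultimately show ?thesis by linarith
  qed
  then obtain A where A: "\<And>k l. k \<in> I \<Longrightarrow> l \<in> I \<Longrightarrow> C' k l = (\<Sum>u\<in>I. A k u * A l u)"
    using insert.IH[of C'] insert.prems(1) by (auto simp: C'_def mult.commute)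
  define A' where "A' k u = (if u = i then C i k / sqrt d else if k = i then 0 else A k u)" for k u
  have "C k l = (\<Sum>u\<in>insert i I. A' k u * A' l u)" if kl: "k \<in> insert i I" "l \<in> insert i I" for k l
  proof -
    have "(\<Sum>u\<in>insert i I. A' k u * A' l u) = C i k * C i l / d + (\<Sum>u\<in>I. A' k u * A' l u)"
      using fin iI d by (simp add: A'_def)
    also have "\<dots> = C k l"
    proof (cases "k = i \<or> l = i")
      case True
      then have "(\<Sum>u\<in>I. A' k u * A' l u) = 0" using iI by (intro sum.neutral) (auto simp: A'_def)
      moreover have row: "d * C i m / d = C i m" if "m \<in> insert i I" for m
        using zero[of m] that by (cases "d = 0") (auto simp: d_def)
      have "C i k * C i l / d = C k l"
        using True
      proof
        assume "k = i"
        then show ?thesis using row[OF kl(2)] by (simp add: d_def)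
      next
        assume l: "l = i"
        then have "C k i = C i k" using kl(1) symi by (cases "k = i") auto
        then show ?thesis using row[OF kl(1)] l by (simp add: d_def mult.commute)
      qed
      ultimately show ?thesis by simp
    next
      case False
      then have "(\<Sum>u\<in>I. A' k u * A' l u) = (\<Sum>u\<in>I. A k u * A l u)"
        using iI by (intro sum.cong) (auto simp: A'_def)
      then show ?thesis using A[of k l] False kl by (auto simp: C'_def)
    qed
    finally show ?thesis by simp
  qed
  then show ?case by blast
qed

lemma (in prob_space) centred_gaussian_char:
  assumes Z: "gaussian_rv M Z" and mean: "expectation Z = 0"
  shows "integrable M (\<lambda>\<omega>. (Z \<omega>)\<^sup>2)"
    and "(\<integral>\<omega>. iexp (Z \<omega>) \<partial>M) = of_real (exp (- expectation (\<lambda>\<omega>. (Z \<omega>)\<^sup>2) / 2))"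
proof -
  have [measurable]: "Z \<in> borel_measurable M" using Z by (simp add: gaussian_rv_def)
  consider \<mu> where "AE \<omega> in M. Z \<omega> = \<mu>"
    | \<mu> s where "0 < s" "distributed M lborel Z (normal_density \<mu> s)"
    using Z unfolding gaussian_rv_def by blast
  then have "integrable M (\<lambda>\<omega>. (Z \<omega>)\<^sup>2) \<and>
    (\<integral>\<omega>. iexp (Z \<omega>) \<partial>M) = of_real (exp (- expectation (\<lambda>\<omega>. (Z \<omega>)\<^sup>2) / 2))"
  proof cases
    case 1
    have "expectation Z = expectation (\<lambda>_. \<mu>)" using 1 by (intro integral_cong_AE) auto
    with mean have "\<mu> = 0" using prob_space by simp
    with 1 have AE: "AE \<omega> in M. Z \<omega> = 0" by simp
    have "integrable M (\<lambda>\<omega>. (Z \<omega>)\<^sup>2)"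
      by (subst integrable_cong_AE[where g="\<lambda>_. 0"]) (use AE in auto)
    moreover have "expectation (\<lambda>\<omega>. (Z \<omega>)\<^sup>2) = expectation (\<lambda>_. 0)"
      using AE by (intro integral_cong_AE) auto
    moreover have "(\<integral>\<omega>. iexp (Z \<omega>) \<partial>M) = (\<integral>\<omega>. 1 \<partial>M)"
      using AE by (intro integral_cong_AE) auto
    ultimately show ?thesis using prob_space by simp
  next
    case 2
    have \<mu>: "\<mu> = 0" using normal_distributed_expectation[OF 2] mean by simp
    have var: "expectation (\<lambda>\<omega>. (Z \<omega>)\<^sup>2) = s\<^sup>2"
      using normal_distributed_variance[OF 2] mean by simp
    have int: "integrable M (\<lambda>\<omega>. (Z \<omega>)\<^sup>2)"
      using var 2(1) not_integrable_integral_eq by fastforce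
    have std: "distributed M lborel (\<lambda>\<omega>. Z \<omega> / s) std_normal_density"
      using 2(2) normal_standard_normal_convert[OF 2(1), of Z \<mu>] \<mu> by simp
    have "distr M lborel (\<lambda>\<omega>. Z \<omega> / s) = std_normal_distribution"
      using distributed_distr_eq_density[OF std] by simp
    then have "distr M borel (\<lambda>\<omega>. Z \<omega> / s) = std_normal_distribution"
      by (metis distr_cong sets_lborel)
    then have "char (distr M borel (\<lambda>\<omega>. Z \<omega> / s)) s = of_real (exp (- s\<^sup>2 / 2))"
      by (simp add: char_std_normal_distribution)
    moreover have "char (distr M borel (\<lambda>\<omega>. Z \<omega> / s)) s = (\<integral>\<omega>. iexp (Z \<omega>) \<partial>M)"
      unfolding char_def using 2(1) by (subst integral_distr) auto
    ultimately show ?thesis using int var by simp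
  qed
  then show "integrable M (\<lambda>\<omega>. (Z \<omega>)\<^sup>2)"
    "(\<integral>\<omega>. iexp (Z \<omega>) \<partial>M) = of_real (exp (- expectation (\<lambda>\<omega>. (Z \<omega>)\<^sup>2) / 2))" by auto
qed

lemma borel_measurable_vecI:
  fixes f :: "'a \<Rightarrow> real ^ 'n"
  assumes "\<And>j. (\<lambda>\<omega>. f \<omega> $ j) \<in> borel_measurable M"
  shows "f \<in> borel_measurable M"
  unfolding borel_measurable_euclidean_space[of f]
  using assms by (auto simp: Basis_vec_def inner_axis)

context prob_space
begin

context
  fixes H :: real and I :: "real set" and W :: "real \<Rightarrow> 'a \<Rightarrow> real ^ 'm"
  assumes fbm: "fractional_brownian_motion M H I W"
begin

lemma fbm_gaussian_rv:
  assumes "finite S" "S \<subseteq> I"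
  shows "gaussian_rv M (\<lambda>\<omega>. \<Sum>t\<in>S. c t * W t \<omega> $ j)"
proof -
  have "gaussian_process M I (\<lambda>t \<omega>. W t \<omega> $ j)"
    using fbm by (simp add: fractional_brownian_motion_def)
  then show ?thesis using assms by (simp add: gaussian_process_def)
qed

lemma fbm_mean: "t \<in> I \<Longrightarrow> expectation (\<lambda>\<omega>. W t \<omega> $ j) = 0"
  using fbm by (simp add: fractional_brownian_motion_def)

lemma fbm_covariance: "s \<in> I \<Longrightarrow> t \<in> I \<Longrightarrow> expectation (\<lambda>\<omega>. W s \<omega> $ j * W t \<omega> $ j) = fbm_cov H s t"
  using fbm by (simp add: fractional_brownian_motion_def)

lemma fbm_single:
  assumes t: "t \<in> I"
  shows "gaussian_rv M (\<lambda>\<omega>. W t \<omega> $ j)"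
proof -
  have "gaussian_rv M (\<lambda>\<omega>. \<Sum>s\<in>{t}. 1 * W s \<omega> $ j)"
    by (rule fbm_gaussian_rv) (use t in auto)
  then show ?thesis by simp
qed

lemma fbm_nth_measurable: "t \<in> I \<Longrightarrow> (\<lambda>\<omega>. W t \<omega> $ j) \<in> borel_measurable M"
  by (drule fbm_single[where j=j]) (simp only: gaussian_rv_def)

lemma fbm_measurable: "t \<in> I \<Longrightarrow> W t \<in> borel_measurable M"
  by (rule borel_measurable_vecI, rule fbm_nth_measurable)

lemma fbm_square_integrable:
  "t \<in> I \<Longrightarrow> integrable M (\<lambda>\<omega>. (W t \<omega> $ j)\<^sup>2)"
  by (rule centred_gaussian_char(1), rule fbm_single, assumption, rule fbm_mean)

lemma fbm_integrable:
  assumes t: "t \<in> I"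
  shows "integrable M (\<lambda>\<omega>. W t \<omega> $ j)"
  by (rule square_integrable_imp_integrable) (intro fbm_nth_measurable fbm_square_integrable t)+

lemma fbm_product_integrable:
  assumes st: "s \<in> I" "t \<in> I"
  shows "integrable M (\<lambda>\<omega>. W s \<omega> $ j * W t \<omega> $ j)"
proof (rule Bochner_Integration.integrable_bound)
  show "integrable M (\<lambda>\<omega>. (W s \<omega> $ j)\<^sup>2 + (W t \<omega> $ j)\<^sup>2)"
    using st by (intro Bochner_Integration.integrable_add fbm_square_integrable)
  show "(\<lambda>\<omega>. W s \<omega> $ j * W t \<omega> $ j) \<in> borel_measurable M"
    using st by (intro borel_measurable_times fbm_nth_measurable)
  have "\<bar>x * y\<bar> \<le> x\<^sup>2 + y\<^sup>2" for x y :: real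
  proof -
    have "0 \<le> (\<bar>x\<bar> - \<bar>y\<bar>)\<^sup>2" by simp
    then have "2 * \<bar>x * y\<bar> \<le> x\<^sup>2 + y\<^sup>2" by (simp add: power2_diff abs_mult)
    then show ?thesis by simp
  qed
  then show "AE \<omega> in M. norm (W s \<omega> $ j * W t \<omega> $ j) \<le> norm ((W s \<omega> $ j)\<^sup>2 + (W t \<omega> $ j)\<^sup>2)"
    by (intro AE_I2) simp
qed

lemma fbm_combination_variance:
  assumes S: "finite S" "S \<subseteq> I"
  shows "expectation (\<lambda>\<omega>. (\<Sum>t\<in>S. c t * W t \<omega> $ j)\<^sup>2) = (\<Sum>s\<in>S. \<Sum>t\<in>S. c s * c t * fbm_cov H s t)"
proof -
  have "expectation (\<lambda>\<omega>. (\<Sum>t\<in>S. c t * W t \<omega> $ j)\<^sup>2)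
      = expectation (\<lambda>\<omega>. \<Sum>s\<in>S. \<Sum>t\<in>S. (c s * c t) * (W s \<omega> $ j * W t \<omega> $ j))"
    unfolding power2_eq_square sum_product by (simp add: ac_simps)
  also have "\<dots> = (\<Sum>s\<in>S. expectation (\<lambda>\<omega>. \<Sum>t\<in>S. (c s * c t) * (W s \<omega> $ j * W t \<omega> $ j)))"
    using S by (intro Bochner_Integration.integral_sum Bochner_Integration.integrable_sum
      integrable_mult_right fbm_product_integrable) auto
  also have "\<dots> = (\<Sum>s\<in>S. \<Sum>t\<in>S. expectation (\<lambda>\<omega>. (c s * c t) * (W s \<omega> $ j * W t \<omega> $ j)))"
    using S by (intro sum.cong refl Bochner_Integration.integral_sum
      integrable_mult_right fbm_product_integrable) auto
  also have "\<dots> = (\<Sum>s\<in>S. \<Sum>t\<in>S. c s * c t * fbm_cov H s t)"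
    using S by (intro sum.cong refl) (auto simp: fbm_covariance subset_eq)
  finally show ?thesis .
qed

lemma fbm_combination_char:
  assumes S: "finite S" "S \<subseteq> I"
  shows "(\<integral>\<omega>. iexp (\<Sum>t\<in>S. c t * W t \<omega> $ j) \<partial>M)
    = of_real (exp (- (\<Sum>s\<in>S. \<Sum>t\<in>S. c s * c t * fbm_cov H s t) / 2))"
proof -
  have "expectation (\<lambda>\<omega>. \<Sum>t\<in>S. c t * W t \<omega> $ j) = (\<Sum>t\<in>S. expectation (\<lambda>\<omega>. c t * W t \<omega> $ j))"
    using S by (intro Bochner_Integration.integral_sum integrable_mult_right fbm_integrable) auto
  also have "\<dots> = 0"
    using S by (intro sum.neutral) (auto simp: fbm_mean subset_eq)
  finally show ?thesis
    using centred_gaussian_char(2)[OF fbm_gaussian_rv[OF S]]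
    by (simp only: fbm_combination_variance[OF S])
qed

lemma fbm_cov_gram:
  assumes S: "finite S" "S \<subseteq> I"
  obtains A where "\<And>s t. s \<in> S \<Longrightarrow> t \<in> S \<Longrightarrow> fbm_cov H s t = (\<Sum>u\<in>S. A s u * A t u)"
proof -
  have "0 \<le> (\<Sum>s\<in>S. \<Sum>t\<in>S. v s * v t * fbm_cov H s t)" for v
    unfolding fbm_combination_variance[OF S, of v undefined, symmetric]
    by (intro integral_nonneg_AE) auto
  then have "\<exists>A. \<forall>s\<in>S. \<forall>t\<in>S. fbm_cov H s t = (\<Sum>u\<in>S. A s u * A t u)"
    using S by (intro psd_gram) (auto simp: fbm_cov_def abs_minus_commute)
  then show ?thesis using that by blast
qed

end

end

lemma (in prob_space) fbm_joint_char:
  fixes W :: "real \<Rightarrow> 'a \<Rightarrow> real ^ 'm" and v :: "real \<times> 'm \<Rightarrow> real"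
  assumes fbm: "fractional_brownian_motion M H I W"
    and S: "finite S" "S \<subseteq> I"
  shows "(\<integral>\<omega>. iexp (\<Sum>p\<in>S \<times> UNIV. v p * W (fst p) \<omega> $ snd p) \<partial>M)
    = of_real (exp (- (\<Sum>j\<in>UNIV. \<Sum>s\<in>S. \<Sum>t\<in>S. v (s, j) * v (t, j) * fbm_cov H s t) / 2))"
proof -
  have split: "(\<Sum>p\<in>S \<times> UNIV. v p * W (fst p) \<omega> $ snd p) = (\<Sum>j\<in>UNIV. \<Sum>t\<in>S. v (t, j) * W t \<omega> $ j)" for \<omega>
  proof -
    have "(\<Sum>p\<in>S \<times> UNIV. v p * W (fst p) \<omega> $ snd p) = (\<Sum>t\<in>S. \<Sum>j\<in>UNIV. v (t, j) * W t \<omega> $ j)"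
      by (simp only: sum.cartesian_product' fst_conv snd_conv)
    also have "\<dots> = (\<Sum>j\<in>UNIV. \<Sum>t\<in>S. v (t, j) * W t \<omega> $ j)" by (rule sum.swap)
    finally show ?thesis .
  qed
  let ?X = "\<lambda>j \<omega>. iexp (\<Sum>t\<in>S. v (t, j) * W t \<omega> $ j)"
  have indep: "indep_vars (\<lambda>j. PiM I (\<lambda>_. borel)) (\<lambda>j \<omega>. \<lambda>t\<in>I. W t \<omega> $ j) UNIV"
    using fbm by (simp add: fractional_brownian_motion_def)
  have "indep_vars (\<lambda>_. borel) (\<lambda>j \<omega>. (\<lambda>w. iexp (\<Sum>t\<in>S. v (t, j) * w t)) (\<lambda>t\<in>I. W t \<omega> $ j)) UNIV"
  proof (rule indep_vars_compose2[OF indep])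
    fix j :: 'm
    have "(\<lambda>w. w t) \<in> borel_measurable (PiM I (\<lambda>_. borel :: real measure))" if "t \<in> S" for t
      using that S by (intro measurable_component_singleton) auto
    then have "(\<lambda>w. \<Sum>t\<in>S. v (t, j) * w t) \<in> borel_measurable (PiM I (\<lambda>_. borel))"
      by (intro borel_measurable_sum borel_measurable_times) auto
    then show "(\<lambda>w. iexp (\<Sum>t\<in>S. v (t, j) * w t)) \<in> borel_measurable (PiM I (\<lambda>_. borel))"
      by measurable
  qed
  moreover have "(\<lambda>w. iexp (\<Sum>t\<in>S. v (t, j) * w t)) (\<lambda>t\<in>I. W t \<omega> $ j) = ?X j \<omega>" for j \<omega>
    using S by (intro arg_cong[where f=iexp] sum.cong) (auto simp: subset_eq)
  ultimately have ind: "indep_vars (\<lambda>_. borel) ?X UNIV" by simp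
  have "(\<integral>\<omega>. iexp (\<Sum>p\<in>S \<times> UNIV. v p * W (fst p) \<omega> $ snd p) \<partial>M) = (\<integral>\<omega>. (\<Prod>j\<in>UNIV. ?X j \<omega>) \<partial>M)"
    by (simp only: split of_real_sum sum_distrib_left exp_sum[OF finite])
  also have "\<dots> = (\<Prod>j\<in>UNIV. \<integral>\<omega>. ?X j \<omega> \<partial>M)"
  proof (rule indep_vars_lebesgue_integral[OF _ ind])
    fix j :: 'm
    have "(\<lambda>\<omega>. \<Sum>t\<in>S. v (t, j) * W t \<omega> $ j) \<in> borel_measurable M"
      using S by (intro borel_measurable_sum borel_measurable_times fbm_nth_measurable[OF fbm]) auto
    then show "integrable M (?X j)"
      by (intro integrable_const_bound[where B=1]) (auto simp del: of_real_sum of_real_mult)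
  qed simp
  also have "\<dots> = (\<Prod>j\<in>UNIV. of_real (exp (- (\<Sum>s\<in>S. \<Sum>t\<in>S. v (s, j) * v (t, j) * fbm_cov H s t) / 2)))"
    by (simp only: fbm_combination_char[OF fbm S])
  also have "\<dots> = of_real (exp (- (\<Sum>j\<in>UNIV. \<Sum>s\<in>S. \<Sum>t\<in>S. v (s, j) * v (t, j) * fbm_cov H s t) / 2))"
    by (simp only: of_real_prod sum_negf[symmetric] sum_divide_distrib exp_sum[OF finite])
  finally show ?thesis .
qed

lemma std_gauss_char:
  assumes "finite I"
  shows "(\<integral>x. iexp (\<Sum>i\<in>I. v i * x i) \<partial>std_gauss I) = of_real (exp (- (\<Sum>i\<in>I. (v i)\<^sup>2) / 2))"
proof -
  interpret N: product_sigma_finite "\<lambda>_. std_normal_distribution"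
    by (rule product_sigma_finite_std_normal)
  interpret S: real_distribution std_normal_distribution by (rule real_dist_normal_dist)
  have "(\<integral>x. iexp (\<Sum>i\<in>I. v i * x i) \<partial>std_gauss I) = (\<integral>x. (\<Prod>i\<in>I. iexp (v i * x i)) \<partial>std_gauss I)"
    by (simp only: of_real_sum sum_distrib_left exp_sum[OF assms])
  also have "\<dots> = (\<Prod>i\<in>I. \<integral>y. iexp (v i * y) \<partial>std_normal_distribution)"
    using assms by (intro N.product_integral_prod S.integrable_const_bound[where B=1]) auto
  also have "\<dots> = (\<Prod>i\<in>I. of_real (exp (- (v i)\<^sup>2 / 2)))"
    using char_std_normal_distribution by (simp add: char_def fun_eq_iff)
  also have "\<dots> = of_real (exp (- (\<Sum>i\<in>I. (v i)\<^sup>2) / 2))"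
    by (simp only: of_real_prod sum_negf[symmetric] sum_divide_distrib exp_sum[OF assms])
  finally show ?thesis .
qed

text \<open>The components are independent with the same covariance, so one Gram factor \<open>A\<close> in the time variable
  serves them all. The comparison is between characteristic functions, because the process is only
  known to have Gaussian linear combinations.\<close>

lemma (in prob_space) fbm_law:
  fixes W :: "real \<Rightarrow> 'a \<Rightarrow> real ^ 'm"
  assumes fbm: "fractional_brownian_motion M H I W"
    and S: "finite S" "S \<subseteq> I"
    and A: "\<And>s t. s \<in> S \<Longrightarrow> t \<in> S \<Longrightarrow> fbm_cov H s t = (\<Sum>u\<in>S. A s u * A t u)"
  shows "distr M (PiM (S \<times> UNIV) (\<lambda>_. borel)) (\<lambda>\<omega>. \<lambda>p\<in>S \<times> UNIV. W (fst p) \<omega> $ snd p)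
    = distr (std_gauss (S \<times> (UNIV :: 'm set))) (PiM (S \<times> UNIV) (\<lambda>_. borel))
       (\<lambda>x. \<lambda>p\<in>S \<times> UNIV. \<Sum>u\<in>S. A (fst p) u * x (u, snd p))"
proof (rule char_determines_law)
  show "prob_space M" by unfold_locales
  show "prob_space (std_gauss (S \<times> (UNIV :: 'm set)))" by (rule prob_space_std_gauss)
  show "finite (S \<times> (UNIV :: 'm set))" using S by simp
  show "(\<lambda>\<omega>. W (fst p) \<omega> $ snd p) \<in> borel_measurable M" if "p \<in> S \<times> UNIV" for p
    using that S by (intro fbm_nth_measurable[OF fbm]) auto
  show "(\<lambda>x. \<Sum>u\<in>S. A (fst p) u * x (u, snd p)) \<in> borel_measurable (std_gauss (S \<times> (UNIV :: 'm set)))"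
    if "p \<in> S \<times> UNIV" for p
  proof (intro borel_measurable_sum borel_measurable_times borel_measurable_const)
    fix u assume "u \<in> S"
    then have "(\<lambda>x. x (u, snd p)) \<in> measurable (std_gauss (S \<times> (UNIV :: 'm set))) std_normal_distribution"
      by (intro measurable_component_singleton) simp
    then show "(\<lambda>x. x (u, snd p)) \<in> borel_measurable (std_gauss (S \<times> (UNIV :: 'm set)))"
      by (simp cong: measurable_cong_sets)
  qed
  fix v :: "real \<times> 'm \<Rightarrow> real"
  define w where "w q = (\<Sum>t\<in>S. v (t, snd q) * A t (fst q))" for q
  have lin: "(\<Sum>p\<in>S \<times> UNIV. v p * (\<Sum>u\<in>S. A (fst p) u * x (u, snd p))) = (\<Sum>q\<in>S \<times> UNIV. w q * x q)" for x :: "real \<times> 'm \<Rightarrow> real"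
  proof -
    have "(\<Sum>p\<in>S \<times> UNIV. v p * (\<Sum>u\<in>S. A (fst p) u * x (u, snd p)))
      = (\<Sum>t\<in>S. \<Sum>j\<in>UNIV. \<Sum>u\<in>S. v (t, j) * A t u * x (u, j))"
      by (simp only: sum.cartesian_product' fst_conv snd_conv sum_distrib_left mult.assoc)
    also have "\<dots> = (\<Sum>j\<in>UNIV. \<Sum>t\<in>S. \<Sum>u\<in>S. v (t, j) * A t u * x (u, j))" by (rule sum.swap)
    also have "\<dots> = (\<Sum>j\<in>UNIV. \<Sum>u\<in>S. \<Sum>t\<in>S. v (t, j) * A t u * x (u, j))"
      by (intro sum.cong refl sum.swap)
    also have "\<dots> = (\<Sum>u\<in>S. \<Sum>j\<in>UNIV. \<Sum>t\<in>S. v (t, j) * A t u * x (u, j))" by (rule sum.swap)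
    also have "\<dots> = (\<Sum>q\<in>S \<times> UNIV. w q * x q)"
      unfolding w_def by (simp only: sum.cartesian_product' fst_conv snd_conv sum_distrib_right)
    finally show ?thesis .
  qed
  have sq: "(\<Sum>q\<in>S \<times> UNIV. (w q)\<^sup>2) = (\<Sum>j\<in>UNIV. \<Sum>s\<in>S. \<Sum>t\<in>S. v (s, j) * v (t, j) * fbm_cov H s t)"
  proof -
    have "(\<Sum>q\<in>S \<times> UNIV. (w q)\<^sup>2) = (\<Sum>u\<in>S. \<Sum>j\<in>UNIV. (w (u, j))\<^sup>2)"
      by (simp only: sum.cartesian_product')
    also have "\<dots> = (\<Sum>j\<in>UNIV. \<Sum>u\<in>S. (w (u, j))\<^sup>2)" by (rule sum.swap)
    also have "\<dots> = (\<Sum>j\<in>UNIV. \<Sum>s\<in>S. \<Sum>t\<in>S. v (s, j) * v (t, j) * fbm_cov H s t)"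
    proof (rule sum.cong[OF refl])
      fix j :: 'm
      have "(\<Sum>u\<in>S. (w (u, j))\<^sup>2) = (\<Sum>u\<in>S. \<Sum>s\<in>S. \<Sum>t\<in>S. v (s, j) * v (t, j) * (A s u * A t u))"
        unfolding w_def power2_eq_square sum_product by (simp add: ac_simps)
      also have "\<dots> = (\<Sum>s\<in>S. \<Sum>u\<in>S. \<Sum>t\<in>S. v (s, j) * v (t, j) * (A s u * A t u))" by (rule sum.swap)
      also have "\<dots> = (\<Sum>s\<in>S. \<Sum>t\<in>S. \<Sum>u\<in>S. v (s, j) * v (t, j) * (A s u * A t u))"
        by (intro sum.cong refl sum.swap)
      also have "\<dots> = (\<Sum>s\<in>S. \<Sum>t\<in>S. v (s, j) * v (t, j) * fbm_cov H s t)"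
        by (intro sum.cong refl) (simp add: A sum_distrib_left)
      finally show "(\<Sum>u\<in>S. (w (u, j))\<^sup>2) = (\<Sum>s\<in>S. \<Sum>t\<in>S. v (s, j) * v (t, j) * fbm_cov H s t)" .
    qed
    finally show ?thesis .
  qed
  show "(\<integral>\<omega>. iexp (\<Sum>p\<in>S \<times> UNIV. v p * W (fst p) \<omega> $ snd p) \<partial>M)
    = (\<integral>x. iexp (\<Sum>p\<in>S \<times> UNIV. v p * (\<Sum>u\<in>S. A (fst p) u * x (u, snd p))) \<partial>std_gauss (S \<times> (UNIV :: 'm set)))"
    unfolding lin fbm_joint_char[OF fbm S] using S by (subst std_gauss_char) (simp_all add: sq)
qed

section \<open>Sub-Gaussian random variables\<close>

text \<open>The centre \<open>a\<close> is a parameter, so that limits can be taken before it is identified as the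
  expectation.\<close>

definition subgaussian :: "'a measure \<Rightarrow> ('a \<Rightarrow> real) \<Rightarrow> real \<Rightarrow> real \<Rightarrow> bool" where
  "subgaussian M Y a c \<longleftrightarrow> Y \<in> borel_measurable M \<and>
    (\<forall>\<theta>. (\<integral>\<^sup>+\<omega>. ennreal (exp (\<theta> * (Y \<omega> - a))) \<partial>M) \<le> ennreal (exp (\<theta>\<^sup>2 * c\<^sup>2 / 2)))"

lemma subgaussian_measurable: "subgaussian M Y a c \<Longrightarrow> Y \<in> borel_measurable M"
  by (simp add: subgaussian_def)

lemma subgaussian_mgf:
  "subgaussian M Y a c \<Longrightarrow> (\<integral>\<^sup>+\<omega>. ennreal (exp (\<theta> * (Y \<omega> - a))) \<partial>M) \<le> ennreal (exp (\<theta>\<^sup>2 * c\<^sup>2 / 2))"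
  by (simp add: subgaussian_def)

lemma subgaussian_mono:
  assumes "subgaussian M Y a c" "0 \<le> c" "c \<le> c'"
  shows "subgaussian M Y a c'"
proof -
  have "\<theta>\<^sup>2 * c\<^sup>2 / 2 \<le> \<theta>\<^sup>2 * c'\<^sup>2 / 2" for \<theta>
    using assms by (intro divide_right_mono mult_left_mono power_mono) auto
  then have "ennreal (exp (\<theta>\<^sup>2 * c\<^sup>2 / 2)) \<le> ennreal (exp (\<theta>\<^sup>2 * c'\<^sup>2 / 2))" for \<theta>
    by (simp add: ennreal_leI)
  with assms(1) show ?thesis unfolding subgaussian_def by (auto intro: order_trans)
qed

text \<open>\<open>1 + \<theta> * m \<le> exp (\<theta>\<^sup>2 * c\<^sup>2 / 2)\<close> for \<open>\<theta>\<close> of both signs, with equality at \<open>0\<close>, forces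
  \<open>m = 0\<close> for the mean \<open>m\<close> of \<open>Y - a\<close>.\<close>

lemma (in prob_space) subgaussian_mean:
  assumes Y: "subgaussian M Y a c"
  shows "integrable M Y" "expectation Y = a"
proof -
  note [measurable] = subgaussian_measurable[OF Y]
  have ei: "integrable M (\<lambda>\<omega>. exp (\<theta> * (Y \<omega> - a)))"
    and el: "expectation (\<lambda>\<omega>. exp (\<theta> * (Y \<omega> - a))) \<le> exp (\<theta>\<^sup>2 * c\<^sup>2 / 2)" for \<theta>
  proof -
    note b = subgaussian_mgf[OF Y, of \<theta>]
    show i: "integrable M (\<lambda>\<omega>. exp (\<theta> * (Y \<omega> - a)))"
      using le_less_trans[OF b ennreal_less_top] by (intro integrableI_bounded) auto
    show "expectation (\<lambda>\<omega>. exp (\<theta> * (Y \<omega> - a))) \<le> exp (\<theta>\<^sup>2 * c\<^sup>2 / 2)"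
      using b by (subst (asm) nn_integral_eq_integral[OF i]) auto
  qed
  have Yi: "integrable M (\<lambda>\<omega>. Y \<omega> - a)"
  proof (rule Bochner_Integration.integrable_bound)
    show "integrable M (\<lambda>\<omega>. exp (1 * (Y \<omega> - a)) + exp ((-1) * (Y \<omega> - a)))"
      by (intro Bochner_Integration.integrable_add ei)
    have "\<bar>y\<bar> \<le> exp y + exp (- y)" for y :: real
      using exp_ge_add_one_self[of y] exp_ge_add_one_self[of "-y"] exp_ge_zero[of y] exp_ge_zero[of "-y"]
      by linarith
    from this[of "Y _ - a"] show "AE \<omega> in M. norm (Y \<omega> - a) \<le> norm (exp (1 * (Y \<omega> - a)) + exp ((-1) * (Y \<omega> - a)))"
      by (intro AE_I2) simp
  qed simp
  then have "integrable M (\<lambda>\<omega>. (Y \<omega> - a) + a)" by (intro Bochner_Integration.integrable_add) auto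
  then show i: "integrable M Y" by simp
  \<comment> \<open>the function \<open>h\<close> has a minimum at \<open>0\<close>, so its derivative \<open>- m\<close> there vanishes\<close>
  define m where "m = expectation (\<lambda>\<omega>. Y \<omega> - a)"
  define h where "h = (\<lambda>\<theta>::real. exp (\<theta>\<^sup>2 * (c\<^sup>2 / 2)) - \<theta> * m)"
  have "(h has_real_derivative - m) (at 0)"
    unfolding h_def by (auto intro!: derivative_eq_intros)
  moreover have "h 0 \<le> h \<theta>" for \<theta>
  proof -
    have "1 + \<theta> * m = expectation (\<lambda>\<omega>. 1 + \<theta> * (Y \<omega> - a))"
      using Yi prob_space by (simp add: m_def)
    also have "\<dots> \<le> expectation (\<lambda>\<omega>. exp (\<theta> * (Y \<omega> - a)))"
      using Yi ei by (intro integral_mono) auto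
    also have "\<dots> \<le> exp (\<theta>\<^sup>2 * c\<^sup>2 / 2)" by (rule el)
    finally show ?thesis unfolding h_def by simp
  qed
  ultimately have "- m = 0"
    by (intro DERIV_local_min[of h "- m" 0 1]) auto
  then show "expectation Y = a" using i prob_space by (simp add: m_def)
qed

lemma (in prob_space) subgaussian_tail:
  assumes Y: "subgaussian M Y a c" and c: "0 < c" and r: "0 \<le> r"
  shows "prob {\<omega> \<in> space M. Y \<omega> - a \<ge> r} \<le> exp (- r\<^sup>2 / (2 * c\<^sup>2))"
    and "prob {\<omega> \<in> space M. Y \<omega> - a \<le> - r} \<le> exp (- r\<^sup>2 / (2 * c\<^sup>2))"
proof -
  note [measurable] = subgaussian_measurable[OF Y]
  \<comment> \<open>\<open>s = 1\<close> and \<open>s = -1\<close> give the two tails\<close>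
  have gen: "prob {\<omega> \<in> space M. s * (Y \<omega> - a) \<ge> r} \<le> exp (- r\<^sup>2 / (2 * c\<^sup>2))" if s: "s\<^sup>2 = 1" for s :: real
  proof -
    \<comment> \<open>the minimiser of the exponent\<close>
    define \<theta> where "\<theta> = r / c\<^sup>2"
    have th: "0 \<le> \<theta>" using r c by (simp add: \<theta>_def)
    have "emeasure M {\<omega> \<in> space M. s * (Y \<omega> - a) \<ge> r}
        = (\<integral>\<^sup>+\<omega>. indicator {\<omega> \<in> space M. s * (Y \<omega> - a) \<ge> r} \<omega> \<partial>M)" by simp
    also have "\<dots> \<le> (\<integral>\<^sup>+\<omega>. ennreal (exp (- \<theta> * r)) * ennreal (exp ((\<theta> * s) * (Y \<omega> - a))) \<partial>M)"
    proof (intro nn_integral_mono)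
      fix \<omega>
      have "1 \<le> exp (- \<theta> * r) * exp ((\<theta> * s) * (Y \<omega> - a))" if "s * (Y \<omega> - a) \<ge> r"
      proof -
        have "\<theta> * r \<le> \<theta> * (s * (Y \<omega> - a))" using that th by (intro mult_left_mono)
        then show ?thesis by (simp add: exp_add[symmetric] mult.assoc)
      qed
      then show "indicator {\<omega> \<in> space M. s * (Y \<omega> - a) \<ge> r} \<omega> \<le> ennreal (exp (- \<theta> * r)) * ennreal (exp ((\<theta> * s) * (Y \<omega> - a)))"
        by (auto simp: indicator_def ennreal_mult[symmetric] simp flip: ennreal_1 intro!: ennreal_leI)
    qed
    also have "\<dots> = ennreal (exp (- \<theta> * r)) * (\<integral>\<^sup>+\<omega>. ennreal (exp ((\<theta> * s) * (Y \<omega> - a))) \<partial>M)"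
      by (rule nn_integral_cmult) simp
    also have "\<dots> \<le> ennreal (exp (- \<theta> * r)) * ennreal (exp ((\<theta> * s)\<^sup>2 * c\<^sup>2 / 2))"
      by (intro mult_left_mono subgaussian_mgf[OF Y]) simp
    also have "\<dots> = ennreal (exp (- \<theta> * r + (\<theta> * s)\<^sup>2 * c\<^sup>2 / 2))"
      unfolding exp_add by (simp add: ennreal_mult)
    also have "- \<theta> * r + (\<theta> * s)\<^sup>2 * c\<^sup>2 / 2 = - r\<^sup>2 / (2 * c\<^sup>2)"
      unfolding power_mult_distrib s using c by (simp add: \<theta>_def power2_eq_square field_simps)
    finally show ?thesis by (simp add: emeasure_eq_measure)
  qed
  show "prob {\<omega> \<in> space M. Y \<omega> - a \<ge> r} \<le> exp (- r\<^sup>2 / (2 * c\<^sup>2))"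
    using gen[of 1] by simp
  have "{\<omega> \<in> space M. Y \<omega> - a \<le> - r} = {\<omega> \<in> space M. (- 1) * (Y \<omega> - a) \<ge> r}" by auto
  then show "prob {\<omega> \<in> space M. Y \<omega> - a \<le> - r} \<le> exp (- r\<^sup>2 / (2 * c\<^sup>2))"
    using gen[of "-1"] by simp
qed

lemma (in prob_space) subgaussian_average:
  assumes Y: "\<And>i. i < n \<Longrightarrow> subgaussian M (Y i) (a i) c" and n: "0 < (n::nat)"
  shows "subgaussian M (\<lambda>\<omega>. (\<Sum>i<n. Y i \<omega>) / n) ((\<Sum>i<n. a i) / n) c"
  unfolding subgaussian_def
proof (intro conjI allI)
  have Ym[measurable]: "i < n \<Longrightarrow> Y i \<in> borel_measurable M" for i
    using Y by (rule subgaussian_measurable)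
  show "(\<lambda>\<omega>. (\<Sum>i<n. Y i \<omega>) / n) \<in> borel_measurable M" by measurable
  fix \<theta>
  have "exp (\<theta> * ((\<Sum>i<n. Y i \<omega>) / n - (\<Sum>i<n. a i) / n)) \<le> (\<Sum>i<n. 1 / n * exp (\<theta> * (Y i \<omega> - a i)))" for \<omega>
  proof -
    have "\<theta> * ((\<Sum>i<n. Y i \<omega>) / n - (\<Sum>i<n. a i) / n) = (\<Sum>i<n. (1 / n) *\<^sub>R (\<theta> * (Y i \<omega> - a i)))"
      by (simp add: sum_subtractf sum_distrib_left sum_divide_distrib diff_divide_distrib right_diff_distrib)
    moreover have "exp (\<Sum>i<n. (1 / n) *\<^sub>R (\<theta> * (Y i \<omega> - a i))) \<le> (\<Sum>i<n. 1 / n * exp (\<theta> * (Y i \<omega> - a i)))"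
      using n by (intro convex_on_sum[OF _ _ exp_convex]) auto
    ultimately show ?thesis by simp
  qed
  then have "(\<integral>\<^sup>+\<omega>. ennreal (exp (\<theta> * ((\<Sum>i<n. Y i \<omega>) / n - (\<Sum>i<n. a i) / n))) \<partial>M)
    \<le> (\<integral>\<^sup>+\<omega>. (\<Sum>i<n. ennreal (1 / n) * ennreal (exp (\<theta> * (Y i \<omega> - a i)))) \<partial>M)"
    by (intro nn_integral_mono) (simp add: ennreal_mult[symmetric] sum_ennreal ennreal_leI)
  also have "\<dots> = (\<Sum>i<n. (\<integral>\<^sup>+\<omega>. ennreal (1 / n) * ennreal (exp (\<theta> * (Y i \<omega> - a i))) \<partial>M))"
    by (rule nn_integral_sum) auto
  also have "\<dots> = (\<Sum>i<n. ennreal (1 / n) * (\<integral>\<^sup>+\<omega>. ennreal (exp (\<theta> * (Y i \<omega> - a i))) \<partial>M))"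
    by (intro sum.cong refl nn_integral_cmult) auto
  also have "\<dots> \<le> (\<Sum>i<n. ennreal (1 / n) * ennreal (exp (\<theta>\<^sup>2 * c\<^sup>2 / 2)))"
    using Y by (intro sum_mono mult_left_mono subgaussian_mgf) auto
  also have "\<dots> = ennreal (exp (\<theta>\<^sup>2 * c\<^sup>2 / 2))"
    using n by (simp add: ennreal_mult[symmetric] ennreal_of_nat_eq_real_of_nat)
  finally show "(\<integral>\<^sup>+\<omega>. ennreal (exp (\<theta> * ((\<Sum>i<n. Y i \<omega>) / n - (\<Sum>i<n. a i) / n))) \<partial>M) \<le> ennreal (exp (\<theta>\<^sup>2 * c\<^sup>2 / 2))" .
qed

text \<open>Almost sure convergence bounds all \<open>Y n\<close> by one constant on an event of probability more than
  \<open>3 / 5\<close>, whereas each \<open>Y n\<close> is far from its centre with probability at most \<open>2 / 5\<close>. Hence no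
  centre is far from that constant.\<close>

lemma (in prob_space) subgaussian_centres_bounded:
  assumes Y: "\<And>n. subgaussian M (Y n) (a n) c" and c: "0 \<le> c"
    and lim: "AE \<omega> in M. (\<lambda>n. Y n \<omega>) \<longlonglongrightarrow> Z \<omega>"
  shows "bounded (range (a :: nat \<Rightarrow> real))"
proof -
  note [measurable] = subgaussian_measurable[OF Y]
  define K where "K = c + 1"
  have K: "0 < K" using c by (simp add: K_def)
  have YK: "subgaussian M (Y n) (a n) K" for n
    using subgaussian_mono[OF Y c] by (simp add: K_def)
  define A where "A m = {\<omega> \<in> space M. \<forall>n. \<bar>Y n \<omega>\<bar> \<le> real m}" for m :: nat
  have Am[measurable]: "A m \<in> sets M" for m unfolding A_def by measurable
  have inc: "incseq A"
    unfolding A_def incseq_def by (auto intro: order_trans)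
  have "AE \<omega> in M. \<omega> \<in> (\<Union>m. A m)"
    using lim AE_space
  proof eventually_elim
    case (elim \<omega>)
    then have "Bseq (\<lambda>n. Y n \<omega>)" by (intro convergent_imp_Bseq) (auto simp: convergent_def)
    then obtain k where k: "\<And>n. norm (Y n \<omega>) \<le> k" by (auto simp: Bseq_def)
    obtain m :: nat where m: "k \<le> real m" using real_arch_simple by blast
    have "\<omega> \<in> A m" unfolding A_def using elim k m by (auto intro: order_trans)
    then show ?case by auto
  qed
  then have "prob (\<Union>m. A m) = 1" by (intro prob_eq_1[THEN iffD2]) auto
  moreover have "range A \<subseteq> events" using Am by blast
  ultimately have "(\<lambda>m. prob (A m)) \<longlonglongrightarrow> 1"
    using finite_Lim_measure_incseq[OF _ inc] by simp
  then have "\<forall>\<^sub>F m in sequentially. 3/5 < prob (A m)" by (rule order_tendstoD) simp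
  then obtain m where m: "3/5 < prob (A m)" by (auto simp: eventually_sequentially)
  have "\<bar>a n\<bar> \<le> real m + 2 * K" for n
  proof (rule ccontr)
    assume *: "\<not> \<bar>a n\<bar> \<le> real m + 2 * K"
    let ?B1 = "{\<omega> \<in> space M. Y n \<omega> - a n \<ge> 2 * K}" and ?B2 = "{\<omega> \<in> space M. Y n \<omega> - a n \<le> - (2 * K)}"
    have "A m \<subseteq> ?B1 \<union> ?B2"
    proof
      fix \<omega> assume "\<omega> \<in> A m"
      then have "\<omega> \<in> space M" "\<bar>Y n \<omega>\<bar> \<le> real m" by (auto simp: A_def)
      with * show "\<omega> \<in> ?B1 \<union> ?B2" by auto
    qed
    then have "prob (A m) \<le> prob (?B1 \<union> ?B2)" by (intro finite_measure_mono) auto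
    also have "\<dots> \<le> prob ?B1 + prob ?B2" by (intro measure_Un_le) auto
    also have "\<dots> \<le> exp (- (2 * K)\<^sup>2 / (2 * K\<^sup>2)) + exp (- (2 * K)\<^sup>2 / (2 * K\<^sup>2))"
      using K by (intro add_mono subgaussian_tail[OF YK]) auto
    also have "- (2 * K)\<^sup>2 / (2 * K\<^sup>2) = - 2" using K by (simp add: power2_eq_square)
    also have "exp (- 2 :: real) \<le> 1 / 5"
    proof -
      have "(5::real) \<le> exp 2" using exp_lower_Taylor_quadratic[of 2] by simp
      then show ?thesis by (simp add: exp_minus field_simps)
    qed
    finally show False using m by simp
  qed
  then show ?thesis unfolding bounded_iff by auto
qed

text \<open>Along a subsequence on which the centres converge, to \<open>l\<close> say, Fatou's lemma gives the bound for
  \<open>Z\<close> with centre \<open>l\<close>, and then \<open>l\<close> must be the expectation of \<open>Z\<close>. So the expectations converge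
  without a separate argument for uniform integrability.\<close>

lemma (in prob_space) subgaussian_limit:
  assumes Y: "\<And>n. subgaussian M (Y n) (a n) c" and c: "0 \<le> c"
    and Z[measurable]: "Z \<in> borel_measurable M"
    and lim: "AE \<omega> in M. (\<lambda>n. Y n \<omega>) \<longlonglongrightarrow> Z \<omega>"
  shows "subgaussian M Z (expectation Z) c" "a \<longlonglongrightarrow> expectation Z"
proof -
  note [measurable] = subgaussian_measurable[OF Y]
  have step: "subgaussian M Z l c" if l: "(a \<circ> r) \<longlonglongrightarrow> l" and r: "strict_mono r" for l r
    unfolding subgaussian_def
  proof (intro conjI allI)
    fix \<theta>
    have "(\<integral>\<^sup>+\<omega>. ennreal (exp (\<theta> * (Z \<omega> - l))) \<partial>M)
      = (\<integral>\<^sup>+\<omega>. liminf (\<lambda>n. ennreal (exp (\<theta> * (Y (r n) \<omega> - a (r n))))) \<partial>M)"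
    proof (rule nn_integral_cong_AE, use lim in eventually_elim)
      case (elim \<omega>)
      from LIMSEQ_subseq_LIMSEQ[OF elim r]
      have "(\<lambda>n. ennreal (exp (\<theta> * (Y (r n) \<omega> - a (r n))))) \<longlonglongrightarrow> ennreal (exp (\<theta> * (Z \<omega> - l)))"
        using l by (auto intro!: tendsto_intros simp: comp_def)
      then show ?case by (rule lim_imp_Liminf[OF sequentially_bot, symmetric])
    qed
    also have "\<dots> \<le> liminf (\<lambda>n. (\<integral>\<^sup>+\<omega>. ennreal (exp (\<theta> * (Y (r n) \<omega> - a (r n)))) \<partial>M))"
      by (rule nn_integral_liminf) simp
    also have "\<dots> \<le> liminf (\<lambda>n. ennreal (exp (\<theta>\<^sup>2 * c\<^sup>2 / 2)))"
      by (intro Liminf_mono always_eventually allI subgaussian_mgf[OF Y])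
    also have "\<dots> = ennreal (exp (\<theta>\<^sup>2 * c\<^sup>2 / 2))" by (simp add: Liminf_const)
    finally show "(\<integral>\<^sup>+\<omega>. ennreal (exp (\<theta> * (Z \<omega> - l))) \<partial>M) \<le> ennreal (exp (\<theta>\<^sup>2 * c\<^sup>2 / 2))" .
  qed simp
  have bdd: "bounded (range a)" by (rule subgaussian_centres_bounded[OF Y c lim])
  have sub: "\<exists>s. strict_mono s \<and> (a \<circ> (r \<circ> s)) \<longlonglongrightarrow> expectation Z \<and> subgaussian M Z (expectation Z) c"
    if r: "strict_mono r" for r :: "nat \<Rightarrow> nat"
  proof -
    have "bounded (range (a \<circ> r))" using bdd by (rule bounded_subset) auto
    then obtain l s where s: "strict_mono s" "((a \<circ> r) \<circ> s) \<longlonglongrightarrow> l"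
      using bounded_imp_convergent_subsequence by blast
    then have "subgaussian M Z l c"
      using r by (intro step[of "r \<circ> s"]) (auto simp: comp_assoc strict_mono_o)
    moreover from this have "expectation Z = l" by (rule subgaussian_mean)
    ultimately show ?thesis using s by (auto simp: comp_assoc)
  qed
  show "subgaussian M Z (expectation Z) c" using sub[of id] by (auto simp: strict_mono_id)
  show "a \<longlonglongrightarrow> expectation Z"
  proof (rule ccontr)
    assume "\<not> a \<longlonglongrightarrow> expectation Z"
    then obtain e where e: "0 < e" "\<And>N. \<exists>n\<ge>N. \<not> dist (a n) (expectation Z) < e"
      unfolding lim_sequentially by blast
    then have "infinite {n. \<not> dist (a n) (expectation Z) < e}"
      unfolding infinite_nat_iff_unbounded_le by blast
    then obtain r :: "nat \<Rightarrow> nat" where r: "strict_mono r" "\<And>n. \<not> dist (a (r n)) (expectation Z) < e"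
      using infinite_enumerate by blast
    from sub[OF r(1)] obtain s where "(a \<circ> (r \<circ> s)) \<longlonglongrightarrow> expectation Z" by blast
    then have "\<forall>\<^sub>F n in sequentially. dist (a (r (s n))) (expectation Z) < e"
      using e(1) by (auto dest: tendstoD simp: comp_def)
    then show False using r(2) by (auto simp: eventually_sequentially)
  qed
qed

section \<open>Increments of fractional Brownian motion and stability of the Euler scheme\<close>

lemma powr_midpoint_convex:
  fixes a b p :: real
  assumes "0 \<le> a" "0 \<le> b" "1 \<le> p"
  shows "((a + b) / 2) powr p \<le> (a powr p + b powr p) / 2"
proof -
  have half: "(c / 2) powr p \<le> c powr p / 2" if "0 \<le> c" for c :: real
  proof -
    have "(1 / 2 :: real) powr p \<le> (1 / 2) powr 1"
      using assms by (intro powr_mono') auto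
    then have "c powr p * (1 / 2) powr p \<le> c powr p * (1 / 2)"
      by (intro mult_left_mono) auto
    moreover have "(c / 2) powr p = c powr p * (1 / 2) powr p"
      using that by (simp add: powr_mult[symmetric])
    ultimately show ?thesis by simp
  qed
  consider "a = 0" | "b = 0" | "0 < a" "0 < b" using assms by linarith
  then show ?thesis
  proof cases
    case 3
    have "((1 - 1/2) *\<^sub>R a + (1/2) *\<^sub>R b) powr p \<le> (1 - 1/2) * a powr p + (1/2) * b powr p"
      using 3 by (intro convex_onD[OF powr_convex[OF assms(3)]]) auto
    then show ?thesis by (simp add: field_simps)
  qed (use half assms in auto)
qed

text \<open>Convexity of \<open>\<lambda>x. \<bar>x\<bar> powr (2 * H)\<close>, which is where \<open>H \<ge> 1 / 2\<close> enters.\<close>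

lemma fbm_increments_positively_correlated:
  assumes H: "1 / 2 \<le> H" and "0 \<le> \<delta>"
  shows "0 \<le> fbm_cov H (s + \<delta>) (t + \<delta>) - fbm_cov H (s + \<delta>) t - fbm_cov H s (t + \<delta>) + fbm_cov H s t"
proof -
  define x where "x = t - s"
  have "\<bar>x\<bar> powr (2 * H) \<le> ((\<bar>x - \<delta>\<bar> + \<bar>x + \<delta>\<bar>) / 2) powr (2 * H)"
    using assms by (intro powr_mono2) auto
  also have "\<dots> \<le> (\<bar>x - \<delta>\<bar> powr (2 * H) + \<bar>x + \<delta>\<bar> powr (2 * H)) / 2"
    using assms by (intro powr_midpoint_convex) auto
  finally have "2 * \<bar>x\<bar> powr (2 * H) \<le> \<bar>x - \<delta>\<bar> powr (2 * H) + \<bar>x + \<delta>\<bar> powr (2 * H)" by simp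
  moreover have "t + \<delta> - (s + \<delta>) = x" "t - (s + \<delta>) = x - \<delta>" "t + \<delta> - s = x + \<delta>" "t - s = x"
    by (auto simp: x_def)
  ultimately show ?thesis unfolding fbm_cov_def by (simp add: field_simps)
qed

text \<open>With unit vectors \<open>e l\<close> the left side is \<open>\<Sum>l. e l \<bullet> h l\<close>, a linear function of \<open>d\<close>. By the
  Cauchy--Schwarz inequality its norm is the standard deviation of the corresponding combination of
  increments, which is largest when all the \<open>e l\<close> agree because the covariances are nonnegative.\<close>

lemma gram_total_variation:
  fixes a :: "nat \<Rightarrow> 'u \<Rightarrow> real" and d :: "'u \<times> 'm::finite \<Rightarrow> real"
  assumes S: "finite S"
    and pos: "\<And>l m. l < N \<Longrightarrow> m < N \<Longrightarrow> 0 \<le> (\<Sum>u\<in>S. a l u * a m u)"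
  shows "(\<Sum>l<N. norm (\<chi> j. \<Sum>u\<in>S. a l u * d (u, j)))
    \<le> sqrt (\<Sum>u\<in>S. (\<Sum>l<N. a l u)\<^sup>2) * sqrt (\<Sum>p\<in>S \<times> UNIV. (d p)\<^sup>2)"
proof -
  define h :: "nat \<Rightarrow> real ^ 'm" where "h l = (\<chi> j. \<Sum>u\<in>S. a l u * d (u, j))" for l
  define e where "e l = sgn (h l)" for l
  have e1: "norm (e l) \<le> 1" for l by (simp add: e_def norm_sgn)
  define g where "g p = (\<Sum>l<N. e l $ snd p * a l (fst p))" for p :: "'u \<times> 'm"
  have "norm (h l) = e l \<bullet> h l" for l
    by (cases "h l = 0") (simp_all add: e_def sgn_div_norm dot_square_norm power2_eq_square)
  then have "(\<Sum>l<N. norm (h l)) = (\<Sum>l<N. \<Sum>j\<in>UNIV. \<Sum>u\<in>S. e l $ j * (a l u * d (u, j)))"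
    by (simp add: inner_vec_def h_def sum_distrib_left)
  also have "\<dots> = (\<Sum>j\<in>UNIV. \<Sum>l<N. \<Sum>u\<in>S. e l $ j * (a l u * d (u, j)))" by (rule sum.swap)
  also have "\<dots> = (\<Sum>j\<in>UNIV. \<Sum>u\<in>S. \<Sum>l<N. e l $ j * (a l u * d (u, j)))"
    by (rule sum.cong[OF refl], rule sum.swap)
  also have "\<dots> = (\<Sum>u\<in>S. \<Sum>j\<in>UNIV. \<Sum>l<N. e l $ j * (a l u * d (u, j)))" by (rule sum.swap)
  also have "\<dots> = (\<Sum>p\<in>S \<times> UNIV. g p * d p)"
    unfolding g_def by (simp only: sum.cartesian_product' fst_conv snd_conv sum_distrib_right mult.assoc)
  also have "\<dots> \<le> (\<Sum>p\<in>S \<times> UNIV. \<bar>g p\<bar> * \<bar>d p\<bar>)"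
    by (intro sum_mono) (metis abs_ge_self abs_mult)
  also have "\<dots> \<le> L2_set g (S \<times> UNIV) * L2_set d (S \<times> UNIV)"
    by (rule L2_set_mult_ineq)
  also have "\<dots> \<le> sqrt (\<Sum>u\<in>S. (\<Sum>l<N. a l u)\<^sup>2) * L2_set d (S \<times> UNIV)"
  proof (intro mult_right_mono)
    have "(\<Sum>p\<in>S \<times> UNIV. (g p)\<^sup>2) = (\<Sum>u\<in>S. \<Sum>j\<in>UNIV. (\<Sum>l<N. \<Sum>m<N. (e l $ j * e m $ j) * (a l u * a m u)))"
      unfolding g_def power2_eq_square sum_product
      by (simp only: sum.cartesian_product' fst_conv snd_conv) (simp add: ac_simps)
    also have "\<dots> = (\<Sum>u\<in>S. \<Sum>l<N. \<Sum>j\<in>UNIV. \<Sum>m<N. (e l $ j * e m $ j) * (a l u * a m u))"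
      by (rule sum.cong[OF refl], rule sum.swap)
    also have "\<dots> = (\<Sum>l<N. \<Sum>u\<in>S. \<Sum>j\<in>UNIV. \<Sum>m<N. (e l $ j * e m $ j) * (a l u * a m u))"
      by (rule sum.swap)
    also have "\<dots> = (\<Sum>l<N. \<Sum>u\<in>S. \<Sum>m<N. \<Sum>j\<in>UNIV. (e l $ j * e m $ j) * (a l u * a m u))"
      by (rule sum.cong[OF refl], rule sum.cong[OF refl], rule sum.swap)
    also have "\<dots> = (\<Sum>l<N. \<Sum>u\<in>S. \<Sum>m<N. (e l \<bullet> e m) * (a l u * a m u))"
      by (simp add: inner_vec_def sum_distrib_right)
    also have "\<dots> = (\<Sum>l<N. \<Sum>m<N. \<Sum>u\<in>S. (e l \<bullet> e m) * (a l u * a m u))"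
      by (rule sum.cong[OF refl], rule sum.swap)
    also have "\<dots> = (\<Sum>l<N. \<Sum>m<N. (e l \<bullet> e m) * (\<Sum>u\<in>S. a l u * a m u))"
      by (simp add: sum_distrib_left)
    also have "\<dots> \<le> (\<Sum>l<N. \<Sum>m<N. 1 * (\<Sum>u\<in>S. a l u * a m u))"
    proof (intro sum_mono mult_right_mono pos)
      fix l m
      have "e l \<bullet> e m \<le> norm (e l) * norm (e m)" by (rule norm_cauchy_schwarz)
      also have "\<dots> \<le> 1" using e1 by (intro mult_le_one) auto
      finally show "e l \<bullet> e m \<le> 1" .
    qed auto
    also have "\<dots> = (\<Sum>l<N. \<Sum>u\<in>S. \<Sum>m<N. a l u * a m u)"
      by (simp only: mult_1, rule sum.cong[OF refl], rule sum.swap)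
    also have "\<dots> = (\<Sum>u\<in>S. \<Sum>l<N. \<Sum>m<N. a l u * a m u)" by (rule sum.swap)
    also have "\<dots> = (\<Sum>u\<in>S. (\<Sum>l<N. a l u)\<^sup>2)"
      by (simp only: power2_eq_square sum_product)
    finally show "L2_set g (S \<times> UNIV) \<le> sqrt (\<Sum>u\<in>S. (\<Sum>l<N. a l u)\<^sup>2)"
      unfolding L2_set_def by (rule real_sqrt_le_mono)
  qed simp
  finally show ?thesis by (simp add: h_def L2_set_def)
qed

primrec euler :: "('e::real_vector \<Rightarrow> 'e) \<Rightarrow> real \<Rightarrow> 'e \<Rightarrow> (nat \<Rightarrow> 'e) \<Rightarrow> nat \<Rightarrow> 'e" where
  "euler b h x N 0 = x"
| "euler b h x N (Suc k) = euler b h x N k + h *\<^sub>R b (euler b h x N k) + N k"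

text \<open>The squared factor that dissipativity gives is \<open>1 + 2 * B * h + L\<^sup>2 * h\<^sup>2\<close>; the factor here is
  the tangent bound for its square root.\<close>

lemma euler_step_contraction:
  fixes b :: "'e::real_inner \<Rightarrow> 'e"
  assumes lip: "\<And>z z'. norm (b z - b z') \<le> L * norm (z - z')"
    and diss: "\<And>z y. (z - y) \<bullet> (b z - b y) \<le> B * (norm (z - y))\<^sup>2"
    and h: "0 \<le> h" and rho: "0 \<le> 1 + B * h + L\<^sup>2 * h\<^sup>2 / 2"
  shows "norm ((y + h *\<^sub>R b y) - (z + h *\<^sub>R b z)) \<le> (1 + B * h + L\<^sup>2 * h\<^sup>2 / 2) * norm (y - z)"
proof -
  define d where "d = y - z"
  define D where "D = b y - b z"
  have D: "norm D \<le> L * norm d" "d \<bullet> D \<le> B * (norm d)\<^sup>2"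
    unfolding d_def D_def by (rule lip diss)+
  have "(norm D)\<^sup>2 \<le> (L * norm d)\<^sup>2" using D(1) by (intro power_mono) auto
  then have D2: "h\<^sup>2 * (norm D)\<^sup>2 \<le> h\<^sup>2 * (L\<^sup>2 * (norm d)\<^sup>2)"
    by (intro mult_left_mono) (auto simp: power_mult_distrib)
  have "(norm (d + h *\<^sub>R D))\<^sup>2 = (norm d)\<^sup>2 + 2 * (h * (d \<bullet> D)) + h\<^sup>2 * (norm D)\<^sup>2"
    unfolding power2_norm_eq_inner by (simp add: inner_add_left inner_add_right inner_commute power2_eq_square)
  also have "\<dots> \<le> (norm d)\<^sup>2 + 2 * (h * (B * (norm d)\<^sup>2)) + h\<^sup>2 * (L\<^sup>2 * (norm d)\<^sup>2)"
    using mult_left_mono[OF D(2) h] D2 by linarith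
  also have "\<dots> \<le> ((1 + B * h + L\<^sup>2 * h\<^sup>2 / 2) * norm d)\<^sup>2"
  proof -
    define c where "c = B * h + L\<^sup>2 * h\<^sup>2 / 2"
    have "(norm d)\<^sup>2 + 2 * (h * (B * (norm d)\<^sup>2)) + h\<^sup>2 * (L\<^sup>2 * (norm d)\<^sup>2) = (1 + 2 * c) * (norm d)\<^sup>2"
      unfolding c_def by (simp add: algebra_simps)
    also have "\<dots> \<le> (1 + c)\<^sup>2 * (norm d)\<^sup>2"
      by (intro mult_right_mono) (auto simp: power2_sum)
    finally show ?thesis unfolding power_mult_distrib c_def by (simp add: add.assoc)
  qed
  finally have "norm (d + h *\<^sub>R D) \<le> (1 + B * h + L\<^sup>2 * h\<^sup>2 / 2) * norm d"
    using rho by (intro power2_le_imp_le[of "norm (d + h *\<^sub>R D)"]) auto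
  moreover have "(y + h *\<^sub>R b y) - (z + h *\<^sub>R b z) = d + h *\<^sub>R D"
    by (simp add: d_def D_def algebra_simps)
  ultimately show ?thesis by (simp only: d_def[symmetric])
qed

lemma euler_stability:
  fixes b :: "'e::real_normed_vector \<Rightarrow> 'e"
  assumes step: "\<And>y z. norm ((y + h *\<^sub>R b y) - (z + h *\<^sub>R b z)) \<le> \<rho> * norm (y - z)"
    and rho: "0 \<le> \<rho>"
  shows "norm (euler b h x N k - euler b h x N' k) \<le> (\<Sum>l<k. \<rho> ^ (k - 1 - l) * norm (N l - N' l))"
proof (induction k)
  case 0
  show ?case by simp
next
  case (Suc k)
  let ?y = "euler b h x N k" and ?z = "euler b h x N' k"
  have "norm (euler b h x N (Suc k) - euler b h x N' (Suc k))
      = norm (((?y + h *\<^sub>R b ?y) - (?z + h *\<^sub>R b ?z)) + (N k - N' k))"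
    by (simp add: algebra_simps)
  also have "\<dots> \<le> norm ((?y + h *\<^sub>R b ?y) - (?z + h *\<^sub>R b ?z)) + norm (N k - N' k)"
    by (rule norm_triangle_ineq)
  also have "\<dots> \<le> \<rho> * norm (?y - ?z) + norm (N k - N' k)" using step by simp
  also have "\<dots> \<le> \<rho> * (\<Sum>l<k. \<rho> ^ (k - 1 - l) * norm (N l - N' l)) + norm (N k - N' k)"
    using Suc rho by (intro add_mono mult_left_mono) auto
  also have "\<rho> * (\<Sum>l<k. \<rho> ^ (k - 1 - l) * norm (N l - N' l)) = (\<Sum>l<k. \<rho> ^ (Suc k - 1 - l) * norm (N l - N' l))"
    unfolding sum_distrib_left
  proof (rule sum.cong[OF refl])
    fix l assume "l \<in> {..<k}"
    then have "Suc k - 1 - l = Suc (k - 1 - l)" by auto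
    then show "\<rho> * (\<rho> ^ (k - 1 - l) * norm (N l - N' l)) = \<rho> ^ (Suc k - 1 - l) * norm (N l - N' l)"
      by (simp only: power_Suc mult.assoc)
  qed
  finally show ?case by simp
qed

lemma euler_endpoint_stability:
  fixes b :: "'e::real_normed_vector \<Rightarrow> 'e"
  assumes step: "\<And>y z. norm ((y + h *\<^sub>R b y) - (z + h *\<^sub>R b z)) \<le> \<rho> * norm (y - z)"
    and rho: "0 \<le> \<rho>" "\<rho> \<le> 1" and k: "k \<le> n"
  shows "norm (euler b h x N k - euler b h x N' k) \<le> (\<Sum>l<n. norm (N l - N' l))"
proof -
  have "norm (euler b h x N k - euler b h x N' k) \<le> (\<Sum>l<k. \<rho> ^ (k - 1 - l) * norm (N l - N' l))"
    by (rule euler_stability[OF step rho(1)])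
  also have "\<dots> \<le> (\<Sum>l<k. norm (N l - N' l))"
    using rho by (intro sum_mono mult_left_le_one_le power_le_one) auto
  also have "\<dots> \<le> (\<Sum>l<n. norm (N l - N' l))"
    using k by (intro sum_mono2) auto
  finally show ?thesis .
qed

lemma euler_sum_stability:
  fixes b :: "'e::real_normed_vector \<Rightarrow> 'e"
  assumes step: "\<And>y z. norm ((y + h *\<^sub>R b y) - (z + h *\<^sub>R b z)) \<le> \<rho> * norm (y - z)"
    and rho: "0 \<le> \<rho>"
  shows "(\<Sum>k<n. norm (euler b h x N k - euler b h x N' k)) \<le> (\<Sum>i<n. \<rho> ^ i) * (\<Sum>l<n. norm (N l - N' l))"
proof -
  have "(\<Sum>k<n. norm (euler b h x N k - euler b h x N' k))
      \<le> (\<Sum>k<n. \<Sum>l<n. (if l < k then \<rho> ^ (k - 1 - l) else 0) * norm (N l - N' l))"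
  proof (rule sum_mono)
    fix k assume "k \<in> {..<n}"
    then have "(\<Sum>l<n. (if l < k then \<rho> ^ (k - 1 - l) else 0) * norm (N l - N' l))
        = (\<Sum>l<k. (if l < k then \<rho> ^ (k - 1 - l) else 0) * norm (N l - N' l))"
      by (intro sum.mono_neutral_right) auto
    also have "\<dots> = (\<Sum>l<k. \<rho> ^ (k - 1 - l) * norm (N l - N' l))"
      by (rule sum.cong) auto
    finally show "norm (euler b h x N k - euler b h x N' k)
        \<le> (\<Sum>l<n. (if l < k then \<rho> ^ (k - 1 - l) else 0) * norm (N l - N' l))"
      using euler_stability[OF step rho, of x N k N'] by simp
  qed
  also have "\<dots> = (\<Sum>l<n. \<Sum>k<n. (if l < k then \<rho> ^ (k - 1 - l) else 0) * norm (N l - N' l))"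
    by (rule sum.swap)
  also have "\<dots> \<le> (\<Sum>l<n. (\<Sum>i<n. \<rho> ^ i) * norm (N l - N' l))"
    unfolding sum_distrib_right[symmetric]
  proof (rule sum_mono, rule mult_right_mono)
    fix l
    have "(\<Sum>k<n. if l < k then \<rho> ^ (k - 1 - l) else 0) = (\<Sum>k\<in>{Suc l..<n}. if l < k then \<rho> ^ (k - 1 - l) else 0)"
      by (intro sum.mono_neutral_right) auto
    also have "\<dots> = (\<Sum>k\<in>{Suc l..<n}. \<rho> ^ (k - Suc l))" by (rule sum.cong) auto
    also have "\<dots> = (\<Sum>i\<in>(\<lambda>k. k - Suc l) ` {Suc l..<n}. \<rho> ^ i)"
      by (subst sum.reindex) (auto simp: inj_on_def)
    also have "\<dots> \<le> (\<Sum>i<n. \<rho> ^ i)"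
      using rho by (intro sum_mono2) auto
    finally show "(\<Sum>k<n. if l < k then \<rho> ^ (k - 1 - l) else 0) \<le> (\<Sum>i<n. \<rho> ^ i)" .
  qed simp
  finally show ?thesis by (simp add: sum_distrib_left)
qed

lemma euler_measurable:
  fixes b :: "real ^ 'd \<Rightarrow> real ^ 'd"
  assumes b[measurable]: "b \<in> borel_measurable borel" and k: "k \<le> n"
  shows "(\<lambda>N. euler b h x N k) \<in> borel_measurable (PiM {..<n} (\<lambda>_. borel))"
  using k
proof (induction k)
  case 0
  show ?case by simp
next
  case (Suc k)
  then have [measurable]: "(\<lambda>N. euler b h x N k) \<in> borel_measurable (PiM {..<n} (\<lambda>_. borel))" by simp
  have [measurable]: "(\<lambda>N. N k) \<in> borel_measurable (PiM {..<n} (\<lambda>_. borel :: (real ^ 'd) measure))"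
    using Suc.prems by (intro measurable_component_singleton) auto
  show ?case by simp
qed

section \<open>Riemann--Stieltjes sums as noise\<close>

lemma uniform_tagged_division:
  fixes d :: real
  assumes d: "0 < d" and N: "0 < N"
  shows "(\<lambda>l. (real l * d, {real l * d..real (l + 1) * d})) ` {..<N} tagged_division_of {0..real N * d}"
  using N
proof (induction N rule: nat_induct_non_zero)
  case 1
  have "{(0, {0..d})} tagged_division_of {0..d}" using d by (intro tagged_division_of_self_real) simp
  then show ?case by (simp add: lessThan_Suc)
next
  case (Suc N)
  let ?F = "\<lambda>l. (real l * d, {real l * d..real (l + 1) * d})"
  have le: "0 \<le> real N * d" "real N * d \<le> real (N + 1) * d" using d by auto
  have "{?F N} tagged_division_of {real N * d..real (N + 1) * d}"
    by (rule tagged_division_of_self_real) (use le in auto)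
  then have "?F ` {..<N} \<union> {?F N} tagged_division_of {0..real N * d} \<union> {real N * d..real (N + 1) * d}"
    by (rule tagged_division_Un[OF Suc.IH]) simp
  also have "?F ` {..<N} \<union> {?F N} = ?F ` {..<Suc N}" by (simp add: lessThan_Suc)
  also have "{0..real N * d} \<union> {real N * d..real (N + 1) * d} = {0..real (Suc N) * d}"
    using ivl_disj_un_two_touch(4)[OF le] by simp
  finally show ?case .
qed

lemma has_rs_integral_uniform:
  assumes rs: "has_rs_integral f g 0 t I" and t: "0 < t"
  shows "(\<lambda>N. \<Sum>l<N. f (real l * (t / N)) * (g (real (l + 1) * (t / N)) - g (real l * (t / N)))) \<longlonglongrightarrow> I"
proof (rule LIMSEQ_I)
  fix e :: real assume "0 < e"
  with rs obtain \<delta> where \<delta>: "0 < \<delta>"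
    "\<And>D. D tagged_division_of {0..t} \<Longrightarrow> (\<forall>(u, K)\<in>D. Sup K - Inf K < \<delta>) \<Longrightarrow>
      \<bar>(\<Sum>(u, K)\<in>D. f u * (g (Sup K) - g (Inf K))) - I\<bar> < e"
    unfolding has_rs_integral_def by meson
  obtain N0 :: nat where N0: "t / \<delta> < real N0" using reals_Archimedean2 by blast
  have "norm ((\<Sum>l<N. f (real l * (t / N)) * (g (real (l + 1) * (t / N)) - g (real l * (t / N)))) - I) < e"
    if N: "N0 \<le> N" for N
  proof -
    define d where "d = t / N"
    have "0 < t / \<delta>" using t \<delta>(1) by simp
    moreover have "t / \<delta> < real N" using N0 N by linarith
    ultimately have N: "0 < N" "t / \<delta> < real N" by (cases N; simp)+
    have d: "0 < d" "d < \<delta>" "real N * d = t" using t N \<delta>(1) by (auto simp: d_def field_simps)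
    let ?F = "\<lambda>l. (real l * d, {real l * d..real (l + 1) * d})"
    have step: "real (l + 1) * d = real l * d + d" for l by (simp add: algebra_simps)
    have "\<bar>(\<Sum>(u, K)\<in>?F ` {..<N}. f u * (g (Sup K) - g (Inf K))) - I\<bar> < e"
    proof (rule \<delta>(2))
      show "?F ` {..<N} tagged_division_of {0..t}"
        using uniform_tagged_division[OF d(1) N(1)] unfolding d(3) .
      show "\<forall>(u, K)\<in>?F ` {..<N}. Sup K - Inf K < \<delta>" using d unfolding step by auto
    qed
    moreover have "inj_on ?F {..<N}" using d by (auto simp: inj_on_def)
    ultimately show ?thesis using d unfolding d_def[symmetric] step by (simp add: sum.reindex)
  qed
  then show "\<exists>no. \<forall>N\<ge>no. norm ((\<Sum>l<N. f (real l * (t / N)) * (g (real (l + 1) * (t / N)) - g (real l * (t / N)))) - I) < e"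
    by blast
qed

text \<open>Yields the initial condition \<open>X 0 = x\<close> from the equation.\<close>

lemma has_rs_integral_singleton:
  assumes "has_rs_integral f g 0 0 I"
  shows "I = 0"
proof (rule ccontr)
  assume "I \<noteq> 0"
  then have "0 < \<bar>I\<bar>" by simp
  with assms obtain \<delta> where \<delta>: "0 < \<delta>"
    "\<And>D. D tagged_division_of {0..0::real} \<Longrightarrow> (\<forall>(u, K)\<in>D. Sup K - Inf K < \<delta>) \<Longrightarrow>
      \<bar>(\<Sum>(u, K)\<in>D. f u * (g (Sup K) - g (Inf K))) - I\<bar> < \<bar>I\<bar>"
    unfolding has_rs_integral_def by meson
  from \<delta>(1) have "\<forall>(u, K)\<in>{(0::real, {0..0::real})}. Sup K - Inf K < \<delta>" by simp
  moreover have "{(0, {0..0})} tagged_division_of {0..0::real}"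
    by (rule tagged_division_of_self_real) simp
  ultimately have "\<bar>(\<Sum>(u, K)\<in>{(0, {0..0})}. f u * (g (Sup K) - g (Inf K))) - I\<bar> < \<bar>I\<bar>"
    by (intro \<delta>(2))
  then show False by simp
qed

text \<open>The Riemann--Stieltjes sum of \<open>\<sigma>\<close> against \<open>w\<close> over the \<open>k\<close>-th interval of length \<open>h\<close>, cut into \<open>q\<close>
  pieces and tagged at the left ends.\<close>

definition rs_noise :: "(real \<Rightarrow> real ^ 'm ^ 'd) \<Rightarrow> (real \<Rightarrow> real ^ 'm) \<Rightarrow> real \<Rightarrow> nat \<Rightarrow> nat \<Rightarrow> real ^ 'd" where
  "rs_noise \<sigma> w h q k = (\<Sum>l\<in>{k * q..<k * q + q}.
     \<sigma> (real l * (h / q)) *v (w (real (l + 1) * (h / q)) - w (real l * (h / q))))"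

text \<open>\<open>G\<close> stands for the stochastic integral as a function of its upper limit. The equation provides it
  only as a limit for each upper limit separately, which suffices since \<open>n\<close> is fixed.\<close>

lemma rs_noise_tendsto:
  fixes \<sigma> :: "real \<Rightarrow> real ^ 'm ^ 'd"
  assumes h: "0 < h"
    and eq: "\<And>k i. k \<le> n \<Longrightarrow> \<exists>J. (\<forall>j. has_rs_integral (\<lambda>s. \<sigma> s $ i $ j) (\<lambda>s. w s $ j) 0 (real k * h) (J j))
       \<and> G (real k * h) $ i = (\<Sum>j\<in>UNIV. J j)"
    and k: "k < n"
  shows "(\<lambda>q. rs_noise \<sigma> w h (Suc q) k) \<longlonglongrightarrow> G (real (k + 1) * h) - G (real k * h)"
proof -
  define P where "P k q = (\<Sum>l<k * q. \<sigma> (real l * (h / q)) *v (w (real (l + 1) * (h / q)) - w (real l * (h / q))))" for k q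
  have P: "(\<lambda>q. P k (Suc q)) \<longlonglongrightarrow> G (real k * h)" if k: "k \<le> n" for k
  proof (rule vec_tendstoI)
    fix i
    obtain J where J: "\<And>j. has_rs_integral (\<lambda>s. \<sigma> s $ i $ j) (\<lambda>s. w s $ j) 0 (real k * h) (J j)"
      "G (real k * h) $ i = (\<Sum>j\<in>UNIV. J j)"
      using eq[OF k] by blast
    have "(\<lambda>q. \<Sum>l<k * Suc q. \<sigma> (real l * (h / Suc q)) $ i $ j *
       (w (real (l + 1) * (h / Suc q)) $ j - w (real l * (h / Suc q)) $ j)) \<longlonglongrightarrow> J j" for j
    proof (cases "k = 0")
      case True
      then have "J j = 0" using J(1)[of j] by (intro has_rs_integral_singleton) simp
      then show ?thesis using True by simp
    next
      case False
      then have "0 < real k * h" using h by simp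
      from has_rs_integral_uniform[OF J(1)[of j] this]
      have "((\<lambda>N. \<Sum>l<N. \<sigma> (real l * (real k * h / N)) $ i $ j *
         (w (real (l + 1) * (real k * h / N)) $ j - w (real l * (real k * h / N)) $ j))
         \<circ> (\<lambda>q. k * Suc q)) \<longlonglongrightarrow> J j"
        by (rule LIMSEQ_subseq_LIMSEQ) (use False in \<open>auto simp: strict_mono_def\<close>)
      moreover have "real k * h / real (k * Suc q) = h / Suc q" for q
      proof -
        have "real k * h / (real k * s) = h / s" for s using False by simp
        then show ?thesis by (simp only: of_nat_mult)
      qed
      ultimately show ?thesis by (simp only: comp_def)
    qed
    then have "(\<lambda>q. \<Sum>j\<in>UNIV. \<Sum>l<k * Suc q. \<sigma> (real l * (h / Suc q)) $ i $ j *
       (w (real (l + 1) * (h / Suc q)) $ j - w (real l * (h / Suc q)) $ j)) \<longlonglongrightarrow> (\<Sum>j\<in>UNIV. J j)"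
      by (intro tendsto_sum)
    moreover have "P k (Suc q) $ i = (\<Sum>j\<in>UNIV. \<Sum>l<k * Suc q. \<sigma> (real l * (h / Suc q)) $ i $ j *
       (w (real (l + 1) * (h / Suc q)) $ j - w (real l * (h / Suc q)) $ j))" for q
      unfolding P_def sum_component matrix_vector_mul_component inner_vec_def
        vector_minus_component inner_real_def by (rule sum.swap)
    ultimately show "(\<lambda>q. P k (Suc q) $ i) \<longlonglongrightarrow> G (real k * h) $ i" using J(2) by simp
  qed
  have "rs_noise \<sigma> w h q k = P (k + 1) q - P k q" for q
  proof -
    have "{..<(k + 1) * q} = {..<k * q} \<union> {k * q..<k * q + q}" by auto
    then show ?thesis unfolding rs_noise_def P_def
      by (simp add: sum.union_disjoint ivl_disj_int)
  qed
  then show ?thesis using P[of "k + 1"] P[of k] k by (auto intro: tendsto_diff)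
qed

lemma norm_matrix_vector_mult_le:
  fixes A :: "real ^ 'm ^ 'd"
  shows "norm (A *v w) \<le> norm A * norm w"
proof -
  have "norm (A *v w) \<le> L2_set (\<lambda>i. norm (A $ i) * norm w) UNIV"
    unfolding norm_vec_def[of "A *v w"]
    by (intro L2_set_mono) (auto simp: matrix_vector_mul_component Cauchy_Schwarz_ineq2)
  also have "\<dots> = norm A * norm w"
    by (simp add: L2_set_left_distrib norm_vec_def)
  finally show ?thesis .
qed

lemma rs_noise_path_measurable:
  fixes \<sigma> :: "real \<Rightarrow> real ^ 'm ^ 'd"
  assumes w: "\<And>l j. l \<le> k * q + q \<Longrightarrow> (\<lambda>\<omega>. w \<omega> (real l * (h / q)) $ j) \<in> borel_measurable L"
  shows "(\<lambda>\<omega>. rs_noise \<sigma> (w \<omega>) h q k) \<in> borel_measurable L"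
proof (rule borel_measurable_vecI)
  fix i
  show "(\<lambda>\<omega>. rs_noise \<sigma> (w \<omega>) h q k $ i) \<in> borel_measurable L"
    unfolding rs_noise_def sum_component matrix_vector_mul_component inner_vec_def
      vector_minus_component inner_real_def
    by (intro borel_measurable_sum borel_measurable_times borel_measurable_const borel_measurable_diff w) auto
qed

lemma rs_noise_total_variation:
  fixes \<sigma> :: "real \<Rightarrow> real ^ 'm ^ 'd"
  assumes S: "\<And>l. l < n * q \<Longrightarrow> norm (\<sigma> (real l * (h / q))) \<le> S"
  shows "(\<Sum>k<n. norm (rs_noise \<sigma> w h q k - rs_noise \<sigma> w' h q k))
    \<le> S * (\<Sum>l<n * q. norm ((w (real (l + 1) * (h / q)) - w' (real (l + 1) * (h / q)))
        - (w (real l * (h / q)) - w' (real l * (h / q)))))"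
proof -
  let ?s = "\<lambda>l::nat. real l * (h / q)"
  let ?D = "\<lambda>l. (w (?s (l + 1)) - w' (?s (l + 1))) - (w (?s l) - w' (?s l))"
  have swap: "(c - d) - (e - f) = (c - e) - (d - f)" for c d e f :: "'v::ab_group_add"
    by (simp add: algebra_simps)
  have "norm (rs_noise \<sigma> w h q k - rs_noise \<sigma> w' h q k) \<le> (\<Sum>l\<in>{k * q..<k * q + q}. S * norm (?D l))"
    if k: "k < n" for k
  proof -
    have diff: "rs_noise \<sigma> w h q k - rs_noise \<sigma> w' h q k = (\<Sum>l\<in>{k * q..<k * q + q}. \<sigma> (?s l) *v ?D l)"
      unfolding rs_noise_def sum_subtractf[symmetric]
      by (rule sum.cong[OF refl]) (unfold matrix_vector_mult_diff_distrib, rule swap)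
    have "norm (rs_noise \<sigma> w h q k - rs_noise \<sigma> w' h q k)
        \<le> (\<Sum>l\<in>{k * q..<k * q + q}. norm (\<sigma> (?s l) *v ?D l))"
      unfolding diff by (rule norm_sum)
    also have "\<dots> \<le> (\<Sum>l\<in>{k * q..<k * q + q}. S * norm (?D l))"
    proof (rule sum_mono)
      fix l assume l: "l \<in> {k * q..<k * q + q}"
      have "(k + 1) * q \<le> n * q"
        by (rule mult_le_mono1) (use k in linarith)
      moreover have "l < (k + 1) * q" using l by simp
      ultimately have "l < n * q" by (rule less_le_trans[rotated])
      have "norm (\<sigma> (?s l) *v ?D l) \<le> norm (\<sigma> (?s l)) * norm (?D l)"
        by (rule norm_matrix_vector_mult_le)
      also have "\<dots> \<le> S * norm (?D l)" using S[OF \<open>l < n * q\<close>] by (rule mult_right_mono) simp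
      finally show "norm (\<sigma> (?s l) *v ?D l) \<le> S * norm (?D l)" .
    qed
    finally show ?thesis .
  qed
  then have "(\<Sum>k<n. norm (rs_noise \<sigma> w h q k - rs_noise \<sigma> w' h q k))
     \<le> (\<Sum>k<n. \<Sum>l\<in>{k * q..<k * q + q}. S * norm (?D l))"
    by (intro sum_mono) simp
  also have "\<dots> = (\<Sum>l<n * q. S * norm (?D l))" by (rule sum.nat_group)
  finally show ?thesis by (simp only: sum_distrib_left)
qed

text \<open>The concentration inequality in the coordinates of \<open>fbm_law\<close>. A shift of the standard vector
  changes the noise by a total of at most \<open>S\<close> times the variation of the shifted path, and this variation
  is bounded by \<open>gram_total_variation\<close>; the sum of all covariances of increments telescopes to the
  variance \<open>(real n * h) powr (2 * H)\<close>.\<close>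

lemma (in prob_space) rs_noise_functional_subgaussian:
  fixes W :: "real \<Rightarrow> 'a \<Rightarrow> real ^ 'm" and \<sigma> :: "real \<Rightarrow> real ^ 'm ^ 'd"
    and \<Phi> :: "(nat \<Rightarrow> real ^ 'd) \<Rightarrow> real"
  assumes fbm: "fractional_brownian_motion M H {0..T} W"
    and H: "1 / 2 \<le> H" and h: "0 < h" and nh: "real n * h \<le> T" and q: "0 < q"
    and S: "\<And>s. s \<in> {0..T} \<Longrightarrow> norm (\<sigma> s) \<le> S" and S0: "0 \<le> S"
    and \<Phi>m: "\<Phi> \<in> borel_measurable (PiM {..<n} (\<lambda>_. borel))"
    and \<Phi>: "\<And>N N'. \<bar>\<Phi> N - \<Phi> N'\<bar> \<le> \<kappa> * (\<Sum>l<n. norm (N l - N' l))" and \<kappa>: "0 \<le> \<kappa>"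
  shows "\<exists>a. subgaussian M (\<lambda>\<omega>. \<Phi> (rs_noise \<sigma> (\<lambda>s. W s \<omega>) h q)) a (\<kappa> * S * (real n * h) powr H)"
proof -
  define s where "s l = real l * (h / q)" for l :: nat
  define I where "I = s ` {..n * q}"
  have sI: "s l \<in> I" if "l \<le> n * q" for l using that by (simp add: I_def)
  have s0: "0 \<le> s l" for l using h q by (simp add: s_def)
  have sL: "s (n * q) = real n * h" using q by (simp add: s_def)
  have smono: "s l \<le> s m" if "l \<le> m" for l m
    using that h q by (auto simp: s_def intro!: divide_right_mono mult_right_mono)
  have sT: "s l \<in> {0..T}" if "l \<le> n * q" for l
    using smono[OF that] s0[of l] sL nh by simp
  have fin: "finite I" and IT: "I \<subseteq> {0..T}" using sT by (auto simp: I_def)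
  have sadd: "s (l + 1) = s l + h / q" for l by (simp add: s_def distrib_right add_divide_distrib)
  obtain A where A: "\<And>s t. s \<in> I \<Longrightarrow> t \<in> I \<Longrightarrow> fbm_cov H s t = (\<Sum>u\<in>I. A s u * A t u)"
    using fbm_cov_gram[OF fbm fin IT] by blast
  let ?J = "I \<times> (UNIV :: 'm set)"
  let ?P = "PiM ?J (\<lambda>_. borel :: real measure)"
  let ?w = "\<lambda>\<omega>. \<lambda>p\<in>?J. W (fst p) \<omega> $ snd p"
  define path where "path p = (\<lambda>t. (\<chi> j. p (t, j)) :: real ^ 'm)" for p :: "real \<times> 'm \<Rightarrow> real"
  define \<Psi> where "\<Psi> p = \<Phi> (\<lambda>k\<in>{..<n}. rs_noise \<sigma> (path p) h q k)" for p
  \<comment> \<open>the values of the motion in terms of the standard vector\<close>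
  define C where "C x = (\<lambda>p\<in>?J. \<Sum>u\<in>I. A (fst p) u * x (u, snd p))" for x :: "real \<times> 'm \<Rightarrow> real"
  have block: "l \<le> n * q" if "l \<le> k * q + q" "k < n" for l k
  proof -
    have "(k + 1) * q \<le> n * q" using that by (intro mult_le_mono1) simp
    with that show ?thesis by simp
  qed
  have \<Phi>_cong: "\<Phi> N = \<Phi> N'" if "\<And>l. l < n \<Longrightarrow> N l = N' l" for N N'
    using \<Phi>[of N N'] that by simp
  have \<Psi>m[measurable]: "\<Psi> \<in> borel_measurable ?P"
  proof -
    have "(\<lambda>p. \<lambda>k\<in>{..<n}. rs_noise \<sigma> (path p) h q k) \<in> measurable ?P (PiM {..<n} (\<lambda>_. borel))"
    proof (rule measurable_restrict)
      fix k assume "k \<in> {..<n}"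
      then show "(\<lambda>p. rs_noise \<sigma> (path p) h q k) \<in> borel_measurable ?P"
        using block sI unfolding path_def s_def
        by (intro rs_noise_path_measurable) (auto intro!: measurable_component_singleton)
    qed
    then show ?thesis unfolding \<Psi>_def by (rule measurable_compose[OF _ \<Phi>m])
  qed
  have Cm[measurable]: "C \<in> measurable (std_gauss ?J) ?P"
    unfolding C_def
  proof (rule measurable_restrict)
    fix p assume "p \<in> ?J"
    have "(\<lambda>x. x (u, snd p)) \<in> borel_measurable (std_gauss ?J)" if "u \<in> I" for u
      using measurable_component_singleton[of "(u, snd p)" ?J "\<lambda>_. std_normal_distribution"] that
      by (simp cong: measurable_cong_sets)
    then show "(\<lambda>x. \<Sum>u\<in>I. A (fst p) u * x (u, snd p)) \<in> borel_measurable (std_gauss ?J)"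
      by (intro borel_measurable_sum borel_measurable_times) auto
  qed
  have Wm[measurable]: "?w \<in> measurable M ?P"
    using IT by (intro measurable_restrict fbm_nth_measurable[OF fbm]) auto
  have Y: "\<Phi> (rs_noise \<sigma> (\<lambda>s. W s \<omega>) h q) = \<Psi> (?w \<omega>)" for \<omega>
    unfolding \<Psi>_def
  proof (rule \<Phi>_cong)
    fix k assume k: "k < n"
    have "path (?w \<omega>) (s l) = W (s l) \<omega>" if "l \<le> k * q + q" for l
      using sI[OF block[OF that k]] by (simp add: path_def vec_eq_iff)
    then show "rs_noise \<sigma> (\<lambda>s. W s \<omega>) h q k = (\<lambda>k\<in>{..<n}. rs_noise \<sigma> (path (?w \<omega>)) h q k) k"
      using k unfolding rs_noise_def s_def by (auto intro!: sum.cong simp del: of_nat_Suc of_nat_add times_divide_eq_right)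
  qed
  have law: "distr M ?P ?w = distr (std_gauss ?J) ?P C"
    unfolding C_def by (rule fbm_law[OF fbm fin IT A])
  define L where "L = \<kappa> * S * (real n * h) powr H"
  have L0: "0 \<le> L" using \<kappa> S0 by (simp add: L_def)
  have lip: "\<bar>\<Psi> (C x) - \<Psi> (C y)\<bar> \<le> L * sqrt (\<Sum>p\<in>?J. (x p - y p)\<^sup>2)" for x y
  proof -
    define a where "a l u = A (s (l + 1)) u - A (s l) u" for l u
    define d where "d p = x p - y p" for p
    let ?H = "\<Sum>l<n * q. norm (\<chi> j. \<Sum>u\<in>I. a l u * d (u, j))"
    let ?N = "\<lambda>x. rs_noise \<sigma> (path (C x)) h q"
    let ?TV = "\<Sum>k<n. norm (?N x k - ?N y k)"
    have diff: "(path (C x) (s (l + 1)) - path (C y) (s (l + 1))) - (path (C x) (s l) - path (C y) (s l))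
        = (\<chi> j. \<Sum>u\<in>I. a l u * d (u, j))" if "l < n * q" for l
      using sI[of l] sI[of "l + 1"] that
      by (simp add: path_def C_def vec_eq_iff a_def d_def algebra_simps sum.distrib sum_subtractf)
    have gram: "(\<Sum>u\<in>I. a l u * a m u) = fbm_cov H (s (l + 1)) (s (m + 1)) - fbm_cov H (s (l + 1)) (s m)
        - fbm_cov H (s l) (s (m + 1)) + fbm_cov H (s l) (s m)" if "l < n * q" "m < n * q" for l m
      using that by (simp add: A sI a_def algebra_simps sum.distrib sum_subtractf)
    have "(\<Sum>l<n * q. a l u) = A (s (n * q)) u - A (s 0) u" for u
      using sum_lessThan_telescope[of "\<lambda>l. A (s l) u" "n * q"] by (simp add: a_def)
    then have "(\<Sum>u\<in>I. (\<Sum>l<n * q. a l u)\<^sup>2) = (\<Sum>u\<in>I. (A (s (n * q)) u - A (s 0) u)\<^sup>2)"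
      by simp
    also have "\<dots> = fbm_cov H (s (n * q)) (s (n * q)) - 2 * fbm_cov H (s (n * q)) (s 0) + fbm_cov H (s 0) (s 0)"
      by (simp add: A sI power2_eq_square algebra_simps sum.distrib sum_subtractf sum_distrib_left)
    also have "\<dots> = (real n * h) powr (2 * H)"
      using h by (simp add: sL fbm_cov_def) (simp add: s_def)
    also have "\<dots> = ((real n * h) powr H)\<^sup>2"
      by (simp add: power2_eq_square powr_add[symmetric])
    finally have tot: "sqrt (\<Sum>u\<in>I. (\<Sum>l<n * q. a l u)\<^sup>2) = (real n * h) powr H" by simp
    have "\<bar>\<Psi> (C x) - \<Psi> (C y)\<bar> \<le> \<kappa> * ?TV"
      using \<Phi>[of "restrict (?N x) {..<n}" "restrict (?N y) {..<n}"]
      unfolding \<Psi>_def by simp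
    also have "\<dots> \<le> \<kappa> * (S * ?H)"
    proof (rule mult_left_mono[OF _ \<kappa>])
      have "norm (\<sigma> (real l * (h / q))) \<le> S" if "l < n * q" for l
        using S[OF sT[of l]] that by (simp add: s_def)
      from rs_noise_total_variation[of n q \<sigma> h S "path (C x)" "path (C y)", OF this]
      have "?TV
        \<le> S * (\<Sum>l<n * q. norm ((path (C x) (s (l + 1)) - path (C y) (s (l + 1))) - (path (C x) (s l) - path (C y) (s l))))"
        unfolding s_def .
      moreover have "(\<Sum>l<n * q. norm ((path (C x) (s (l + 1)) - path (C y) (s (l + 1))) - (path (C x) (s l) - path (C y) (s l))))
        = ?H"
        by (rule sum.cong[OF refl], rule arg_cong[where f=norm], rule diff) simp
      ultimately show "?TV
        \<le> S * ?H"
        by simp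
    qed
    also have "\<dots> \<le> \<kappa> * (S * ((real n * h) powr H * sqrt (\<Sum>p\<in>?J. (d p)\<^sup>2)))"
    proof (intro mult_left_mono \<kappa> S0)
      have "0 \<le> (\<Sum>u\<in>I. a l u * a m u)" if "l < n * q" "m < n * q" for l m
        unfolding gram[OF that] sadd using H h q by (intro fbm_increments_positively_correlated) auto
      from gram_total_variation[where a=a and N="n * q" and d=d, OF fin this]
      show "?H \<le> (real n * h) powr H * sqrt (\<Sum>p\<in>?J. (d p)\<^sup>2)"
        unfolding tot .
    qed
    finally show ?thesis by (simp add: L_def d_def mult.assoc)
  qed
  define a where "a = (\<integral>x. \<Psi> (C x) \<partial>std_gauss ?J)"
  have "subgaussian M (\<lambda>\<omega>. \<Phi> (rs_noise \<sigma> (\<lambda>s. W s \<omega>) h q)) a L"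
    unfolding subgaussian_def Y
  proof (intro conjI allI)
    show "(\<lambda>\<omega>. \<Psi> (?w \<omega>)) \<in> borel_measurable M"
      by (rule measurable_compose[OF Wm \<Psi>m])
    fix \<theta>
    have [measurable]: "(\<lambda>p. ennreal (exp (\<theta> * (\<Psi> p - a)))) \<in> borel_measurable ?P"
      using \<Psi>m by measurable
    have "(\<integral>\<^sup>+\<omega>. ennreal (exp (\<theta> * (\<Psi> (?w \<omega>) - a))) \<partial>M)
      = (\<integral>\<^sup>+p. ennreal (exp (\<theta> * (\<Psi> p - a))) \<partial>distr M ?P ?w)"
      by (subst nn_integral_distr[OF Wm]) simp_all
    also have "\<dots> = (\<integral>\<^sup>+x. ennreal (exp (\<theta> * (\<Psi> (C x) - a))) \<partial>std_gauss ?J)"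
      unfolding law by (subst nn_integral_distr[OF Cm]) simp_all
    also have "\<dots> \<le> ennreal (exp (\<theta>\<^sup>2 * L\<^sup>2 / 2))"
      unfolding a_def
    proof (rule std_gauss_concentration)
      show "finite ?J" using fin by simp
      show "(\<lambda>x. \<Psi> (C x)) \<in> borel_measurable (std_gauss ?J)"
        by (rule measurable_compose[OF Cm \<Psi>m])
    qed (use L0 lip in auto)
    finally show "(\<integral>\<^sup>+\<omega>. ennreal (exp (\<theta> * (\<Psi> (?w \<omega>) - a))) \<partial>M) \<le> \<dots>" .
  qed
  then show ?thesis unfolding L_def by blast
qed

text \<open>The bound does not depend on the fineness \<open>q\<close> of the Riemann--Stieltjes sums, so it passes to
  their limit.\<close>

lemma (in prob_space) noise_functional_subgaussian:
  fixes W :: "real \<Rightarrow> 'a \<Rightarrow> real ^ 'm" and \<sigma> :: "real \<Rightarrow> real ^ 'm ^ 'd"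
    and \<Phi> :: "(nat \<Rightarrow> real ^ 'd) \<Rightarrow> real" and N :: "nat \<Rightarrow> 'a \<Rightarrow> real ^ 'd"
  assumes fbm: "fractional_brownian_motion M H {0..T} W"
    and H: "1 / 2 \<le> H" and h: "0 < h" and nh: "real n * h \<le> T"
    and S: "\<And>s. s \<in> {0..T} \<Longrightarrow> norm (\<sigma> s) \<le> S" and S0: "0 \<le> S"
    and \<Phi>m: "\<Phi> \<in> borel_measurable (PiM {..<n} (\<lambda>_. borel))"
    and \<Phi>: "\<And>N N'. \<bar>\<Phi> N - \<Phi> N'\<bar> \<le> \<kappa> * (\<Sum>l<n. norm (N l - N' l))" and \<kappa>: "0 \<le> \<kappa>"
    and N: "\<And>k. k < n \<Longrightarrow> N k \<in> borel_measurable M"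
    and lim: "AE \<omega> in M. \<forall>k<n. (\<lambda>q. rs_noise \<sigma> (\<lambda>s. W s \<omega>) h (Suc q) k) \<longlonglongrightarrow> N k \<omega>"
  shows "\<exists>a. subgaussian M (\<lambda>\<omega>. \<Phi> (\<lambda>k. N k \<omega>)) a (\<kappa> * S * (real n * h) powr H)"
proof -
  let ?Y = "\<lambda>q \<omega>. \<Phi> (rs_noise \<sigma> (\<lambda>s. W s \<omega>) h (Suc q))"
  have "\<exists>a. subgaussian M (?Y q) a (\<kappa> * S * (real n * h) powr H)" for q
    using H h nh S S0 \<Phi>m \<Phi> \<kappa> by (intro rs_noise_functional_subgaussian[OF fbm]) auto
  then obtain a where a: "\<And>q. subgaussian M (?Y q) (a q) (\<kappa> * S * (real n * h) powr H)" by metis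
  have cong: "\<Phi> (\<lambda>k. N k \<omega>) = \<Phi> (\<lambda>k\<in>{..<n}. N k \<omega>)" for \<omega>
    using \<Phi>[of "\<lambda>k. N k \<omega>" "\<lambda>k\<in>{..<n}. N k \<omega>"] by simp
  have "(\<lambda>\<omega>. \<lambda>k\<in>{..<n}. N k \<omega>) \<in> measurable M (PiM {..<n} (\<lambda>_. borel))"
    using N by (intro measurable_restrict) auto
  then have m: "(\<lambda>\<omega>. \<Phi> (\<lambda>k. N k \<omega>)) \<in> borel_measurable M"
    unfolding cong by (rule measurable_compose[OF _ \<Phi>m])
  have "AE \<omega> in M. (\<lambda>q. ?Y q \<omega>) \<longlonglongrightarrow> \<Phi> (\<lambda>k. N k \<omega>)"
    using lim
  proof eventually_elim
    case (elim \<omega>)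
    let ?R = "\<lambda>q. rs_noise \<sigma> (\<lambda>s. W s \<omega>) h (Suc q)"
    have "(\<lambda>q. \<kappa> * (\<Sum>k<n. norm (?R q k - N k \<omega>))) \<longlonglongrightarrow> \<kappa> * (\<Sum>k<n. norm (N k \<omega> - N k \<omega>))"
      using elim by (intro tendsto_intros) auto
    then have "(\<lambda>q. \<kappa> * (\<Sum>k<n. norm (?R q k - N k \<omega>))) \<longlonglongrightarrow> 0" by simp
    then have "(\<lambda>q. \<Phi> (?R q) - \<Phi> (\<lambda>k. N k \<omega>)) \<longlonglongrightarrow> 0"
      by (rule Lim_null_comparison[rotated]) (use \<Phi> in auto)
    then show ?case by (simp add: LIM_zero_iff)
  qed
  from subgaussian_limit(1)[OF a _ m this] show ?thesis
    using \<kappa> S0 by auto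
qed

section \<open>Riemann sums and the error of the Euler scheme\<close>

lemma holder_on_continuous:
  fixes f :: "real \<Rightarrow> 'e::real_normed_vector"
  assumes hol: "holder_on \<gamma> S f" and \<gamma>: "0 < \<gamma>"
  shows "continuous_on S f"
  unfolding continuous_on_iff
proof (intro ballI allI impI)
  fix t and e :: real assume t: "t \<in> S" and e: "0 < e"
  obtain C where C: "\<And>s t. s \<in> S \<Longrightarrow> t \<in> S \<Longrightarrow> norm (f s - f t) \<le> C * \<bar>s - t\<bar> powr \<gamma>"
    using hol unfolding holder_on_def by blast
  define K where "K = \<bar>C\<bar> + 1"
  have K: "0 < K" by (simp add: K_def)
  define \<delta> where "\<delta> = (e / K) powr (1 / \<gamma>)"
  have \<delta>: "0 < \<delta>" using e K by (simp add: \<delta>_def)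
  have "dist (f s) (f t) < e" if s: "s \<in> S" "dist s t < \<delta>" for s
  proof -
    have "\<bar>s - t\<bar> powr \<gamma> < \<delta> powr \<gamma>"
      using s \<gamma> by (intro powr_less_mono2) (auto simp: dist_real_def)
    also have "\<delta> powr \<gamma> = e / K" using \<gamma> e K by (simp add: \<delta>_def powr_powr)
    finally have "K * \<bar>s - t\<bar> powr \<gamma> < e" using K by (simp add: field_simps)
    moreover have "C * \<bar>s - t\<bar> powr \<gamma> \<le> K * \<bar>s - t\<bar> powr \<gamma>"
      by (rule mult_right_mono) (simp_all add: K_def)
    with C[OF s(1) t] have "norm (f s - f t) \<le> K * \<bar>s - t\<bar> powr \<gamma>" by linarith
    ultimately show ?thesis by (simp add: dist_norm)
  qed
  with \<delta> show "\<exists>d>0. \<forall>s\<in>S. dist s t < d \<longrightarrow> dist (f s) (f t) < e" by blast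
qed

lemma riemann_step:
  fixes g :: "real \<Rightarrow> 'e::euclidean_space"
  assumes cont: "continuous_on {a..c} g" and ac: "a \<le> c"
    and e: "\<And>s. s \<in> {a..c} \<Longrightarrow> norm (g s - g a) \<le> e"
  shows "norm (integral {a..c} g - (c - a) *\<^sub>R g a) \<le> e * (c - a)"
proof -
  have "integral {a..c} g - (c - a) *\<^sub>R g a = integral {a..c} g - integral {a..c} (\<lambda>_. g a)"
    using ac by simp
  also have "\<dots> = integral {a..c} (\<lambda>s. g s - g a)"
    using cont by (intro Henstock_Kurzweil_Integration.integral_diff[symmetric] integrable_continuous_interval) auto
  also have "norm \<dots> \<le> e * (c - a)"
    using cont ac e by (intro integral_bound) (auto intro: continuous_intros)
  finally show ?thesis .
qed

lemma integral_split_uniform: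
  fixes g :: "real \<Rightarrow> 'e::euclidean_space"
  assumes "continuous_on {0..real n * h} g" and h: "0 \<le> h"
  shows "integral {0..real n * h} g = (\<Sum>k<n. integral {real k * h..real (k + 1) * h} g)"
  using assms(1)
proof (induction n)
  case 0
  show ?case by simp
next
  case (Suc n)
  have le: "0 \<le> real n * h" "real n * h \<le> real (n + 1) * h" using h by (auto intro: mult_right_mono)
  have c: "continuous_on {0..real n * h} g"
    by (rule continuous_on_subset[OF Suc.prems]) (use le in auto)
  have "integral {0..real n * h} g + integral {real n * h..real (n + 1) * h} g = integral {0..real (n + 1) * h} g"
    using le Suc.prems by (intro Henstock_Kurzweil_Integration.integral_combine integrable_continuous_interval) auto
  then show ?case using Suc.IH[OF c] by simp
qed

lemma riemann_sums_tendsto: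
  fixes g :: "real \<Rightarrow> real"
  assumes cont: "continuous_on {0..T} g" and T: "0 < T"
  shows "(\<lambda>n. (\<Sum>k<Suc n. g (real k * (T / Suc n))) / Suc n) \<longlonglongrightarrow> 1 / T * integral {0..T} g"
proof (rule LIMSEQ_I)
  fix e :: real assume e: "0 < e"
  have "uniformly_continuous_on {0..T} g" using cont by (intro compact_uniformly_continuous) auto
  moreover have "0 < e / 2" using e by simp
  ultimately obtain d where d: "0 < d"
    "\<And>s t. s \<in> {0..T} \<Longrightarrow> t \<in> {0..T} \<Longrightarrow> dist s t < d \<Longrightarrow> dist (g s) (g t) < e / 2"
    unfolding uniformly_continuous_on_def by metis
  obtain n0 :: nat where n0: "T / d < real n0" using reals_Archimedean2 by blast
  show "\<exists>no. \<forall>n\<ge>no. norm ((\<Sum>k<Suc n. g (real k * (T / Suc n))) / Suc n - 1 / T * integral {0..T} g) < e"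
  proof (intro exI allI impI)
    fix n assume n: "n0 \<le> n"
    define h where "h = T / Suc n"
    have h: "0 < h" "real (Suc n) * h = T" using T by (auto simp: h_def)
    have "T / d < real (Suc n)" using n0 n by simp
    then have hd: "h < d" using d(1) by (simp add: h_def field_simps)
    have step: "norm (integral {real k * h..real (k + 1) * h} g - h * g (real k * h)) \<le> e / 2 * h"
      if k: "k < Suc n" for k
    proof -
      have "real (k + 1) * h \<le> real (Suc n) * h" using k h by (intro mult_right_mono) auto
      then have sub: "{real k * h..real (k + 1) * h} \<subseteq> {0..T}" using h by auto
      have len: "real (k + 1) * h - real k * h = h" by (simp add: algebra_simps)
      have "norm (integral {real k * h..real (k + 1) * h} g - (real (k + 1) * h - real k * h) *\<^sub>R g (real k * h))
        \<le> e / 2 * (real (k + 1) * h - real k * h)"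
      proof (rule riemann_step)
        show "continuous_on {real k * h..real (k + 1) * h} g" using cont sub by (rule continuous_on_subset)
        show "real k * h \<le> real (k + 1) * h" using h by (intro mult_right_mono) auto
        fix s assume s: "s \<in> {real k * h..real (k + 1) * h}"
        then have "dist s (real k * h) < d" using hd len by (auto simp: dist_real_def)
        moreover have "real k * h \<in> {0..T}" using sub len h by auto
        ultimately have "dist (g s) (g (real k * h)) < e / 2" using d(2) s sub by blast
        then show "norm (g s - g (real k * h)) \<le> e / 2" by (simp add: dist_norm)
      qed
      then show ?thesis unfolding len by simp
    qed
    have "integral {0..T} g = (\<Sum>k<Suc n. integral {real k * h..real (k + 1) * h} g)"
      using integral_split_uniform[of "Suc n" h g] cont h by simp
    then have "norm (integral {0..T} g - h * (\<Sum>k<Suc n. g (real k * h)))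
      = norm (\<Sum>k<Suc n. integral {real k * h..real (k + 1) * h} g - h * g (real k * h))"
      by (simp only: sum_subtractf sum_distrib_left)
    also have "\<dots> \<le> (\<Sum>k<Suc n. e / 2 * h)"
      using step by (intro sum_norm_le) simp
    also have "\<dots> = e / 2 * (real (Suc n) * h)" by simp
    also have "\<dots> = e / 2 * T" by (simp only: h(2))
    finally have I: "norm (integral {0..T} g - h * (\<Sum>k<Suc n. g (real k * h))) \<le> e / 2 * T" .
    have "(\<Sum>k<Suc n. g (real k * h)) / Suc n - 1 / T * integral {0..T} g
      = - (integral {0..T} g - h * (\<Sum>k<Suc n. g (real k * h))) / T"
    proof -
      have "(\<Sum>k<Suc n. g (real k * h)) / Suc n = h * (\<Sum>k<Suc n. g (real k * h)) / T"
        using T by (simp add: h_def)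
      then show ?thesis by (simp add: diff_divide_distrib)
    qed
    then have "norm ((\<Sum>k<Suc n. g (real k * h)) / Suc n - 1 / T * integral {0..T} g)
      = norm (integral {0..T} g - h * (\<Sum>k<Suc n. g (real k * h))) / T"
      using T by simp
    also have "\<dots> \<le> e / 2" using I T by (simp add: field_simps)
    also have "\<dots> < e" using e by simp
    finally show "norm ((\<Sum>k<Suc n. g (real k * (T / Suc n))) / Suc n - 1 / T * integral {0..T} g) < e"
      unfolding h_def .
  qed
qed

text \<open>The exact solution is itself an Euler scheme, for the noise \<open>N k + err k\<close>; stability turns the sum
  of the corrections into an error bound.\<close>

lemma euler_error:
  fixes b :: "'e::euclidean_space \<Rightarrow> 'e" and X :: "real \<Rightarrow> 'e"
  assumes step: "\<And>y z. norm ((y + h *\<^sub>R b y) - (z + h *\<^sub>R b z)) \<le> \<rho> * norm (y - z)"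
    and rho: "0 \<le> \<rho>" "\<rho> \<le> 1" and h: "0 \<le> h"
    and cont: "continuous_on {0..real n * h} (\<lambda>s. b (X s))"
    and e: "\<And>s t. s \<in> {0..real n * h} \<Longrightarrow> t \<in> {0..real n * h} \<Longrightarrow> \<bar>s - t\<bar> \<le> h \<Longrightarrow> norm (b (X s) - b (X t)) \<le> e"
    and X0: "X 0 = x"
    and G: "\<And>t. G t = X t - x - integral {0..t} (\<lambda>s. b (X s))"
    and N: "\<And>k. k < n \<Longrightarrow> N k = G (real (k + 1) * h) - G (real k * h)"
    and k: "k \<le> n"
  shows "norm (euler b h x N k - X (real k * h)) \<le> real n * h * e"
proof -
  let ?g = "\<lambda>s. b (X s)"
  \<comment> \<open>the correction that makes the scheme exact\<close>
  define err where "err k = integral {real k * h..real (k + 1) * h} ?g - h *\<^sub>R ?g (real k * h)" for k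
  have sub: "{real k * h..real (k + 1) * h} \<subseteq> {0..real n * h}" if "k < n" for k
    using that h mult_right_mono[of "real (k + 1)" "real n" h] by auto
  have len: "real (k + 1) * h - real k * h = h" for k by (simp add: algebra_simps)
  have le: "real k * h \<le> real (k + 1) * h" for k using len[of k] h by linarith
  have err: "norm (err k) \<le> e * h" if "k < n" for k
  proof -
    have "norm (integral {real k * h..real (k + 1) * h} ?g - (real (k + 1) * h - real k * h) *\<^sub>R ?g (real k * h))
      \<le> e * (real (k + 1) * h - real k * h)"
    proof (rule riemann_step[OF _ le])
      show "continuous_on {real k * h..real (k + 1) * h} ?g"
        using cont sub[OF that] by (rule continuous_on_subset)
      fix s assume s: "s \<in> {real k * h..real (k + 1) * h}"
      then have "\<bar>s - real k * h\<bar> \<le> h" using len[of k] by auto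
      moreover have "real k * h \<in> {real k * h..real (k + 1) * h}" using le by simp
      ultimately show "norm (?g s - ?g (real k * h)) \<le> e"
        using s sub[OF that] by (intro e) blast+
    qed
    then show ?thesis unfolding len err_def .
  qed
  have exact: "euler b h x (\<lambda>k. N k + err k) k = X (real k * h)" if "k \<le> n" for k
    using that
  proof (induction k)
    case 0
    show ?case using X0 by simp
  next
    case (Suc k)
    then have k: "k < n" by simp
    have "real (k + 1) * h \<le> real n * h" using k h by (intro mult_right_mono) auto
    then have c0: "continuous_on {0..real (k + 1) * h} ?g"
      by (intro continuous_on_subset[OF cont]) auto
    have "integral {0..real k * h} ?g + integral {real k * h..real (k + 1) * h} ?g = integral {0..real (k + 1) * h} ?g"
      using le[of k] h c0 by (intro Henstock_Kurzweil_Integration.integral_combine integrable_continuous_interval) auto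
    then have "N k = X (real (k + 1) * h) - X (real k * h) - integral {real k * h..real (k + 1) * h} ?g"
      unfolding N[OF k] G by (simp add: algebra_simps)
    then show ?case using Suc by (simp add: err_def add.commute)
  qed
  have "norm (euler b h x N k - X (real k * h)) \<le> (\<Sum>l<n. norm (N l - (N l + err l)))"
    unfolding exact[OF k, symmetric] by (rule euler_endpoint_stability[OF step rho k])
  also have "\<dots> \<le> (\<Sum>l<n. e * h)" using err by (intro sum_mono) simp
  also have "\<dots> = real n * h * e" by simp
  finally show ?thesis .
qed

lemma lip_norm_bound:
  assumes "lip_norm V \<le> ereal \<alpha>"
  shows "\<bar>V y - V z\<bar> \<le> \<alpha> * norm (y - z)"
proof (cases "y = z")
  case False
  then have "ereal (\<bar>V y - V z\<bar> / norm (y - z)) \<le> lip_norm V"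
    unfolding lip_norm_def by (intro SUP_upper2[of "(y, z)"]) auto
  with assms have "ereal (\<bar>V y - V z\<bar> / norm (y - z)) \<le> ereal \<alpha>" by (rule order_trans[rotated])
  with False show ?thesis by (simp add: field_simps)
qed simp

lemma augmented_filtration_subset:
  fixes X :: "'a \<Rightarrow> 'c::topological_space"
  assumes W: "\<And>s. s \<in> {0..t} \<Longrightarrow> W s \<in> borel_measurable M"
    and X: "X \<in> borel_measurable (augmented_filtration M W t)"
  shows "X \<in> borel_measurable M"
proof (rule measurableI)
  let ?G = "{W s -` A \<inter> space M | s A. s \<in> {0..t} \<and> A \<in> sets borel} \<union> null_sets M"
  have G: "?G \<subseteq> sets M" using W by (auto intro: measurable_sets)
  then have G': "?G \<subseteq> Pow (space M)" using sets.sets_into_space by blast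
  have sp: "space (augmented_filtration M W t) = space M"
    unfolding augmented_filtration_def using G' by (rule space_measure_of)
  fix A :: "'c set" assume "A \<in> sets borel"
  then have "X -` A \<inter> space M \<in> sets (augmented_filtration M W t)"
    using measurable_sets[OF X, of A] by (simp only: sp)
  also have "\<dots> = sigma_sets (space M) ?G"
    unfolding augmented_filtration_def using G' by (rule sets_measure_of)
  also have "\<dots> \<subseteq> sets M" using G by (rule sets.sigma_sets_subset)
  finally show "X -` A \<inter> space M \<in> sets M" .
qed simp

section \<open>Time averages of the solution\<close>

context prob_space
begin

context
  fixes H T B \<alpha> S L :: real and x :: "real ^ 'd" and b :: "real ^ 'd \<Rightarrow> real ^ 'd"
    and \<sigma> :: "real \<Rightarrow> real ^ 'm ^ 'd" and W :: "real \<Rightarrow> 'a \<Rightarrow> real ^ 'm"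
    and X :: "real \<Rightarrow> 'a \<Rightarrow> real ^ 'd" and V :: "real ^ 'd \<Rightarrow> real"
  assumes H: "1 / 2 < H" and T: "0 < T" and B: "B < 0"
    and b_lip: "\<And>z z'. norm (b z - b z') \<le> L * norm (z - z')"
    and b_diss: "\<And>z y. (z - y) \<bullet> (b z - b y) \<le> B * (norm (z - y))\<^sup>2"
    and S: "\<And>s. s \<in> {0..T} \<Longrightarrow> norm (\<sigma> s) \<le> S"
    and fbm: "fractional_brownian_motion M H {0..T} W"
    and X_meas: "\<And>t. t \<in> {0..T} \<Longrightarrow> X t \<in> borel_measurable M"
    and X_cont: "\<And>\<omega>. \<omega> \<in> space M \<Longrightarrow> continuous_on {0..T} (\<lambda>t. X t \<omega>)"
    and X_eq: "AE \<omega> in M. \<forall>t\<in>{0..T}. \<forall>i. \<exists>J.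
       (\<forall>j. has_rs_integral (\<lambda>s. \<sigma> s $ i $ j) (\<lambda>s. W s \<omega> $ j) 0 t (J j)) \<and>
       X t \<omega> $ i = x $ i + integral {0..t} (\<lambda>s. b (X s \<omega>) $ i) + (\<Sum>j\<in>UNIV. J j)"
    and V: "\<And>y z. \<bar>V y - V z\<bar> \<le> \<alpha> * norm (y - z)" and \<alpha>: "0 < \<alpha>"
begin

lemma S_nonneg: "0 \<le> S"
proof -
  have "norm (\<sigma> 0) \<le> S" using T by (intro S) simp
  with norm_ge_zero show ?thesis by (rule order_trans)
qed

lemma b_cont: "continuous_on UNIV b" and V_cont: "continuous_on UNIV V"
  by (rule lipschitz_continuous_on, rule b_lip) (rule lipschitz_continuous_on[where K=\<alpha>], simp add: V)

lemmas b_meas = borel_measurable_continuous_onI[OF b_cont]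
  and V_meas = borel_measurable_continuous_onI[OF V_cont]

text \<open>Contraction factor of one Euler step.\<close>

definition rate :: "real \<Rightarrow> real" where
  "rate h = 1 + B * h + L\<^sup>2 * h\<^sup>2 / 2"

lemma rate_bounds:
  assumes h: "0 < h" "h * (- B) \<le> 1" "h * (L\<^sup>2 + 1) \<le> - B"
  shows "0 \<le> rate h" "rate h < 1"
proof -
  have "L\<^sup>2 * h \<le> h * (L\<^sup>2 + 1)" using h(1) by (simp add: algebra_simps)
  then have "L\<^sup>2 * h \<le> - B" using h(3) by linarith
  then have "h * (L\<^sup>2 * h) \<le> h * (- B)" using h(1) by (intro mult_left_mono) auto
  moreover have "h * (- B) > 0" using h(1) B by (simp add: mult_pos_neg)
  ultimately have "L\<^sup>2 * h\<^sup>2 / 2 < - (B * h)" by (simp add: power2_eq_square algebra_simps)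
  then show "rate h < 1" by (simp add: rate_def)
  have "0 \<le> L\<^sup>2 * h\<^sup>2 / 2" by simp
  moreover have "0 \<le> 1 + B * h" using h(2) by (simp add: mult.commute)
  ultimately show "0 \<le> rate h" by (simp add: rate_def)
qed

lemma step_contraction:
  assumes "0 < h" "0 \<le> rate h"
  shows "norm ((y + h *\<^sub>R b y) - (z + h *\<^sub>R b z)) \<le> rate h * norm (y - z)"
  unfolding rate_def
  using assms by (intro euler_step_contraction b_lip b_diss) (auto simp: rate_def)

text \<open>Defined by \<open>lim\<close> rather than from the solution, so that measurability is immediate.\<close>

definition limit_noise :: "real \<Rightarrow> nat \<Rightarrow> 'a \<Rightarrow> real ^ 'd" where
  "limit_noise h k \<omega> = lim (\<lambda>q. rs_noise \<sigma> (\<lambda>s. W s \<omega>) h (Suc q) k)"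

text \<open>The stochastic integral, read off from the equation.\<close>

definition driver :: "'a \<Rightarrow> real \<Rightarrow> real ^ 'd" where
  "driver \<omega> t = X t \<omega> - x - integral {0..t} (\<lambda>s. b (X s \<omega>))"

lemma drift_continuous:
  assumes "\<omega> \<in> space M"
  shows "continuous_on {0..T} (\<lambda>s. b (X s \<omega>))"
  using b_cont X_cont[OF assms] by (rule continuous_on_compose2) simp

lemma limit_noise_measurable:
  assumes h: "0 < h" and n: "real n * h \<le> T" and k: "k < n"
  shows "limit_noise h k \<in> borel_measurable M"
proof -
  have "(\<lambda>\<omega>. rs_noise \<sigma> (\<lambda>s. W s \<omega>) h (Suc q) k) \<in> borel_measurable M" for q
  proof (rule rs_noise_path_measurable)
    fix l j assume l: "l \<le> k * Suc q + Suc q"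
    have "real l \<le> real (k + 1) * real (Suc q)"
      using l by (simp only: of_nat_mult[symmetric] of_nat_le_iff) simp
    also have "\<dots> \<le> real n * real (Suc q)" using k by (intro mult_right_mono) auto
    finally have "real l * (h / Suc q) \<le> real n * real (Suc q) * (h / Suc q)"
      using h by (intro mult_right_mono) auto
    also have "\<dots> = real n * h" by simp
    finally have "real l * (h / Suc q) \<in> {0..T}" using h n by simp
    then show "(\<lambda>\<omega>. W (real l * (h / Suc q)) \<omega> $ j) \<in> borel_measurable M"
      by (rule fbm_nth_measurable[OF fbm])
  qed
  then show ?thesis
    unfolding limit_noise_def[abs_def] by (rule borel_measurable_lim_metric)
qed

text \<open>The equation supplies the Riemann--Stieltjes integrals at each of the finitely many grid times; at
  time \<open>0\<close> they vanish.\<close>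

lemma limit_noise:
  assumes h: "0 < h" and n: "real n * h \<le> T"
  shows "AE \<omega> in M. X 0 \<omega> = x \<and> (\<forall>k<n. (\<lambda>q. rs_noise \<sigma> (\<lambda>s. W s \<omega>) h (Suc q) k) \<longlonglongrightarrow> limit_noise h k \<omega>
    \<and> limit_noise h k \<omega> = driver \<omega> (real (k + 1) * h) - driver \<omega> (real k * h))"
  using X_eq AE_space
proof eventually_elim
  case (elim \<omega>)
  have driver: "\<exists>J. (\<forall>j. has_rs_integral (\<lambda>s. \<sigma> s $ i $ j) (\<lambda>s. W s \<omega> $ j) 0 t (J j)) \<and> driver \<omega> t $ i = (\<Sum>j\<in>UNIV. J j)"
    if t: "t \<in> {0..T}" for t i
  proof -
    obtain J where J: "\<And>j. has_rs_integral (\<lambda>s. \<sigma> s $ i $ j) (\<lambda>s. W s \<omega> $ j) 0 t (J j)"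
      "X t \<omega> $ i = x $ i + integral {0..t} (\<lambda>s. b (X s \<omega>) $ i) + (\<Sum>j\<in>UNIV. J j)"
      using elim(1) t by blast
    have "continuous_on {0..t} (\<lambda>s. b (X s \<omega>))"
      using drift_continuous[OF elim(2)] by (rule continuous_on_subset) (use t in auto)
    then have "(\<lambda>s. b (X s \<omega>)) integrable_on {0..t}" by (rule integrable_continuous_interval)
    then have "integral {0..t} (\<lambda>s. b (X s \<omega>)) $ i = integral {0..t} (\<lambda>s. b (X s \<omega>) $ i)"
      by (rule integral_component_eq_cart[symmetric])
    then have "driver \<omega> t $ i = (\<Sum>j\<in>UNIV. J j)" unfolding driver_def using J(2) by simp
    with J(1) show ?thesis by blast
  qed
  have X0: "X 0 \<omega> = x"
  proof (rule vec_eq_iff[THEN iffD2], rule allI)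
    fix i
    obtain J where J: "\<And>j. has_rs_integral (\<lambda>s. \<sigma> s $ i $ j) (\<lambda>s. W s \<omega> $ j) 0 0 (J j)"
      "driver \<omega> 0 $ i = (\<Sum>j\<in>UNIV. J j)"
      using driver[of 0 i] T by auto
    have "J j = 0" for j using has_rs_integral_singleton[OF J(1)] .
    then show "X 0 \<omega> $ i = x $ i" using J(2) by (simp add: driver_def)
  qed
  have conv: "(\<lambda>q. rs_noise \<sigma> (\<lambda>s. W s \<omega>) h (Suc q) k)
      \<longlonglongrightarrow> driver \<omega> (real (k + 1) * h) - driver \<omega> (real k * h)" if "k < n" for k
  proof (rule rs_noise_tendsto[OF h _ that])
    fix k i assume "k \<le> n"
    then have "real k * h \<le> real n * h" using h by (intro mult_right_mono) auto
    then have "real k * h \<le> T" using n by (rule order_trans)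
    then have "real k * h \<in> {0..T}" using h by simp
    then show "\<exists>J. (\<forall>j. has_rs_integral (\<lambda>s. \<sigma> s $ i $ j) (\<lambda>s. W s \<omega> $ j) 0 (real k * h) (J j)) \<and>
      driver \<omega> (real k * h) $ i = (\<Sum>j\<in>UNIV. J j)" by (rule driver)
  qed
  then have "limit_noise h k \<omega> = driver \<omega> (real (k + 1) * h) - driver \<omega> (real k * h)" if "k < n" for k
    unfolding limit_noise_def using that by (intro limI) auto
  with conv X0 show ?case by simp
qed

lemma functional_subgaussian:
  assumes h: "0 < h" and n: "real n * h \<le> T"
    and \<Phi>m: "\<Phi> \<in> borel_measurable (PiM {..<n} (\<lambda>_. borel))"
    and \<Phi>: "\<And>N N'. \<bar>\<Phi> N - \<Phi> N'\<bar> \<le> \<kappa> * (\<Sum>l<n. norm (N l - N' l))" and \<kappa>: "0 \<le> \<kappa>"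
  shows "\<exists>a. subgaussian M (\<lambda>\<omega>. \<Phi> (\<lambda>k. limit_noise h k \<omega>)) a (\<kappa> * S * (real n * h) powr H)"
proof (rule noise_functional_subgaussian[OF fbm _ h n S S_nonneg \<Phi>m \<Phi> \<kappa>])
  show "1 / 2 \<le> H" using H by simp
  show "limit_noise h k \<in> borel_measurable M" if "k < n" for k
    using limit_noise_measurable[OF h n that] .
  show "AE \<omega> in M. \<forall>k<n. (\<lambda>q. rs_noise \<sigma> (\<lambda>s. W s \<omega>) h (Suc q) k) \<longlonglongrightarrow> limit_noise h k \<omega>"
    using limit_noise[OF h n] by eventually_elim blast
qed

lemma rate_eventually:
  assumes t: "0 < t"
  shows "\<forall>\<^sub>F n in sequentially. 0 \<le> 1 + B * (t / Suc n) \<and> 0 \<le> rate (t / Suc n) \<and> rate (t / Suc n) < 1"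
proof -
  define m where "m = min (1 / (- B)) ((- B) / (L\<^sup>2 + 1))"
  have L1: "0 < L\<^sup>2 + 1" by (simp add: add_nonneg_pos)
  have "0 < 1 / (- B)" "0 < (- B) / (L\<^sup>2 + 1)"
    using B L1 by (intro divide_pos_pos; simp)+
  then have m: "0 < m" "m \<le> 1 / (- B)" "m \<le> (- B) / (L\<^sup>2 + 1)"
    unfolding m_def by linarith+
  obtain n0 :: nat where n0: "t / m < real n0" using reals_Archimedean2 by blast
  show ?thesis
    unfolding eventually_sequentially
  proof (intro exI allI impI)
    fix n assume n: "n0 \<le> n"
    define h where "h = t / Suc n"
    have h: "0 < h" using t by (simp add: h_def)
    have "t / m < real (Suc n)" using n0 n by simp
    then have hm: "h \<le> m" using m(1) by (simp add: h_def field_simps)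
    have "h * (- B) \<le> (1 / (- B)) * (- B)"
      using hm m(2) B by (intro mult_right_mono) auto
    then have 1: "h * (- B) \<le> 1" using B by simp
    have "h * (L\<^sup>2 + 1) \<le> ((- B) / (L\<^sup>2 + 1)) * (L\<^sup>2 + 1)"
      using hm m(3) L1 by (intro mult_right_mono) auto
    then have "h * (L\<^sup>2 + 1) \<le> - B" using L1 by simp
    from rate_bounds[OF h 1 this] 1
    show "0 \<le> 1 + B * (t / Suc n) \<and> 0 \<le> rate (t / Suc n) \<and> rate (t / Suc n) < 1"
      unfolding h_def[symmetric] by (simp add: mult.commute)
  qed
qed

text \<open>The error over one block is controlled by the modulus of continuity of the drift along the path,
  and stability makes the blocks add up to at most the length of the time interval.\<close>

lemma euler_converges:
  assumes t: "0 < t" "t \<le> T"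
  shows "AE \<omega> in M. (\<forall>e>0. \<exists>n0. \<forall>n\<ge>n0. \<forall>k\<le>Suc n.
    norm (euler b (t / Suc n) x (\<lambda>k. limit_noise (t / Suc n) k \<omega>) k - X (real k * (t / Suc n)) \<omega>) \<le> e)"
proof -
  have tn: "0 < t / Suc n" "real (Suc n) * (t / Suc n) = t" for n using t by auto
  have "AE \<omega> in M. \<forall>n. X 0 \<omega> = x \<and> (\<forall>k<Suc n. limit_noise (t / Suc n) k \<omega>
     = driver \<omega> (real (k + 1) * (t / Suc n)) - driver \<omega> (real k * (t / Suc n)))"
    unfolding AE_all_countable
  proof
    fix n
    have "real (Suc n) * (t / Suc n) \<le> T" using t tn(2)[of n] by simp
    from limit_noise[OF tn(1) this] show "AE \<omega> in M. X 0 \<omega> = x \<and> (\<forall>k<Suc n. limit_noise (t / Suc n) k \<omega>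
       = driver \<omega> (real (k + 1) * (t / Suc n)) - driver \<omega> (real k * (t / Suc n)))"
      by eventually_elim blast
  qed
  then show ?thesis
    using AE_space
  proof eventually_elim
    case (elim \<omega>)
    show ?case
    proof (intro allI impI)
      fix e :: real assume e: "0 < e"
      have c: "continuous_on {0..t} (\<lambda>s. b (X s \<omega>))"
        using drift_continuous[OF elim(2)] by (rule continuous_on_subset) (use t in auto)
      then have "uniformly_continuous_on {0..t} (\<lambda>s. b (X s \<omega>))"
        by (intro compact_uniformly_continuous) auto
      moreover have "0 < e / t" using e t by simp
      ultimately obtain d where d: "0 < d" "\<And>s s'. s \<in> {0..t} \<Longrightarrow> s' \<in> {0..t} \<Longrightarrow> dist s s' < d \<Longrightarrow>
        dist (b (X s \<omega>)) (b (X s' \<omega>)) < e / t"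
        unfolding uniformly_continuous_on_def by metis
      obtain n1 where n1: "\<And>n. n1 \<le> n \<Longrightarrow> 0 \<le> rate (t / Suc n) \<and> rate (t / Suc n) < 1"
        using rate_eventually[OF t(1)] unfolding eventually_sequentially by blast
      obtain n2 :: nat where n2: "t / d < real n2" using reals_Archimedean2 by blast
      show "\<exists>n0. \<forall>n\<ge>n0. \<forall>k\<le>Suc n.
        norm (euler b (t / Suc n) x (\<lambda>k. limit_noise (t / Suc n) k \<omega>) k - X (real k * (t / Suc n)) \<omega>) \<le> e"
      proof (intro exI allI impI)
        fix n k assume n: "max n1 n2 \<le> n" and k: "k \<le> Suc n"
        define h where "h = t / Suc n"
        have h: "0 < h" "real (Suc n) * h = t" unfolding h_def by (rule tn)+
        have "t / d < real (Suc n)" using n2 n by simp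
        then have hd: "h < d" using d(1) by (simp add: h_def field_simps)
        have r: "0 \<le> rate h" "rate h \<le> 1" using n1[of n] n by (auto simp: h_def)
        have "norm (euler b h x (\<lambda>k. limit_noise h k \<omega>) k - X (real k * h) \<omega>) \<le> real (Suc n) * h * (e / t)"
        proof (rule euler_error[where X="\<lambda>s. X s \<omega>" and \<rho>="rate h" and G="driver \<omega>"])
          show "norm ((y + h *\<^sub>R b y) - (z + h *\<^sub>R b z)) \<le> rate h * norm (y - z)" for y z
            by (rule step_contraction[OF h(1) r(1)])
          show "continuous_on {0..real (Suc n) * h} (\<lambda>s. b (X s \<omega>))" unfolding h(2) by (rule c)
          show "norm (b (X s \<omega>) - b (X s' \<omega>)) \<le> e / t"
            if "s \<in> {0..real (Suc n) * h}" "s' \<in> {0..real (Suc n) * h}" "\<bar>s - s'\<bar> \<le> h" for s s'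
            using d(2)[of s s'] that hd unfolding h(2) by (simp add: dist_norm)
          show "limit_noise h k \<omega> = driver \<omega> (real (k + 1) * h) - driver \<omega> (real k * h)" if "k < Suc n" for k
            using elim(1) that unfolding h_def by blast
        qed (use r h k elim(1) in \<open>auto simp: driver_def\<close>)
        also have "real (Suc n) * h * (e / t) = e" unfolding h(2) using t by simp
        finally show "norm (euler b (t / Suc n) x (\<lambda>k. limit_noise (t / Suc n) k \<omega>) k - X (real k * (t / Suc n)) \<omega>) \<le> e"
          unfolding h_def .
      qed
    qed
  qed
qed

text \<open>The common pattern of the two limits below, at a single time and for the time average: the scheme
  with the exact noise inherits the bound from its Riemann--Stieltjes approximations, and hands it on
  as the step tends to zero.\<close>

lemma euler_functional_limit:
  assumes t: "0 < t" "t \<le> T"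
    and \<Phi>m: "\<And>n. \<Phi> n \<in> borel_measurable (PiM {..<Suc n} (\<lambda>_. borel))"
    and \<Phi>: "\<And>n N N'. m \<le> n \<Longrightarrow> \<bar>\<Phi> n N - \<Phi> n N'\<bar> \<le> \<kappa> * (\<Sum>l<Suc n. norm (N l - N' l))" and \<kappa>: "0 \<le> \<kappa>"
    and Z: "Z \<in> borel_measurable M"
    and lim: "AE \<omega> in M. (\<lambda>n. \<Phi> n (\<lambda>k. limit_noise (t / Suc n) k \<omega>)) \<longlonglongrightarrow> Z \<omega>"
  shows "subgaussian M Z (expectation Z) (\<kappa> * S * T powr H)"
proof -
  let ?Y = "\<lambda>n \<omega>. \<Phi> n (\<lambda>k. limit_noise (t / Suc n) k \<omega>)"
  have tn: "0 < t / Suc n" "real (Suc n) * (t / Suc n) = t" for n using t by auto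
  have ex: "\<exists>a. subgaussian M (?Y n) a (\<kappa> * S * T powr H)" if n: "m \<le> n" for n
  proof -
    have "real (Suc n) * (t / Suc n) \<le> T" unfolding tn(2) by (rule t)
    from functional_subgaussian[OF tn(1) this \<Phi>m \<Phi>[OF n] \<kappa>]
    obtain a where a: "subgaussian M (?Y n) a (\<kappa> * S * t powr H)" unfolding tn(2) by blast
    have "0 \<le> \<kappa> * S * t powr H" using \<kappa> S_nonneg by simp
    moreover have "\<kappa> * S * t powr H \<le> \<kappa> * S * T powr H"
      using \<kappa> S_nonneg t H by (intro mult_left_mono powr_mono2) auto
    ultimately show ?thesis using subgaussian_mono[OF a] by blast
  qed
  define a where "a n = (SOME a. subgaussian M (?Y n) a (\<kappa> * S * T powr H))" for n
  have a: "subgaussian M (?Y n) (a n) (\<kappa> * S * T powr H)" if "m \<le> n" for n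
    unfolding a_def by (rule someI_ex) (rule ex[OF that])
  show ?thesis
  proof (rule subgaussian_limit(1)[where Y="\<lambda>n. ?Y (n + m)" and a="\<lambda>n. a (n + m)"])
    show "subgaussian M (?Y (n + m)) (a (n + m)) (\<kappa> * S * T powr H)" for n by (rule a) simp
    show "0 \<le> \<kappa> * S * T powr H" using \<kappa> S_nonneg by simp
    show "AE \<omega> in M. (\<lambda>n. ?Y (n + m) \<omega>) \<longlonglongrightarrow> Z \<omega>"
      using lim by eventually_elim (rule LIMSEQ_ignore_initial_segment)
  qed (rule Z)
qed

lemma terminal_subgaussian_pos:
  assumes t: "0 < t" "t \<le> T"
  shows "subgaussian M (\<lambda>\<omega>. V (X t \<omega>)) (expectation (\<lambda>\<omega>. V (X t \<omega>))) (\<alpha> * S * T powr H)"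
proof -
  obtain n0 where n0: "\<And>n. n0 \<le> n \<Longrightarrow> 0 \<le> rate (t / Suc n) \<and> rate (t / Suc n) < 1"
    using rate_eventually[OF t(1)] unfolding eventually_sequentially by blast
  have tn: "0 < t / Suc n" "real (Suc n) * (t / Suc n) = t" for n using t by auto
  let ?E = "\<lambda>n N. euler b (t / Suc n) x N (Suc n)"
  show ?thesis
  proof (rule euler_functional_limit[OF t, where m=n0 and \<Phi>="\<lambda>n N. V (?E n N)"])
    show "(\<lambda>N. V (?E n N)) \<in> borel_measurable (PiM {..<Suc n} (\<lambda>_. borel))" for n
      by (rule measurable_compose[OF euler_measurable[OF b_meas] V_meas]) simp
    show "\<bar>V (?E n N) - V (?E n N')\<bar> \<le> \<alpha> * (\<Sum>l<Suc n. norm (N l - N' l))" if "n0 \<le> n" for n N N'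
      using \<alpha> n0[OF that] by (intro order_trans[OF V] mult_left_mono
        euler_endpoint_stability[OF step_contraction[OF tn(1)]]) auto
    show "(\<lambda>\<omega>. V (X t \<omega>)) \<in> borel_measurable M"
      using t by (intro measurable_compose[OF X_meas V_meas]) auto
    show "AE \<omega> in M. (\<lambda>n. V (?E n (\<lambda>k. limit_noise (t / Suc n) k \<omega>))) \<longlonglongrightarrow> V (X t \<omega>)"
      using euler_converges[OF t]
    proof eventually_elim
      case (elim \<omega>)
      let ?N = "\<lambda>n k. limit_noise (t / Suc n) k \<omega>"
      have "(\<lambda>n. ?E n (?N n)) \<longlonglongrightarrow> X t \<omega>"
      proof (rule LIMSEQ_I)
        fix e :: real assume e: "0 < e"
        then have "0 < e / 2" by simp
        with elim obtain n1 where n1: "\<And>n k. n1 \<le> n \<Longrightarrow> k \<le> Suc n \<Longrightarrow>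
          norm (euler b (t / Suc n) x (?N n) k - X (real k * (t / Suc n)) \<omega>) \<le> e / 2" by blast
        have "norm (?E n (?N n) - X t \<omega>) < e" if "n1 \<le> n" for n
          using n1[OF that order_refl] e unfolding tn(2) by linarith
        then show "\<exists>n1. \<forall>n\<ge>n1. norm (?E n (?N n) - X t \<omega>) < e" by blast
      qed
      moreover have "isCont V (X t \<omega>)" using V_cont by (simp add: continuous_on_eq_continuous_at)
      ultimately show ?case by (rule isCont_tendsto_compose[rotated])
    qed
  qed (use \<alpha> in simp)
qed

lemma V_path_continuous:
  assumes "\<omega> \<in> space M"
  shows "continuous_on {0..T} (\<lambda>t. V (X t \<omega>))"
  using V_cont X_cont[OF assms] by (rule continuous_on_compose2) simp

lemma V_path_tendsto:
  assumes "\<omega> \<in> space M" "\<And>n. u n \<in> {0..T}" "t \<in> {0..T}" "u \<longlonglongrightarrow> t"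
  shows "(\<lambda>n. V (X (u n) \<omega>)) \<longlonglongrightarrow> V (X t \<omega>)"
  using V_path_continuous[OF assms(1)] assms(2-) unfolding continuous_on_sequentially by (auto simp: comp_def)

lemma V_X_measurable: "t \<in> {0..T} \<Longrightarrow> (\<lambda>\<omega>. V (X t \<omega>)) \<in> borel_measurable M"
  by (rule measurable_compose[OF X_meas V_meas])

lemma bound_nonneg: "0 \<le> \<alpha> * S * T powr H"
  using \<alpha> S_nonneg by simp

text \<open>At \<open>t = 0\<close> there is no Euler step; this case is the limit from the right.\<close>

lemma terminal_subgaussian:
  assumes t: "t \<in> {0..T}"
  shows "subgaussian M (\<lambda>\<omega>. V (X t \<omega>)) (expectation (\<lambda>\<omega>. V (X t \<omega>))) (\<alpha> * S * T powr H)"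
proof (cases "t = 0")
  case False
  then show ?thesis using t by (intro terminal_subgaussian_pos) auto
next
  case True
  define u where "u n = T / Suc n" for n
  have u: "0 < u n" "u n \<le> T" for n using T by (auto simp: u_def field_simps)
  have "u \<longlonglongrightarrow> 0" unfolding u_def
    using LIMSEQ_Suc[OF lim_const_over_n[of T]] by simp
  then have "AE \<omega> in M. (\<lambda>n. V (X (u n) \<omega>)) \<longlonglongrightarrow> V (X t \<omega>)"
    using u t True by (intro AE_I2 V_path_tendsto) (auto intro: less_imp_le)
  then show ?thesis
    using terminal_subgaussian_pos[OF u] bound_nonneg V_X_measurable[OF t]
    by (intro subgaussian_limit(1)[where Y="\<lambda>n \<omega>. V (X (u n) \<omega>)"])
qed

text \<open>The paths are continuous and the sub-Gaussian bound is uniform in \<open>t\<close>.\<close>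

lemma mean_continuous: "continuous_on {0..T} (\<lambda>t. expectation (\<lambda>\<omega>. V (X t \<omega>)))"
proof (rule continuous_on_sequentiallyI)
  fix u t assume u: "\<forall>n. u n \<in> {0..T}" and t: "t \<in> {0..T}" and lim: "u \<longlonglongrightarrow> t"
  have "AE \<omega> in M. (\<lambda>n. V (X (u n) \<omega>)) \<longlonglongrightarrow> V (X t \<omega>)"
    using u t lim by (intro AE_I2 V_path_tendsto) auto
  then show "(\<lambda>n. expectation (\<lambda>\<omega>. V (X (u n) \<omega>))) \<longlonglongrightarrow> expectation (\<lambda>\<omega>. V (X t \<omega>))"
    using u terminal_subgaussian bound_nonneg V_X_measurable[OF t]
    by (intro subgaussian_limit(2)[where Y="\<lambda>n \<omega>. V (X (u n) \<omega>)"]) auto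
qed

definition time_average :: "'a \<Rightarrow> real" where
  "time_average \<omega> = 1 / T * integral {0..T} (\<lambda>t. V (X t \<omega>))"

lemma grid: "k < Suc n \<Longrightarrow> real k * (T / Suc n) \<in> {0..T}"
  using T mult_right_mono[of "real k" "real (Suc n)" "T / Suc n"] by simp

lemma riemann_sum_tendsto_average:
  assumes "\<omega> \<in> space M"
  shows "(\<lambda>n. (\<Sum>k<Suc n. V (X (real k * (T / Suc n)) \<omega>)) / Suc n) \<longlonglongrightarrow> time_average \<omega>"
  unfolding time_average_def by (rule riemann_sums_tendsto[OF V_path_continuous[OF assms] T])

lemma time_average_measurable: "time_average \<in> borel_measurable M"
proof (rule borel_measurable_LIMSEQ_real)
  show "(\<lambda>\<omega>. (\<Sum>k<Suc n. V (X (real k * (T / Suc n)) \<omega>)) / Suc n) \<in> borel_measurable M" for n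
    using grid by (intro borel_measurable_divide borel_measurable_sum V_X_measurable borel_measurable_const) simp
qed (rule riemann_sum_tendsto_average)

text \<open>The Riemann sums in time converge pathwise, hence also in mean since they are uniformly
  sub-Gaussian; this interchanges the expectation with the time integral.\<close>

lemma expectation_time_average:
  "expectation time_average = 1 / T * integral {0..T} (\<lambda>t. expectation (\<lambda>\<omega>. V (X t \<omega>)))"
proof (rule LIMSEQ_unique)
  let ?m = "\<lambda>t. expectation (\<lambda>\<omega>. V (X t \<omega>))"
  show "(\<lambda>n. (\<Sum>k<Suc n. ?m (real k * (T / Suc n))) / Suc n) \<longlonglongrightarrow> 1 / T * integral {0..T} ?m"
    by (rule riemann_sums_tendsto[OF mean_continuous T])
  show "(\<lambda>n. (\<Sum>k<Suc n. ?m (real k * (T / Suc n))) / Suc n) \<longlonglongrightarrow> expectation time_average"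
  proof (rule subgaussian_limit(2))
    show "subgaussian M (\<lambda>\<omega>. (\<Sum>k<Suc n. V (X (real k * (T / Suc n)) \<omega>)) / Suc n)
      ((\<Sum>k<Suc n. ?m (real k * (T / Suc n))) / Suc n) (\<alpha> * S * T powr H)" for n
      by (intro subgaussian_average terminal_subgaussian grid) auto
    show "AE \<omega> in M. (\<lambda>n. (\<Sum>k<Suc n. V (X (real k * (T / Suc n)) \<omega>)) / Suc n) \<longlonglongrightarrow> time_average \<omega>"
      by (intro AE_I2 riemann_sum_tendsto_average)
  qed (rule bound_nonneg time_average_measurable)+
qed

text \<open>Lipschitz constant of the averaged Euler scheme with respect to the sum of the norms of the noise
  shifts.\<close>

definition average_gain :: "nat \<Rightarrow> real" where
  "average_gain n = \<alpha> / Suc n * (\<Sum>i<Suc n. rate (T / Suc n) ^ i)"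

text \<open>The powers of \<open>rate h\<close> form a geometric sum, and bounding \<open>rate h\<close> below by \<open>1 + B * h\<close>
  makes the last power comparable with \<open>exp (B * T)\<close>.\<close>

lemma average_gain_eventually:
  assumes c: "\<alpha> * (1 - exp (B * T)) / (- B * T) < c"
  shows "\<forall>\<^sub>F n in sequentially. average_gain n \<le> c"
proof -
  have lim: "(\<lambda>n. \<alpha> * (1 - (1 + (B * T) / Suc n) ^ Suc n) / (- B * T - L\<^sup>2 * T\<^sup>2 / 2 / Suc n))
    \<longlonglongrightarrow> \<alpha> * (1 - exp (B * T)) / (- B * T - 0)"
  proof (intro tendsto_intros)
    show "(\<lambda>n. (1 + (B * T) / Suc n) ^ Suc n) \<longlonglongrightarrow> exp (B * T)"
      using LIMSEQ_Suc[OF tendsto_exp_limit_sequentially[of "B * T"]] .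
    show "(\<lambda>n. L\<^sup>2 * T\<^sup>2 / 2 / Suc n) \<longlonglongrightarrow> 0"
      using LIMSEQ_Suc[OF lim_const_over_n[of "L\<^sup>2 * T\<^sup>2 / 2"]] .
    show "- B * T - 0 \<noteq> 0" using B T by simp
  qed
  have "\<forall>\<^sub>F n in sequentially. \<alpha> * (1 - (1 + (B * T) / Suc n) ^ Suc n) / (- B * T - L\<^sup>2 * T\<^sup>2 / 2 / Suc n) < c"
    using c by (intro order_tendstoD(2)[OF lim]) simp
  then show ?thesis
    using rate_eventually[OF T]
  proof eventually_elim
    case (elim n)
    define N where "N = real (Suc n)"
    define \<rho> where "\<rho> = rate (T / Suc n)"
    have N: "0 < N" by (simp add: N_def)
    have \<rho>: "0 \<le> \<rho>" "\<rho> < 1" using elim(2) by (auto simp: \<rho>_def)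
    have gap: "N * (1 - \<rho>) = - B * T - L\<^sup>2 * T\<^sup>2 / 2 / N"
      using N unfolding \<rho>_def rate_def N_def[symmetric] by (simp add: field_simps power2_eq_square)
    have "(1 + (B * T) / N) ^ Suc n \<le> \<rho> ^ Suc n"
    proof (rule power_mono)
      show "1 + (B * T) / N \<le> \<rho>" unfolding \<rho>_def rate_def N_def by simp
      show "0 \<le> 1 + (B * T) / N" using elim(2) by (simp add: N_def)
    qed
    then have pw: "1 - \<rho> ^ Suc n \<le> 1 - (1 + (B * T) / N) ^ Suc n" by simp
    have "(\<Sum>i<Suc n. \<rho> ^ i) = (1 - \<rho> ^ Suc n) / (1 - \<rho>)"
      using \<rho> by (intro sum_gp_strict[THEN trans]) auto
    moreover have "average_gain n = \<alpha> / N * (\<Sum>i<Suc n. \<rho> ^ i)"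
      by (simp only: average_gain_def \<rho>_def N_def)
    ultimately have "average_gain n = \<alpha> * (1 - \<rho> ^ Suc n) / (N * (1 - \<rho>))"
      by (simp only: times_divide_times_eq)
    also have "\<dots> \<le> \<alpha> * (1 - (1 + (B * T) / N) ^ Suc n) / (N * (1 - \<rho>))"
      using pw \<alpha> N \<rho> by (intro divide_right_mono mult_left_mono) auto
    also have "\<dots> < c" using elim(1) unfolding gap unfolding N_def .
    finally show ?case by simp
  qed
qed

lemma time_average_subgaussian:
  assumes c: "\<alpha> * (1 - exp (B * T)) / (- B * T) < c"
  shows "subgaussian M time_average (expectation time_average) (c * S * T powr H)"
proof -
  have "\<forall>\<^sub>F n in sequentially. average_gain n \<le> c \<and> 0 \<le> rate (T / Suc n)"
    using average_gain_eventually[OF c] rate_eventually[OF T] by eventually_elim blast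
  then obtain n0 where n0: "\<And>n. n0 \<le> n \<Longrightarrow> average_gain n \<le> c \<and> 0 \<le> rate (T / Suc n)"
    unfolding eventually_sequentially by blast
  have tn: "0 < T / Suc n" for n using T by auto
  let ?E = "\<lambda>n. euler b (T / Suc n) x"
  let ?F = "\<lambda>n N. (\<Sum>k<Suc n. V (?E n N k)) / Suc n"
  have mean_diff: "\<bar>(\<Sum>k<Suc n. f k) / Suc n - (\<Sum>k<Suc n. g k) / Suc n\<bar> \<le> (\<Sum>k<Suc n. d k) / Suc n"
    if "\<And>k. k < Suc n \<Longrightarrow> \<bar>f k - g k\<bar> \<le> d k" for f g d and n :: nat
  proof -
    have "\<bar>(\<Sum>k<Suc n. f k) / Suc n - (\<Sum>k<Suc n. g k) / Suc n\<bar> = \<bar>\<Sum>k<Suc n. f k - g k\<bar> / Suc n"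
      by (simp only: diff_divide_distrib[symmetric] sum_subtractf abs_divide abs_of_nat)
    also have "\<dots> \<le> (\<Sum>k<Suc n. d k) / Suc n"
      by (intro divide_right_mono order_trans[OF sum_abs] sum_mono that) auto
    finally show ?thesis .
  qed
  show ?thesis
  proof (rule euler_functional_limit[OF T order_refl, where m=n0 and \<Phi>="?F"])
    show "?F n \<in> borel_measurable (PiM {..<Suc n} (\<lambda>_. borel))" for n
      by (intro borel_measurable_divide borel_measurable_sum borel_measurable_const
        measurable_compose[OF euler_measurable[OF b_meas] V_meas]) simp
    show "0 \<le> c"
    proof -
      have "B * T < 0" using B T by (rule mult_neg_pos)
      then have "0 \<le> \<alpha> * (1 - exp (B * T)) / (- B * T)"
        using \<alpha> B T by (intro divide_nonneg_nonneg mult_nonneg_nonneg) simp_all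
      with c show ?thesis by linarith
    qed
    show "\<bar>?F n N - ?F n N'\<bar> \<le> c * (\<Sum>l<Suc n. norm (N l - N' l))" if n: "n0 \<le> n" for n N N'
    proof -
      have r: "0 \<le> rate (T / Suc n)" using n0[OF n] by simp
      have "\<bar>?F n N - ?F n N'\<bar> \<le> (\<Sum>k<Suc n. \<alpha> * norm (?E n N k - ?E n N' k)) / Suc n"
        by (rule mean_diff) (rule V)
      also have "\<dots> = \<alpha> / Suc n * (\<Sum>k<Suc n. norm (?E n N k - ?E n N' k))"
        by (simp only: sum_distrib_left[symmetric] times_divide_eq_left)
      also have "\<dots> \<le> \<alpha> / Suc n * ((\<Sum>i<Suc n. rate (T / Suc n) ^ i) * (\<Sum>l<Suc n. norm (N l - N' l)))"
        using \<alpha> by (intro mult_left_mono euler_sum_stability[OF step_contraction[OF tn r] r]) simp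
      also have "\<dots> = average_gain n * (\<Sum>l<Suc n. norm (N l - N' l))"
        unfolding average_gain_def by (simp only: mult.assoc)
      also have "\<dots> \<le> c * (\<Sum>l<Suc n. norm (N l - N' l))"
        using n0[OF n] by (intro mult_right_mono sum_nonneg) auto
      finally show ?thesis .
    qed
    show "AE \<omega> in M. (\<lambda>n. ?F n (\<lambda>k. limit_noise (T / Suc n) k \<omega>)) \<longlonglongrightarrow> time_average \<omega>"
      using euler_converges[OF T order_refl] AE_space
    proof eventually_elim
      case (elim \<omega>)
      let ?N = "\<lambda>n k. limit_noise (T / Suc n) k \<omega>"
      let ?R = "\<lambda>n. (\<Sum>k<Suc n. V (X (real k * (T / Suc n)) \<omega>)) / Suc n"
      have "(\<lambda>n. ?F n (?N n) - ?R n) \<longlonglongrightarrow> 0"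
      proof (rule LIMSEQ_I)
        fix e :: real assume e: "0 < e"
        then have "0 < e / (2 * \<alpha>)" using \<alpha> by simp
        with elim(1) obtain n1 where n1: "\<And>n k. n1 \<le> n \<Longrightarrow> k \<le> Suc n \<Longrightarrow>
          norm (?E n (?N n) k - X (real k * (T / Suc n)) \<omega>) \<le> e / (2 * \<alpha>)" by blast
        have "norm (?F n (?N n) - ?R n - 0) < e" if n: "n1 \<le> n" for n
        proof -
          have "\<bar>?F n (?N n) - ?R n\<bar> \<le> (\<Sum>k<Suc n. \<alpha> * (e / (2 * \<alpha>))) / Suc n"
            using \<alpha> n1[OF n] by (intro mean_diff order_trans[OF V] mult_left_mono) auto
          also have "\<dots> = e / 2" using \<alpha> by (simp del: of_nat_Suc)
          finally show ?thesis using e by simp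
        qed
        then show "\<exists>n1. \<forall>n\<ge>n1. norm (?F n (?N n) - ?R n - 0) < e" by blast
      qed
      from tendsto_add[OF this riemann_sum_tendsto_average[OF elim(2)]]
      show ?case by simp
    qed
  qed (rule time_average_measurable)
qed

text \<open>The constant \<open>c\<close> is chosen so that the Gaussian tail is the asserted bound. That it exceeds the
  limiting gain amounts to \<open>q\<^sup>2 < 2 * H * q\<close> for \<open>q = 1 - exp (B * T)\<close>. For \<open>S = 0\<close> the
  division by zero makes the asserted bound equal to \<open>1\<close>.\<close>

lemma time_average_tail:
  assumes r: "0 < r"
  shows "prob {\<omega> \<in> space M.
      1 / T * integral {0..T} (\<lambda>t. V (X t \<omega>) - expectation (\<lambda>\<omega>'. V (X t \<omega>'))) > r}
    \<le> exp (- (r\<^sup>2 * B\<^sup>2 * T powr (2 - 2 * H) / (4 * \<alpha>\<^sup>2 * H * S\<^sup>2 * (1 - exp (B * T)))))"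
proof (cases "S = 0")
  case True
  then show ?thesis by simp
next
  case False
  then have S0: "0 < S" using S_nonneg by simp
  define q where "q = 1 - exp (B * T)"
  have "B * T < 0" using B T by (rule mult_neg_pos)
  then have q: "0 < q" "q < 1" by (auto simp: q_def)
  define c where "c = \<alpha> * sqrt (2 * H * q) / (- B * T)"
  have BT: "0 < - B * T" using \<open>B * T < 0\<close> by simp
  have "q\<^sup>2 < 2 * H * q"
  proof -
    have "q * q < 1 * q" using q by (intro mult_strict_right_mono) auto
    moreover have "1 * q \<le> 2 * H * q" using q H by (intro mult_right_mono) auto
    ultimately show ?thesis by (simp add: power2_eq_square)
  qed
  then have "q < sqrt (2 * H * q)" by (rule real_less_rsqrt)
  then have "\<alpha> * q < \<alpha> * sqrt (2 * H * q)" using \<alpha> by (rule mult_strict_left_mono)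
  then have "\<alpha> * q / (- B * T) < c" unfolding c_def using BT by (rule divide_strict_right_mono)
  then have sub: "subgaussian M time_average (expectation time_average) (c * S * T powr H)"
    unfolding q_def by (rule time_average_subgaussian)
  have "0 < \<alpha> * sqrt (2 * H * q)" using \<alpha> q H by simp
  then have "0 < c" unfolding c_def using BT by (rule divide_pos_pos)
  then have K: "0 < c * S * T powr H" using S0 T by simp
  note [measurable] = time_average_measurable
  have "1 / T * integral {0..T} (\<lambda>t. V (X t \<omega>) - expectation (\<lambda>\<omega>'. V (X t \<omega>')))
      = time_average \<omega> - expectation time_average" if "\<omega> \<in> space M" for \<omega>
  proof -
    have "integral {0..T} (\<lambda>t. V (X t \<omega>) - expectation (\<lambda>\<omega>'. V (X t \<omega>')))
      = integral {0..T} (\<lambda>t. V (X t \<omega>)) - integral {0..T} (\<lambda>t. expectation (\<lambda>\<omega>'. V (X t \<omega>')))"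
      by (intro Henstock_Kurzweil_Integration.integral_diff integrable_continuous_interval
        V_path_continuous[OF that] mean_continuous)
    then show ?thesis
      unfolding expectation_time_average time_average_def by (simp only: right_diff_distrib)
  qed
  then have "{\<omega> \<in> space M. 1 / T * integral {0..T} (\<lambda>t. V (X t \<omega>) - expectation (\<lambda>\<omega>'. V (X t \<omega>'))) > r}
    \<subseteq> {\<omega> \<in> space M. time_average \<omega> - expectation time_average \<ge> r}"
    by auto
  then have "prob {\<omega> \<in> space M. 1 / T * integral {0..T} (\<lambda>t. V (X t \<omega>) - expectation (\<lambda>\<omega>'. V (X t \<omega>'))) > r}
    \<le> prob {\<omega> \<in> space M. time_average \<omega> - expectation time_average \<ge> r}"
    by (intro finite_measure_mono) simp_all
  also have "\<dots> \<le> exp (- r\<^sup>2 / (2 * (c * S * T powr H)\<^sup>2))"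
    using r by (intro subgaussian_tail(1)[OF sub K]) simp
  also have "- r\<^sup>2 / (2 * (c * S * T powr H)\<^sup>2) = - (r\<^sup>2 * B\<^sup>2 * T powr (2 - 2 * H) / (4 * \<alpha>\<^sup>2 * H * S\<^sup>2 * q))"
  proof -
    define P where "P = (T powr H)\<^sup>2"
    have P: "0 < P" using T by (simp add: P_def)
    have e1: "T powr (2 - 2 * H) = T\<^sup>2 / P"
      unfolding P_def
      using T by (simp add: powr_diff power2_eq_square powr_add[symmetric])
    have e2: "c\<^sup>2 = \<alpha>\<^sup>2 * (2 * H * q) / (B\<^sup>2 * T\<^sup>2)"
      unfolding c_def using H q by (simp add: power_divide power_mult_distrib)
    show ?thesis
      unfolding power_mult_distrib e1 e2 P_def[symmetric]
      using \<alpha> H S0 q B T P by (simp add: field_simps)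
  qed
  finally show ?thesis unfolding q_def .
qed

end

end

theorem mainTheorem6:
  fixes M :: "'a measure"
    and H T B \<beta> \<alpha> r :: real
    and x :: "real ^ 'd"
    and b :: "real ^ 'd \<Rightarrow> real ^ 'd"
    and \<sigma> :: "real \<Rightarrow> real ^ 'm ^ 'd"
    and W :: "real \<Rightarrow> 'a \<Rightarrow> real ^ 'm"
    and X :: "real \<Rightarrow> 'a \<Rightarrow> real ^ 'd"
    and V :: "real ^ 'd \<Rightarrow> real"
  assumes "prob_space M"
    and "1 / 2 < H" and "H < 1" and "T > 0"
    and "\<exists>L. \<forall>z z'. norm (b z - b z') \<le> L * norm (z - z')"
    and "\<beta> > 1 - H" and "holder_on \<beta> {0..T} \<sigma>"
    and "B < 0" and "\<And>z y. (z - y) \<bullet> (b z - b y) \<le> B * (norm (z - y))\<^sup>2"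
    and "fractional_brownian_motion M H {0..T} W"
    and "fbm_sde_solution M H T W b \<sigma> x X"
    and "\<alpha> > 0" and "lip_norm V \<le> ereal \<alpha>"
    and "r > 0"
  shows "measure M {\<omega> \<in> space M.
            1 / T * integral {0..T} (\<lambda>t. V (X t \<omega>) - (\<integral>\<omega>'. V (X t \<omega>') \<partial>M)) > r}
         \<le> exp (- (r\<^sup>2 * B\<^sup>2 * T powr (2 - 2 * H) /
                   (4 * \<alpha>\<^sup>2 * H * (SUP s\<in>{0..T}. norm (\<sigma> s))\<^sup>2 * (1 - exp (B * T)))))"
proof -
  interpret prob_space M by fact
  obtain L where lip: "\<And>z z'. norm (b z - b z') \<le> L * norm (z - z')" using assms(5) by blast
  note fbm = \<open>fractional_brownian_motion M H {0..T} W\<close>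
  have "0 < \<beta>" using assms(3,6) by simp
  with assms(7) have "continuous_on {0..T} \<sigma>" by (rule holder_on_continuous)
  then have "compact ((\<lambda>s. norm (\<sigma> s)) ` {0..T})"
    by (intro compact_continuous_image continuous_on_norm) auto
  then have "bdd_above ((\<lambda>s. norm (\<sigma> s)) ` {0..T})"
    by (intro bounded_imp_bdd_above compact_imp_bounded)
  then have S: "norm (\<sigma> s) \<le> (SUP s\<in>{0..T}. norm (\<sigma> s))" if "s \<in> {0..T}" for s
    using that by (intro cSUP_upper)
  note sol = \<open>fbm_sde_solution M H T W b \<sigma> x X\<close>[unfolded fbm_sde_solution_def]
  have X_meas: "X t \<in> borel_measurable M" if t: "t \<in> {0..T}" for t
  proof (rule augmented_filtration_subset)
    show "X t \<in> borel_measurable (augmented_filtration M W t)" using sol t by blast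
    show "W s \<in> borel_measurable M" if "s \<in> {0..t}" for s
      using that t by (intro fbm_measurable[OF fbm]) auto
  qed
  have X_cont: "continuous_on {0..T} (\<lambda>t. X t \<omega>)" if "\<omega> \<in> space M" for \<omega>
  proof (rule holder_on_continuous)
    have "0 < H / 2" "H / 2 < H" using assms(2) by auto
    with sol that show "holder_on (H - H / 2) {0..T} (\<lambda>t. X t \<omega>)" by blast
    show "0 < H - H / 2" using assms(2) by simp
  qed
  have X_eq: "AE \<omega> in M. \<forall>t\<in>{0..T}. \<forall>i. \<exists>J.
       (\<forall>j. has_rs_integral (\<lambda>s. \<sigma> s $ i $ j) (\<lambda>s. W s \<omega> $ j) 0 t (J j)) \<and>
       X t \<omega> $ i = x $ i + integral {0..t} (\<lambda>s. b (X s \<omega>) $ i) + (\<Sum>j\<in>UNIV. J j)"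
    using sol by blast
  show ?thesis
    by (rule time_average_tail[OF assms(2,4,8) lip assms(9) S fbm X_meas X_cont X_eq
      lip_norm_bound[OF assms(13)] assms(12,14)])
qed

end
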